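(* Let $\mathbb G$ be a Carnot group, let $S\subset\mathbb G$ be a $C^2$-smooth hypersurface and let $\varphi\in C^1(S)$. Then $$\int_S|\operatorname{grad}_{HS}\varphi(x)|\,\sigma_H^{n-1}(x)=\int_{\mathbb R}\sigma_H^{n-2}\{\varphi^{-1}[s]\cap S\}\,ds$$ and $$\int_S\psi(x)\,|\operatorname{grad}_{HS}\varphi(x)|\,\sigma_H^{n-1}(x)=\int_{\mathbb R}ds\int_{\varphi^{-1}[s]\cap S}\psi(y)\,\sigma_H^{n-2}(y)$$ for every $\psi\in L^1(S,\sigma_H^{n-1})$.
   Context: Carnot group: an $n$-dimensional connected, simply connected nilpotent Lie group $\mathbb G$ whose Lie algebra is stratified, $\mathfrak g=H_1\oplus\dots\oplus H_k$, $[H_1,H_{i-1}]=H_i$ ($2\le i\le k$), $[H_1,H_k]=0$. $H=H_1$ is also viewed as a left-invariant subbundle of $T\mathbb G$. A left-invariant frame adapted to the stratification is fixed together with the left-invariant Riemannian metric making it orthonormal; $\sigma_R^m$ is the $m$-dimensional Riemannian measure and $P_E$ orthogonal projection onto $E$. Hypersurfaces: $\nu$ is the Riemannian unit normal of $S$, $C_S=\{x\in S:P_H\nu=0\}$. The $H$-perimeter measure on $S$ is $\sigma_H^{n-1}=|P_H\nu|\sigma_R^{n-1}$. $HS=H\cap TS$ (on $S\setminus C_S$, of rank $\dim H-1$), and $\operatorname{grad}_{HS}\varphi$ is the orthogonal projection onto $HS$ of the tangential Riemannian gradient of $\varphi$ on $S$. On an $(n-2)$-dimensional submanifold $N\subset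 S$ with unit normal $\eta\in TS$, $\sigma_H^{n-2}=|P_H\nu|\,|P_{HS}\eta|\,\sigma_R^{n-2}$. The measure $\sigma_H^{n-2}$ on a level set $\varphi^{-1}[s]$ is understood on the $C^1$-submanifold of its points where $d\varphi\ne0$ (points where $d\varphi=0$ contribute zero). *)

theory Defs
  imports
    "HOL-Analysis.Analysis"
    "HOL-Algebra.Generated_Groups"
    "HOL-Combinatorics.Permutations"
begin

section \<open>Functions of class \<open>C\<^sup>k\<close>\<close>

text \<open>The set \<open>D\<close> consists of coordinate directions and \<open>U\<close> is meant to be a relatively open subset of
  \<open>span D\<close>. For \<open>D = Basis\<close> this is the usual notion on open subsets of a Euclidean space; for
  \<open>card D = m\<close> it is the usual notion on open subsets of \<open>\<real>\<^sup>m\<close>. The derivative within \<open>U\<close> is determined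
  on \<open>span D\<close> only, and it is evaluated only there.\<close>

fun C_on :: "nat \<Rightarrow> 'e::euclidean_space set \<Rightarrow> ('e \<Rightarrow> 'b::real_normed_vector) \<Rightarrow> 'e set \<Rightarrow> bool" where
  "C_on 0 D f U \<longleftrightarrow> continuous_on U f"
| "C_on (Suc k) D f U \<longleftrightarrow>
     f differentiable_on U \<and> (\<forall>b\<in>D. C_on k D (\<lambda>u. frechet_derivative f (at u within U) b) U)"

definition smooth_on :: "('e::euclidean_space \<Rightarrow> 'b::real_normed_vector) \<Rightarrow> 'e set \<Rightarrow> bool" where
  "smooth_on f U \<longleftrightarrow> (\<forall>k. C_on k Basis f U)"


section \<open>Smooth atlases and Lie groups\<close>

type_synonym ('g, 'e) chart = "'g set \<times> ('g \<Rightarrow> 'e)"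

definition smooth_atlas :: "('g::topological_space, 'e::euclidean_space) chart set \<Rightarrow> bool" where
  "smooth_atlas A \<longleftrightarrow>
     (\<forall>(U, x)\<in>A. open U \<and> open (x ` U) \<and> (\<exists>y. homeomorphism U (x ` U) x y)) \<and>
     (\<Union>(U, x)\<in>A. U) = UNIV \<and>
     (\<forall>(U, x)\<in>A. \<forall>(V, y)\<in>A. smooth_on (y \<circ> inv_into U x) (x ` (U \<inter> V)))"

definition prod_atlas :: "('g, 'e) chart set \<Rightarrow> ('h, 'f) chart set \<Rightarrow> ('g \<times> 'h, 'e \<times> 'f) chart set" where
  "prod_atlas A B = {(U \<times> V, map_prod x y) | U x V y. (U, x) \<in> A \<and> (V, y) \<in> B}"

definition smooth_map ::
  "('g::topological_space, 'e::euclidean_space) chart set \<Rightarrow>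
   ('h::topological_space, 'f::euclidean_space) chart set \<Rightarrow> ('g \<Rightarrow> 'h) \<Rightarrow> bool" where
  "smooth_map A B f \<longleftrightarrow> continuous_on UNIV f \<and>
     (\<forall>(U, x)\<in>A. \<forall>(V, y)\<in>B. smooth_on (y \<circ> f \<circ> inv_into U x) (x ` (U \<inter> f -` V)))"

text \<open>The data of a Carnot group. The chart \<open>id_chart\<close> is a chart around the identity. It identifies the
  Lie algebra \<open>\<gg> = T\<^sub>1G\<close> with the model space \<open>'e\<close>, and its coordinate vectors at the identity are the
  vectors of the fixed frame. Every basis of \<open>T\<^sub>1G\<close> is of this form, by composing a chart with a linear
  isomorphism. Hence the fixed left-invariant frame corresponds to \<open>Basis\<close>, and the left-invariant
  Riemannian metric making it orthonormal corresponds to the inner product of \<open>'e\<close>. The dimension \<open>n\<close> is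
  \<open>DIM('e)\<close>, and \<open>layer G i\<close> is \<open>H\<^sub>i\<close> for \<open>1 \<le> i \<le> step G\<close>.\<close>

record ('g, 'e) carnot = "'g monoid" +
  atlas :: "('g, 'e) chart set"
  id_chart :: "('g, 'e) chart"
  step :: nat
  layer :: "nat \<Rightarrow> 'e set"

abbreviation id_coord :: "('g, 'e) carnot \<Rightarrow> 'g \<Rightarrow> 'e" where
  "id_coord G \<equiv> snd (id_chart G)"

text \<open>The left-invariant vector field with value \<open>v\<close> at the identity, acting on functions.\<close>

definition left_field ::
  "('g::topological_space, 'e::euclidean_space) carnot \<Rightarrow> 'e \<Rightarrow> ('g \<Rightarrow> 'b::real_normed_vector) \<Rightarrow> 'g \<Rightarrow> 'b"
  where
  "left_field G v f p =
     vector_derivative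
       (\<lambda>t. f (p \<otimes>\<^bsub>G\<^esub> inv_into (fst (id_chart G)) (id_coord G) (id_coord G \<one>\<^bsub>G\<^esub> + t *\<^sub>R v))) (at 0)"

text \<open>The value at the identity of the commutator of two left-invariant vector fields; its components are
  obtained by applying the commutator to the coordinate functions.\<close>

definition bracket :: "('g::topological_space, 'e::euclidean_space) carnot \<Rightarrow> 'e \<Rightarrow> 'e \<Rightarrow> 'e" where
  "bracket G v w =
     left_field G v (left_field G w (id_coord G)) \<one>\<^bsub>G\<^esub> - left_field G w (left_field G v (id_coord G)) \<one>\<^bsub>G\<^esub>"

primrec lower_central :: "('a, 'm) monoid_scheme \<Rightarrow> nat \<Rightarrow> 'a set" where
  "lower_central G 0 = carrier G"
| "lower_central G (Suc i) =
     generate G {h \<otimes>\<^bsub>G\<^esub> l \<otimes>\<^bsub>G\<^esub> inv\<^bsub>G\<^esub> h \<otimes>\<^bsub>G\<^esub> inv\<^bsub>G\<^esub> l | h l. h \<in> carrier G \<and> l \<in> lower_central G i}"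

locale carnot_group = group G
  for G :: "('g::{t2_space, second_countable_topology}, 'e::euclidean_space) carnot" (structure) +
  assumes carrier_UNIV: "carrier G = UNIV"
    and smooth_atlas: "smooth_atlas (atlas G)"
    and smooth_mult: "smooth_map (prod_atlas (atlas G) (atlas G)) (atlas G) (\<lambda>(p, q). p \<otimes> q)"
    and smooth_inv: "smooth_map (atlas G) (atlas G) (\<lambda>p. inv p)"
    and connected_group: "connected (UNIV :: 'g set)"
    and simply_connected_group: "simply_connected (UNIV :: 'g set)"
    and nilpotent_group: "\<exists>c. lower_central G c = {\<one>}"
    and id_chart: "id_chart G \<in> atlas G" "\<one> \<in> fst (id_chart G)"
    and step: "step G \<ge> 1"
    and subspace_layer: "\<And>i. i \<in> {1..step G} \<Longrightarrow> subspace (layer G i)"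
    and direct_sum: "\<And>v. \<exists>!w. w \<in> (\<Pi>\<^sub>E i\<in>{1..step G}. layer G i) \<and> v = (\<Sum>i\<in>{1..step G}. w i)"
    and adapted_frame: "\<And>i. i \<in> {1..step G} \<Longrightarrow> layer G i = span (layer G i \<inter> Basis)"
    and bracket_layer: "\<And>i. i \<in> {2..step G} \<Longrightarrow>
          span {bracket G v w | v w. v \<in> layer G 1 \<and> w \<in> layer G (i - 1)} = layer G i"
    and bracket_last: "\<And>v w. v \<in> layer G 1 \<Longrightarrow> w \<in> layer G (step G) \<Longrightarrow> bracket G v w = 0"


section \<open>Tangent spaces\<close>

text \<open>All tangent spaces \<open>T\<^sub>pG\<close> are identified with \<open>'e\<close> by left translation to the identity; thus vectors
  are given by their components in the left-invariant frame, and the horizontal bundle is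
  \<open>layer G 1\<close> at every point.\<close>

definition has_velocity ::
  "('g::topological_space, 'e::euclidean_space) carnot \<Rightarrow> (real \<Rightarrow> 'g) \<Rightarrow> 'e \<Rightarrow> real \<Rightarrow> bool" where
  "has_velocity G \<gamma> v t \<longleftrightarrow> isCont \<gamma> t \<and>
     ((\<lambda>s. id_coord G (inv\<^bsub>G\<^esub> (\<gamma> t) \<otimes>\<^bsub>G\<^esub> \<gamma> s)) has_vector_derivative v) (at t)"

definition tangent_space ::
  "('g::topological_space, 'e::euclidean_space) carnot \<Rightarrow> 'g set \<Rightarrow> 'g \<Rightarrow> 'e set" where
  "tangent_space G N p = {v. \<exists>\<gamma>. range \<gamma> \<subseteq> N \<and> \<gamma> 0 = p \<and> has_velocity G \<gamma> v 0}"

definition orth_proj :: "'e::euclidean_space set \<Rightarrow> 'e \<Rightarrow> 'e" where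
  "orth_proj E v = (THE w. w \<in> E \<and> (\<forall>e\<in>E. (v - w) \<bullet> e = 0))"

text \<open>A unit vector of \<open>E\<close> normal to \<open>N\<close>. It will be used when \<open>T\<^sub>pN\<close> has codimension one in \<open>E\<close>; it is
  then unique up to sign, and only norms of its projections matter.\<close>

definition unit_normal ::
  "('g::topological_space, 'e::euclidean_space) carnot \<Rightarrow> 'e set \<Rightarrow> 'g set \<Rightarrow> 'g \<Rightarrow> 'e" where
  "unit_normal G E N p = (SOME \<nu>. \<nu> \<in> E \<and> norm \<nu> = 1 \<and> (\<forall>v\<in>tangent_space G N p. \<nu> \<bullet> v = 0))"


section \<open>Submanifolds and Riemannian measure\<close>

definition partial_velocity ::
  "('g::topological_space, 'e::euclidean_space) carnot \<Rightarrow> ('e \<Rightarrow> 'g) \<Rightarrow> 'e \<Rightarrow> 'e \<Rightarrow> 'e" where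
  "partial_velocity G f u b = (THE v. has_velocity G (\<lambda>t. f (u + t *\<^sub>R b)) v 0)"

text \<open>A local parametrization of class \<open>C\<^sup>k\<close> (with \<open>k \<ge> 1\<close>) of \<open>N\<close>, defined on an open subset \<open>U\<close> of the
  coordinate space \<open>span D \<cong> \<real>\<^sup>m\<close>, where \<open>m = card D\<close>.\<close>

definition local_param ::
  "('g::topological_space, 'e::euclidean_space) carnot \<Rightarrow> nat \<Rightarrow> 'g set \<Rightarrow> 'e set \<Rightarrow> 'e set \<Rightarrow> ('e \<Rightarrow> 'g) \<Rightarrow> bool"
  where
  "local_param G k N D U f \<longleftrightarrow>
     D \<subseteq> Basis \<and> openin (top_of_set (span D)) U \<and>
     openin (top_of_set N) (f ` U) \<and> (\<exists>h. homeomorphism U (f ` U) f h) \<and>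
     (\<forall>(V, y)\<in>atlas G. C_on k D (y \<circ> f) (U \<inter> f -` V)) \<and>
     (\<forall>u\<in>U. \<forall>c. (\<Sum>b\<in>D. c b *\<^sub>R partial_velocity G f u b) = 0 \<longrightarrow> (\<forall>b\<in>D. c b = 0))"

definition submanifold ::
  "('g::topological_space, 'e::euclidean_space) carnot \<Rightarrow> nat \<Rightarrow> nat \<Rightarrow> 'g set \<Rightarrow> bool" where
  "submanifold G k m N \<longleftrightarrow>
     (\<forall>p\<in>N. \<exists>D U f. local_param G k N D U f \<and> card D = m \<and> p \<in> f ` U)"

definition C1_fun ::
  "('g::topological_space, 'e::euclidean_space) carnot \<Rightarrow> 'g set \<Rightarrow> ('g \<Rightarrow> real) \<Rightarrow> bool" where
  "C1_fun G N \<phi> \<longleftrightarrow> (\<forall>D U f. local_param G 1 N D U f \<longrightarrow> C_on 1 D (\<phi> \<circ> f) U)"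

text \<open>Determinant of a matrix with rows and columns indexed by the finite set \<open>D\<close>; Lebesgue measure on
  \<open>span D\<close> for \<open>D \<subseteq> Basis\<close>. For \<open>D = {}\<close> (dimension \<open>0\<close>)
  they are \<open>1\<close> and the unit point mass at \<open>0\<close>.\<close>

definition det_on :: "'i set \<Rightarrow> ('i \<Rightarrow> 'i \<Rightarrow> real) \<Rightarrow> real" where
  "det_on D M = (\<Sum>\<pi> | \<pi> permutes D. of_int (sign \<pi>) * (\<Prod>i\<in>D. M i (\<pi> i)))"

definition lborel_on :: "'e::euclidean_space set \<Rightarrow> 'e measure" where
  "lborel_on D = distr (\<Pi>\<^sub>M b\<in>D. (lborel :: real measure)) borel (\<lambda>x. \<Sum>b\<in>D. x b *\<^sub>R b)"

definition gram_det ::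
  "('g::topological_space, 'e::euclidean_space) carnot \<Rightarrow> 'e set \<Rightarrow> ('e \<Rightarrow> 'g) \<Rightarrow> 'e \<Rightarrow> real" where
  "gram_det G D f u =
     det_on D (\<lambda>b c. partial_velocity G f u b \<bullet> partial_velocity G f u c)"

text \<open>The \<open>m\<close>-dimensional Riemannian measure of an \<open>m\<close>-dimensional \<open>C\<^sup>1\<close> submanifold \<open>N\<close>: the Borel measure
  on \<open>N\<close> with density \<open>sqrt (det (g\<^sub>i\<^sub>j))\<close> in every local parametrization.\<close>

definition riem_measure ::
  "('g::topological_space, 'e::euclidean_space) carnot \<Rightarrow> nat \<Rightarrow> 'g set \<Rightarrow> 'g measure" where
  "riem_measure G m N = (THE \<mu>. sets \<mu> = sets (restrict_space borel N) \<and>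
     (\<forall>D U f. local_param G 1 N D U f \<and> card D = m \<longrightarrow>
        (\<forall>B\<in>sets borel. B \<subseteq> U \<longrightarrow>
           emeasure \<mu> (f ` B) = (\<integral>\<^sup>+u\<in>B. ennreal (sqrt (gram_det G D f u)) \<partial>lborel_on D))))"


section \<open>Horizontal geometry of a hypersurface\<close>

definition tangential_grad ::
  "('g::topological_space, 'e::euclidean_space) carnot \<Rightarrow> 'g set \<Rightarrow> ('g \<Rightarrow> real) \<Rightarrow> 'g \<Rightarrow> 'e" where
  "tangential_grad G S \<phi> p = (THE w. w \<in> tangent_space G S p \<and>
     (\<forall>\<gamma> v. range \<gamma> \<subseteq> S \<and> \<gamma> 0 = p \<and> has_velocity G \<gamma> v 0 \<longrightarrow>
        ((\<phi> \<circ> \<gamma>) has_real_derivative (w \<bullet> v)) (at 0)))"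

definition HS :: "('g::topological_space, 'e::euclidean_space) carnot \<Rightarrow> 'g set \<Rightarrow> 'g \<Rightarrow> 'e set" where
  "HS G S p = layer G 1 \<inter> tangent_space G S p"

definition grad_HS ::
  "('g::topological_space, 'e::euclidean_space) carnot \<Rightarrow> 'g set \<Rightarrow> ('g \<Rightarrow> real) \<Rightarrow> 'g \<Rightarrow> 'e" where
  "grad_HS G S \<phi> p = orth_proj (HS G S p) (tangential_grad G S \<phi> p)"

text \<open>\<open>|P\<^sub>H \<nu>|\<close>, which vanishes exactly on the characteristic set \<open>C\<^sub>S\<close>.\<close>

definition hor_normal_norm ::
  "('g::topological_space, 'e::euclidean_space) carnot \<Rightarrow> 'g set \<Rightarrow> 'g \<Rightarrow> real" where
  "hor_normal_norm G S p = norm (orth_proj (layer G 1) (unit_normal G UNIV S p))"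

text \<open>The measures \<open>\<sigma>\<^sub>H\<^sup>n\<^sup>-\<^sup>1\<close> on \<open>S\<close> and \<open>\<sigma>\<^sub>H\<^sup>n\<^sup>-\<^sup>2\<close> on \<open>N \<subseteq> S\<close>. They are completed, so that membership in
  \<open>L\<^sup>1\<close> is not restricted to Borel representatives. If \<open>n = 1\<close>, then the sets \<open>N\<close> below are empty.\<close>

definition sigma_H_hypersurface ::
  "('g::topological_space, 'e::euclidean_space) carnot \<Rightarrow> 'g set \<Rightarrow> 'g measure" where
  "sigma_H_hypersurface G S =
     completion (density (riem_measure G (DIM('e) - 1) S) (\<lambda>p. ennreal (hor_normal_norm G S p)))"

definition sigma_H_codim2 ::
  "('g::topological_space, 'e::euclidean_space) carnot \<Rightarrow> 'g set \<Rightarrow> 'g set \<Rightarrow> 'g measure" where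
  "sigma_H_codim2 G S N =
     completion (density (riem_measure G (DIM('e) - 2) N)
       (\<lambda>p. ennreal (hor_normal_norm G S p *
          norm (orth_proj (HS G S p) (unit_normal G (tangent_space G S p) N p)))))"

text \<open>The part of the level set \<open>\<phi>\<^sup>-\<^sup>1[s] \<inter> S\<close> where \<open>d\<phi> \<noteq> 0\<close>.\<close>

definition regular_level ::
  "('g::topological_space, 'e::euclidean_space) carnot \<Rightarrow> 'g set \<Rightarrow> ('g \<Rightarrow> real) \<Rightarrow> real \<Rightarrow> 'g set" where
  "regular_level G S \<phi> s = {p \<in> S. \<phi> p = s \<and> tangential_grad G S \<phi> p \<noteq> 0}"

abbreviation sigma_H_level ::
  "('g::topological_space, 'e::euclidean_space) carnot \<Rightarrow> 'g set \<Rightarrow> ('g \<Rightarrow> real) \<Rightarrow> real \<Rightarrow> 'g measure" where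
  "sigma_H_level G S \<phi> s \<equiv> sigma_H_codim2 G S (regular_level G S \<phi> s)"

end

(* Where the tangential gradient of phi does not vanish, S has local parametrizations F in which phi
   is one of the coordinates, phi (F w) = w . b; fixing that coordinate parametrizes the level sets.
   By Cramer's rule for the Gram matrix g of F, |grad phi|^2 is the (b, b) entry of its inverse, so
   |grad phi| sqrt (det g) is the square root of the Gram determinant of the slice. Hence the
   Riemannian coarea formula is Fubini's theorem in such a parametrization; it globalizes by a countable
   cover, once the change of variables formula shows that the Riemannian measures exist. The unit normal
   of a level set in S is grad phi / |grad phi| up to sign, so that |P_HS eta| |grad phi| = |grad_HS phi|,
   and the horizontal formula is the Riemannian one for the integrand
   psi |P_H nu| |grad_HS phi| / |grad phi|. *)

theory Submission
  imports Defs
begin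

text \<open>The measures, normals and gradients are given by description and choice operators, so
  each is identified in a parametrization before it is used. Parametrizations are homeomorphisms
  onto their images whose regularity is known in one direction only. The other direction rests on a
  lifting principle: a continuous map whose composition with an immersion is differentiable at a
  point is itself differentiable there. It makes transition maps differentiable. It also turns a
  curve with a velocity at one instant into a parameter curve with a derivative at that instant,
  which identifies the tangent space, defined by such curves, with the span of the partial
  velocities. The change of variables formula concerns full-dimensional Lebesgue measure, whereas
  the dimension of a parameter domain varies; a unit cube in the missing coordinates bridges the
  gap. The horizontal integrand is a quotient that reads 0 / 0 where \<phi> has zero gradient, and
  \<open>grad_HS\<close> may jump at characteristic points, where the rank of \<open>HS\<close>
  changes. Borel measurability holds because \<open>grad_HS\<close> is continuous on the
  characteristic set and on its complement separately.\<close>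

section \<open>Determinants indexed by finite sets\<close>

text \<open>An index type with \<open>DIM('e)\<close> elements makes the matrix calculus and the change of
  variables theorem for \<open>real ^ 'n\<close> available over an abstract Euclidean space.\<close>

typedef (overloaded) 'e basis_index = "Basis :: 'e::euclidean_space set"
  morphisms basis_vec basis_index
  by (rule nonempty_Basis [unfolded ex_in_conv [symmetric]])

instance basis_index :: (euclidean_space) finite
proof
  have "(UNIV :: 'a basis_index set) = basis_index ` Basis"
    by (auto simp: image_iff) (metis basis_vec basis_vec_inverse)
  then show "finite (UNIV :: 'a basis_index set)"
    by (metis finite_Basis finite_imageI)
qed

text \<open>The change of variables theorem \<open>has_measure_differentiable_image\<close> is
  stated for well-ordered finite index types. The order itself is arbitrary; any injective ranking
  by natural numbers supplies it.\<close>

instantiation basis_index :: (euclidean_space) wellorder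
begin

definition basis_index_rank :: "'a basis_index \<Rightarrow> nat" where
  "basis_index_rank = (SOME f. inj f)"

definition "less_eq_basis_index i j \<longleftrightarrow> basis_index_rank i \<le> basis_index_rank j"

definition "less_basis_index i j \<longleftrightarrow> basis_index_rank i < basis_index_rank j"

instance
proof
  have inj: "inj (basis_index_rank :: 'a basis_index \<Rightarrow> nat)"
    unfolding basis_index_rank_def
    using finite_imp_inj_to_nat_seg [of "UNIV :: 'a basis_index set"]
    by (intro someI_ex [of inj]) auto
  show "i = j" if "i \<le> j" "j \<le> i" for i j :: "'a basis_index"
    using that inj by (auto simp: less_eq_basis_index_def inj_def)
  show "P a" if IH: "\<And>i. (\<And>j. j < i \<Longrightarrow> P j) \<Longrightarrow> P i" for P and a :: "'a basis_index"
    by (induction a rule: measure_induct_rule [of basis_index_rank])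
      (rule IH, simp add: less_basis_index_def)
qed (auto simp: less_eq_basis_index_def less_basis_index_def)

end

lemma bij_betw_basis_vec: "D \<subseteq> Basis \<Longrightarrow> bij_betw basis_vec {i. basis_vec i \<in> D} D"
  by (rule bij_betw_byWitness [where f' = basis_index])
    (auto simp: basis_vec_inverse basis_index_inverse subset_iff)

text \<open>Conjugation with \<open>q\<close>, in the form of \<open>map_permutation\<close>, is a
  sign-preserving bijection between the permutations of \<open>J\<close> and those of
  \<open>D\<close>.\<close>

lemma det_on_reindex:
  assumes q: "bij_betw q J D" and J: "finite J"
  shows "det_on D M = det_on J (\<lambda>i j. M (q i) (q j))"
proof -
  have inj: "inj_on q J" and D: "D = q ` J"
    using q by (auto simp: bij_betw_def)
  have bij: "bij_betw (map_permutation J q) {\<pi>. \<pi> permutes J} {\<pi>. \<pi> permutes D}"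
  proof (rule bij_betw_byWitness [where f' = "map_permutation D (inv_into J q)"])
    show "\<forall>\<pi>\<in>{\<pi>. \<pi> permutes J}. map_permutation D (inv_into J q) (map_permutation J q \<pi>) = \<pi>"
      using map_permutation_compose_inv [OF q] inj by auto
    show "\<forall>\<pi>\<in>{\<pi>. \<pi> permutes D}. map_permutation J q (map_permutation D (inv_into J q) \<pi>) = \<pi>"
      using map_permutation_compose_inv [OF bij_betw_inv_into [OF q]] D
      by (auto simp: f_inv_into_f)
    show "map_permutation J q ` {\<pi>. \<pi> permutes J} \<subseteq> {\<pi>. \<pi> permutes D}"
      using map_permutation_permutes [OF q] by auto
    show "map_permutation D (inv_into J q) ` {\<pi>. \<pi> permutes D} \<subseteq> {\<pi>. \<pi> permutes J}"
      using map_permutation_permutes [OF bij_betw_inv_into [OF q]] by auto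
  qed
  have "det_on D M = (\<Sum>\<pi> | \<pi> permutes J. of_int (sign (map_permutation J q \<pi>)) *
      (\<Prod>i\<in>D. M i (map_permutation J q \<pi> i)))"
    unfolding det_on_def by (rule sum.reindex_bij_betw [OF bij, symmetric])
  also have "\<dots> = det_on J (\<lambda>i j. M (q i) (q j))"
    unfolding det_on_def
  proof (rule sum.cong [OF refl])
    fix \<pi> assume "\<pi> \<in> {\<pi>. \<pi> permutes J}"
    then have \<pi>: "\<pi> permutes J" by simp
    have "(\<Prod>i\<in>D. M i (map_permutation J q \<pi> i)) = (\<Prod>i\<in>J. M (q i) (map_permutation J q \<pi> (q i)))"
      by (rule prod.reindex_bij_betw [OF q, symmetric])
    also have "\<dots> = (\<Prod>i\<in>J. M (q i) (q (\<pi> i)))"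
      using inj by (intro prod.cong) (auto simp: map_permutation_apply)
    finally show "of_int (sign (map_permutation J q \<pi>)) * (\<Prod>i\<in>D. M i (map_permutation J q \<pi> i)) =
        of_int (sign \<pi>) * (\<Prod>i\<in>J. M (q i) (q (\<pi> i)))"
      using sign_map_permutation [OF inj \<pi> J] by simp
  qed
  finally show ?thesis .
qed

definition pad_matrix :: "'n set \<Rightarrow> ('n \<Rightarrow> 'n \<Rightarrow> real) \<Rightarrow> real ^ 'n ^ 'n" where
  "pad_matrix J M = (\<chi> i j. if i \<in> J \<and> j \<in> J then M i j else if i = j then 1 else 0)"

text \<open>A permutation that moves an index outside \<open>J\<close> meets an off-diagonal zero of
  the identity block there. The remaining permutations are those of \<open>J\<close>, for which the
  identity block contributes ones.\<close>

lemma det_pad_matrix: "det (pad_matrix J M) = det_on J M" for J :: "'n::finite set"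
proof -
  let ?g = "\<lambda>\<pi>. of_int (sign \<pi>) * (\<Prod>i\<in>UNIV. pad_matrix J M $ i $ \<pi> i)"
  have "det (pad_matrix J M) = sum ?g {\<pi>. \<pi> permutes J}"
    unfolding det_def
  proof (rule sum.mono_neutral_right)
    show "{\<pi>. \<pi> permutes J} \<subseteq> {\<pi>. \<pi> permutes UNIV}"
      using permutes_subset by blast
    show "\<forall>\<pi>\<in>{\<pi>. \<pi> permutes UNIV} - {\<pi>. \<pi> permutes J}. ?g \<pi> = 0"
    proof
      fix \<pi> assume \<pi>: "\<pi> \<in> {\<pi>. \<pi> permutes UNIV} - {\<pi>. \<pi> permutes J}"
      then obtain i where "i \<notin> J" "\<pi> i \<noteq> i"
        by (auto simp: permutes_def)
      then have "pad_matrix J M $ i $ \<pi> i = 0"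
        by (simp add: pad_matrix_def)
      then show "?g \<pi> = 0" by auto
    qed
  qed (simp add: finite_permutations)
  also have "\<dots> = det_on J M"
    unfolding det_on_def
  proof (intro sum.cong refl arg_cong2 [where f = "(*)"])
    fix \<pi> assume "\<pi> \<in> {\<pi>. \<pi> permutes J}"
    then have \<pi>: "\<pi> permutes J" by simp
    show "(\<Prod>i\<in>UNIV. pad_matrix J M $ i $ \<pi> i) = (\<Prod>i\<in>J. M i (\<pi> i))"
    proof (rule prod.mono_neutral_cong_right)
      show "\<forall>i\<in>UNIV - J. pad_matrix J M $ i $ \<pi> i = 1"
        using \<pi> by (auto simp: pad_matrix_def permutes_not_in)
      show "pad_matrix J M $ i $ \<pi> i = M i (\<pi> i)" if "i \<in> J" for i
        using that \<pi> by (simp add: pad_matrix_def permutes_in_image)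
    qed auto
  qed
  finally show ?thesis .
qed

lemma det_on_cong:
  assumes "\<And>i j. i \<in> D \<Longrightarrow> j \<in> D \<Longrightarrow> M i j = M' i j"
  shows "det_on D M = det_on D M'"
proof -
  have "(\<Prod>i\<in>D. M i (\<pi> i)) = (\<Prod>i\<in>D. M' i (\<pi> i))" if "\<pi> permutes D" for \<pi>
    using that by (intro prod.cong) (auto simp: assms permutes_in_image)
  then show ?thesis
    unfolding det_on_def by (intro sum.cong) auto
qed

lemma det_on_transpose: "finite D \<Longrightarrow> det_on D (\<lambda>i j. M j i) = det_on D M"
proof -
  assume fin: "finite D"
  have "det_on D (\<lambda>i j. M j i) =
      (\<Sum>\<pi> | \<pi> permutes D. of_int (sign (inv_into UNIV \<pi>)) * (\<Prod>i\<in>D. M (inv_into UNIV \<pi> i) i))"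
    unfolding det_on_def
    by (rule sum_permutations_inverse)
  also have "\<dots> = det_on D M"
    unfolding det_on_def
  proof (intro sum.cong refl arg_cong2 [where f = "(*)"])
    fix \<pi> assume "\<pi> \<in> {\<pi>. \<pi> permutes D}"
    then have \<pi>: "\<pi> permutes D" by simp
    show "real_of_int (sign (inv_into UNIV \<pi>)) = real_of_int (sign \<pi>)"
      using \<pi> fin permutation_permutes sign_inverse by (metis)
    have "(\<Prod>i\<in>D. M i (\<pi> i)) = (\<Prod>i\<in>D. M (inv_into UNIV \<pi> i) (\<pi> (inv_into UNIV \<pi> i)))"
      by (rule prod.reindex_bij_betw [OF permutes_imp_bij [OF permutes_inv [OF \<pi>]], symmetric])
    then show "(\<Prod>i\<in>D. M (inv_into UNIV \<pi> i) i) = (\<Prod>i\<in>D. M i (\<pi> i))"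
      using \<pi> by (simp add: permutes_inverses)
  qed
  finally show ?thesis .
qed

text \<open>Padding with an identity block is multiplicative, so the product rule follows from
  \<open>det_mul\<close> for square matrices.\<close>

lemma det_on_mult:
  fixes D :: "'e::euclidean_space set"
  assumes D: "D \<subseteq> Basis"
  shows "det_on D (\<lambda>i j. \<Sum>k\<in>D. A i k * B k j) = det_on D A * det_on D B"
proof -
  define J where "J = {i. basis_vec i \<in> D}"
  have q: "bij_betw basis_vec J D"
    unfolding J_def by (rule bij_betw_basis_vec [OF D])
  let ?pad = "\<lambda>M. pad_matrix J (\<lambda>i j. M (basis_vec i) (basis_vec j))"
  have det: "det_on D M = det (?pad M)" for M
    by (simp add: det_on_reindex [OF q] det_pad_matrix)
  have "?pad (\<lambda>i j. \<Sum>k\<in>D. A i k * B k j) = ?pad A ** ?pad B"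
  proof (simp add: vec_eq_iff matrix_matrix_mult_def, intro allI)
    fix i j :: "'e basis_index"
    show "?pad (\<lambda>i j. \<Sum>k\<in>D. A i k * B k j) $ i $ j =
        (\<Sum>k\<in>UNIV. ?pad A $ i $ k * ?pad B $ k $ j)"
    proof (cases "i \<in> J")
      case True
      have "(\<Sum>k\<in>UNIV. ?pad A $ i $ k * ?pad B $ k $ j) = (\<Sum>k\<in>J. ?pad A $ i $ k * ?pad B $ k $ j)"
        using True by (intro sum.mono_neutral_right) (auto simp: pad_matrix_def)
      also have "\<dots> = (if j \<in> J then
          (\<Sum>k\<in>J. A (basis_vec i) (basis_vec k) * B (basis_vec k) (basis_vec j)) else 0)"
        using True by (auto simp: pad_matrix_def intro!: sum.neutral)
      also have "(\<Sum>k\<in>J. A (basis_vec i) (basis_vec k) * B (basis_vec k) (basis_vec j)) =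
          (\<Sum>k\<in>D. A (basis_vec i) k * B k (basis_vec j))"
        by (rule sum.reindex_bij_betw [OF q])
      finally show ?thesis
        using True by (auto simp: pad_matrix_def)
    next
      case False
      have "(\<Sum>k\<in>UNIV. ?pad A $ i $ k * ?pad B $ k $ j) = (\<Sum>k\<in>{i}. ?pad A $ i $ k * ?pad B $ k $ j)"
        using False by (intro sum.mono_neutral_right) (auto simp: pad_matrix_def)
      then show ?thesis
        using False by (auto simp: pad_matrix_def)
    qed
  qed
  then show ?thesis
    by (simp add: det det_mul)
qed

text \<open>Only permutations that fix \<open>b\<close> survive: this is Laplace expansion along a
  row that is a unit vector.\<close>

lemma det_on_row_unit:
  assumes D: "finite D" "b \<in> D" and M: "\<And>j. j \<in> D \<Longrightarrow> M b j = (if j = b then 1 else 0)"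
  shows "det_on D M = det_on (D - {b}) M"
proof -
  have "det_on D M = (\<Sum>\<pi> | \<pi> permutes (D - {b}). of_int (sign \<pi>) * (\<Prod>i\<in>D. M i (\<pi> i)))"
    unfolding det_on_def
  proof (rule sum.mono_neutral_right)
    show "finite {\<pi>. \<pi> permutes D}" using D by (simp add: finite_permutations)
    show "{\<pi>. \<pi> permutes D - {b}} \<subseteq> {\<pi>. \<pi> permutes D}"
      using permutes_subset by blast
    show "\<forall>\<pi>\<in>{\<pi>. \<pi> permutes D} - {\<pi>. \<pi> permutes D - {b}}. of_int (sign \<pi>) * (\<Prod>i\<in>D. M i (\<pi> i)) = 0"
    proof
      fix \<pi> assume \<pi>: "\<pi> \<in> {\<pi>. \<pi> permutes D} - {\<pi>. \<pi> permutes D - {b}}"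
      then have "\<pi> b \<noteq> b" "\<pi> b \<in> D"
        using D by (auto simp: permutes_def)
      then have "M b (\<pi> b) = 0" using M by simp
      then show "of_int (sign \<pi>) * (\<Prod>i\<in>D. M i (\<pi> i)) = 0" using D by auto
    qed
  qed
  also have "\<dots> = det_on (D - {b}) M"
    unfolding det_on_def
  proof (intro sum.cong refl arg_cong2 [where f = "(*)"])
    fix \<pi> assume "\<pi> \<in> {\<pi>. \<pi> permutes D - {b}}"
    then have "\<pi> b = b" by (auto simp: permutes_def)
    then show "(\<Prod>i\<in>D. M i (\<pi> i)) = (\<Prod>i\<in>D - {b}. M i (\<pi> i))"
      using D M by (simp add: prod.remove)
  qed
  finally show ?thesis .
qed

text \<open>A permutation other than the identity moves at least two indices, so some row other than
  \<open>b\<close> contributes a zero. In \<open>det_on_cofactor\<close> this matrix acts from the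
  left and replaces row \<open>b\<close> by a combination of all rows.\<close>

lemma det_on_identity_row:
  assumes D: "finite D" "b \<in> D"
  shows "det_on D (\<lambda>i j. if i = b then c j else if i = j then 1 else 0) = (c b :: real)"
proof -
  let ?M = "\<lambda>i j. if i = b then c j else if i = j then 1 else (0::real)"
  have "det_on D ?M = (\<Sum>\<pi>\<in>{id}. of_int (sign \<pi>) * (\<Prod>i\<in>D. ?M i (\<pi> i)))"
    unfolding det_on_def
  proof (rule sum.mono_neutral_right)
    show "finite {\<pi>. \<pi> permutes D}" using D by (simp add: finite_permutations)
    show "{id} \<subseteq> {\<pi>. \<pi> permutes D}" by (simp add: permutes_id)
    show "\<forall>\<pi>\<in>{\<pi>. \<pi> permutes D} - {id}. of_int (sign \<pi>) * (\<Prod>i\<in>D. ?M i (\<pi> i)) = 0"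
    proof
      fix \<pi> assume \<pi>: "\<pi> \<in> {\<pi>. \<pi> permutes D} - {id}"
      have "\<exists>i\<in>D. i \<noteq> b \<and> \<pi> i \<noteq> i"
      proof (rule ccontr)
        assume "\<not> (\<exists>i\<in>D. i \<noteq> b \<and> \<pi> i \<noteq> i)"
        then have fixed: "\<pi> i = i" if "i \<noteq> b" for i
          using \<pi> that by (auto simp: permutes_def)
        moreover have "\<pi> b = b"
          using \<pi> fixed [of "\<pi> b"] permutes_inj [of \<pi> D] by (auto simp: inj_eq)
        ultimately have "\<pi> = id" by (auto simp: fun_eq_iff) metis
        with \<pi> show False by simp
      qed
      then have "\<exists>i\<in>D. ?M i (\<pi> i) = 0" by force
      then have "(\<Prod>i\<in>D. ?M i (\<pi> i)) = 0"
        by (intro prod_zero D)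
      then show "of_int (sign \<pi>) * (\<Prod>i\<in>D. ?M i (\<pi> i)) = 0" by simp
    qed
  qed
  also have "\<dots> = (\<Prod>i\<in>D. if i = b then c i else 1)"
    by (auto intro!: prod.cong)
  also have "\<dots> = c b"
    using D by simp
  finally show ?thesis .
qed

text \<open>Both sides are the determinant of \<open>M\<close> with row \<open>b\<close> replaced by the combination
  with coefficients \<open>c\<close> of all its rows.\<close>

lemma det_on_cofactor:
  fixes D :: "'e::euclidean_space set"
  assumes D: "D \<subseteq> Basis" "b \<in> D"
    and c: "\<And>j. j \<in> D \<Longrightarrow> (\<Sum>i\<in>D. c i * M i j) = (if j = b then 1 else 0)"
  shows "c b * det_on D M = det_on (D - {b}) M"
proof -
  have fin: "finite D" using D finite_Basis finite_subset by blast
  let ?E = "\<lambda>i j. if i = b then c j else if i = j then 1 else (0::real)"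
  have "c b * det_on D M = det_on D ?E * det_on D M"
    using fin D by (simp add: det_on_identity_row)
  also have "\<dots> = det_on D (\<lambda>i j. \<Sum>k\<in>D. ?E i k * M k j)"
    by (simp add: det_on_mult [OF D(1)])
  also have "\<dots> = det_on D (\<lambda>i j. if i = b then \<Sum>k\<in>D. c k * M k j else M i j)"
    using fin by (intro det_on_cong) (auto simp: if_distrib [where f = "\<lambda>x. x * _"] cong: if_cong)
  also have "\<dots> = det_on (D - {b}) (\<lambda>i j. if i = b then \<Sum>k\<in>D. c k * M k j else M i j)"
    using fin D c by (intro det_on_row_unit) auto
  also have "\<dots> = det_on (D - {b}) M"
    by (intro det_on_cong) auto
  finally show ?thesis .
qed

text \<open>This is the transformation rule of Gram matrices under a change of frame. The bijection
  \<beta> only matches the index sets, so that \<open>T\<close> becomes a square matrix with a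
  determinant.\<close>

lemma det_on_congruence:
  fixes D D' :: "'e::euclidean_space set"
  assumes D: "D \<subseteq> Basis" "D' \<subseteq> Basis" and \<beta>: "bij_betw \<beta> D' D"
  shows "det_on D' (\<lambda>i j. \<Sum>k\<in>D. \<Sum>l\<in>D. T k i * T l j * M k l) =
    (det_on D' (\<lambda>i j. T (\<beta> i) j))\<^sup>2 * det_on D M"
proof -
  have fin: "finite D'" using D finite_Basis finite_subset by blast
  have "det_on D' (\<lambda>i j. \<Sum>k\<in>D. \<Sum>l\<in>D. T k i * T l j * M k l) =
      det_on D' (\<lambda>i j. \<Sum>k\<in>D'. T (\<beta> k) i * (\<Sum>l\<in>D'. M (\<beta> k) (\<beta> l) * T (\<beta> l) j))"
    by (simp add: sum.reindex_bij_betw [OF \<beta>, symmetric] sum_distrib_left mult_ac)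
  also have "\<dots> = det_on D' (\<lambda>i k. T (\<beta> k) i) *
      (det_on D' (\<lambda>k l. M (\<beta> k) (\<beta> l)) * det_on D' (\<lambda>l j. T (\<beta> l) j))"
    by (simp add: det_on_mult [OF D(2), of "\<lambda>i k. T (\<beta> k) i" "\<lambda>k j. \<Sum>l\<in>D'. M (\<beta> k) (\<beta> l) * T (\<beta> l) j"]
        det_on_mult [OF D(2), of "\<lambda>k l. M (\<beta> k) (\<beta> l)" "\<lambda>l j. T (\<beta> l) j"])
  also have "det_on D' (\<lambda>i k. T (\<beta> k) i) = det_on D' (\<lambda>i j. T (\<beta> i) j)"
    using det_on_transpose [OF fin, of "\<lambda>i j. T (\<beta> i) j"] .
  also have "det_on D' (\<lambda>k l. M (\<beta> k) (\<beta> l)) = det_on D M"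
    using det_on_reindex [OF \<beta> fin, of M] by simp
  finally show ?thesis
    by (simp add: power2_eq_square)
qed

section \<open>Lebesgue measure on coordinate subspaces\<close>

lemma sets_lborel_on [simp, measurable_cong]: "sets (lborel_on D) = sets borel"
  and space_lborel_on [simp]: "space (lborel_on D) = UNIV"
  by (simp_all add: lborel_on_def)

interpretation lborel_product: product_sigma_finite "\<lambda>_. lborel :: real measure" ..

lemma measurable_coords_sum [measurable]:
  "finite D \<Longrightarrow> (\<lambda>x. \<Sum>b\<in>D. x b *\<^sub>R b) \<in> borel_measurable (\<Pi>\<^sub>M b\<in>D. (lborel :: real measure))"
  for D :: "'e::euclidean_space set"
  by measurable

lemma nn_integral_lborel_on:
  assumes "finite D" "g \<in> borel_measurable borel"
  shows "(\<integral>\<^sup>+u. g u \<partial>lborel_on D) =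
    (\<integral>\<^sup>+x. g (\<Sum>b\<in>D. x b *\<^sub>R b) \<partial>(\<Pi>\<^sub>M b\<in>D. (lborel :: real measure)))"
  unfolding lborel_on_def using assms
  by (intro nn_integral_distr) measurable

text \<open>Tonelli with the coordinate \<open>b\<close> integrated last. In the coarea formula
  \<open>s\<close> is the value of \<phi> and \<open>D\<close> indexes the coordinates on the level
  set; for empty \<open>D\<close> the inner integral is the value of \<open>g\<close> at
  \<open>s *\<^sub>R b\<close>.\<close>

lemma lborel_on_insert:
  fixes D :: "'e::euclidean_space set"
  assumes D: "finite D" "b \<notin> D" and g: "g \<in> borel_measurable borel"
  shows "(\<lambda>s. \<integral>\<^sup>+t. g (t + s *\<^sub>R b) \<partial>lborel_on D) \<in> borel_measurable borel"
    and "(\<integral>\<^sup>+u. g u \<partial>lborel_on (insert b D)) = (\<integral>\<^sup>+s. (\<integral>\<^sup>+t. g (t + s *\<^sub>R b) \<partial>lborel_on D) \<partial>lborel)"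
proof -
  note [measurable] = g D(1)
  interpret D: finite_product_sigma_finite "\<lambda>_. lborel :: real measure" D
    by standard (rule D)
  have eq: "(\<integral>\<^sup>+t. g (t + s *\<^sub>R b) \<partial>lborel_on D) =
      (\<integral>\<^sup>+x. g ((\<Sum>c\<in>D. x c *\<^sub>R c) + s *\<^sub>R b) \<partial>(\<Pi>\<^sub>M b\<in>D. lborel))" for s
    by (rule nn_integral_lborel_on) (use D in measurable)
  show "(\<lambda>s. \<integral>\<^sup>+t. g (t + s *\<^sub>R b) \<partial>lborel_on D) \<in> borel_measurable borel"
    unfolding eq by measurable
  have "(\<integral>\<^sup>+u. g u \<partial>lborel_on (insert b D)) =
      (\<integral>\<^sup>+x. g (\<Sum>c\<in>insert b D. x c *\<^sub>R c) \<partial>(\<Pi>\<^sub>M b\<in>insert b D. lborel))"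
    using D g by (intro nn_integral_lborel_on) auto
  also have "\<dots> = (\<integral>\<^sup>+s. (\<integral>\<^sup>+x. g (\<Sum>c\<in>insert b D. (x(b := s)) c *\<^sub>R c) \<partial>(\<Pi>\<^sub>M b\<in>D. lborel)) \<partial>lborel)"
    using D g by (intro lborel_product.product_nn_integral_insert_rev) measurable
  also have "\<dots> = (\<integral>\<^sup>+s. (\<integral>\<^sup>+t. g (t + s *\<^sub>R b) \<partial>lborel_on D) \<partial>lborel)"
  proof (intro nn_integral_cong)
    fix s
    have "(\<Sum>c\<in>insert b D. (x(b := s)) c *\<^sub>R c) = (\<Sum>c\<in>D. x c *\<^sub>R c) + s *\<^sub>R b" for x :: "'e \<Rightarrow> real"
      using D by (auto simp: intro!: sum.cong)
    then show "(\<integral>\<^sup>+x. g (\<Sum>c\<in>insert b D. (x(b := s)) c *\<^sub>R c) \<partial>(\<Pi>\<^sub>M b\<in>D. lborel)) =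
        (\<integral>\<^sup>+t. g (t + s *\<^sub>R b) \<partial>lborel_on D)"
      by (simp add: eq)
  qed
  finally show "(\<integral>\<^sup>+u. g u \<partial>lborel_on (insert b D)) =
      (\<integral>\<^sup>+s. (\<integral>\<^sup>+t. g (t + s *\<^sub>R b) \<partial>lborel_on D) \<partial>lborel)" .
qed

section \<open>Change of variables in coordinate subspaces\<close>

lemma emeasure_lborel_cart_box:
  fixes A :: "'n::finite \<Rightarrow> real set"
  assumes "\<And>i. A i \<in> sets borel"
  shows "emeasure lborel {x :: real ^ 'n. \<forall>i. x $ i \<in> A i} = (\<Prod>i\<in>UNIV. emeasure lborel (A i))"
proof -
  have [measurable]: "A i \<in> sets borel" for i using assms .
  have inj: "inj (\<lambda>i::'n. axis i (1::real))"
    by (auto simp: inj_def axis_eq_axis)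
  define f where "f = (\<lambda>b::real^'n. indicator (A (the_inv (\<lambda>i. axis i 1) b)) :: real \<Rightarrow> ennreal)"
  have f: "f (axis i 1) = indicator (A i)" for i
    by (simp add: f_def the_inv_f_f [OF inj])
  have bij: "bij_betw (\<lambda>i::'n. axis i (1::real)) UNIV Basis"
    using inj by (auto simp: bij_betw_def Basis_vec_def)
  have "emeasure lborel {x :: real ^ 'n. \<forall>i. x $ i \<in> A i} =
      (\<integral>\<^sup>+x. indicator {x :: real ^ 'n. \<forall>i. x $ i \<in> A i} x \<partial>lborel)"
    by (intro nn_integral_indicator [symmetric]) simp
  also have "\<dots> = (\<integral>\<^sup>+x. (\<Prod>b\<in>Basis. f b (x \<bullet> b)) \<partial>lborel)"
  proof (intro nn_integral_cong)
    fix x :: "real ^ 'n"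
    have "(\<Prod>b\<in>Basis. f b (x \<bullet> b)) = (\<Prod>i\<in>UNIV. f (axis i 1) (x \<bullet> axis i 1))"
      by (rule prod.reindex_bij_betw [OF bij, symmetric])
    also have "\<dots> = (\<Prod>i\<in>UNIV. indicator (A i) (x $ i))"
      by (simp add: f inner_axis)
    also have "\<dots> = indicator {x :: real ^ 'n. \<forall>i. x $ i \<in> A i} x"
      by (auto simp: indicator_def prod_zero_iff)
    finally show "indicator {x :: real ^ 'n. \<forall>i. x $ i \<in> A i} x = (\<Prod>b\<in>Basis. f b (x \<bullet> b))" ..
  qed
  also have "\<dots> = (\<Prod>b\<in>Basis. \<integral>\<^sup>+x. f b x \<partial>lborel)"
    by (intro nn_integral_lborel_prod) (auto simp: f_def)
  also have "\<dots> = (\<Prod>i\<in>UNIV. \<integral>\<^sup>+x. f (axis i 1) x \<partial>lborel)"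
    by (rule prod.reindex_bij_betw [OF bij, symmetric])
  finally show ?thesis
    by (simp add: f)
qed

lemma measurable_combination [measurable]:
  "(\<lambda>x :: real ^ 'n. \<Sum>i\<in>J. x $ i *\<^sub>R (q i :: 'e::euclidean_space)) \<in> borel_measurable borel"
  by measurable

text \<open>Cylinders over subsets of \<open>span D\<close> reduce the change of variables in \<open>card D\<close> dimensions to the
  full-dimensional one.\<close>

lemma emeasure_lborel_on_eq_cylinder:
  fixes D :: "'e::euclidean_space set" and J :: "'n::finite set"
  assumes q: "bij_betw q J D" and B: "B \<in> sets borel"
  shows "emeasure (lborel_on D) B =
    emeasure lborel {x :: real ^ 'n. (\<Sum>i\<in>J. x $ i *\<^sub>R q i) \<in> B \<and> (\<forall>i. i \<notin> J \<longrightarrow> x $ i \<in> {0..1})}"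
proof -
  have D: "finite D" using q bij_betw_finite finite by blast
  note [measurable] = B D
  define r where "r = inv_into J q"
  have r: "r b \<in> J" "q (r b) = b" if "b \<in> D" for b
    using that q by (auto simp: r_def bij_betw_def inv_into_into f_inv_into_f)
  have rq: "r (q i) = i" "q i \<in> D" if "i \<in> J" for i
    using that q by (auto simp: r_def bij_betw_def inv_into_f_f)
  define C where "C = {x :: real ^ 'n. \<forall>i. i \<notin> J \<longrightarrow> x $ i \<in> {0..1}}"
  have C: "C \<in> sets borel" unfolding C_def by measurable
  note [measurable] = C
  \<comment> \<open>\<open>R\<close> reads off the coordinates indexed by \<open>D\<close>. It
    pushes Lebesgue measure on the cylinder \<open>C\<close> forward to the product measure: on
    rectangles, each coordinate outside \<open>J\<close> contributes a factor 1, the length of the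
    unit interval.\<close>
  define R where "R = (\<lambda>x :: real ^ 'n. \<lambda>b\<in>D. x $ r b)"
  have R [measurable]: "R \<in> borel \<rightarrow>\<^sub>M (\<Pi>\<^sub>M b\<in>D. (lborel :: real measure))"
    unfolding R_def by (rule measurable_restrict) simp
  have "distr (density lborel (indicator C)) (\<Pi>\<^sub>M b\<in>D. lborel) R = (\<Pi>\<^sub>M b\<in>D. (lborel :: real measure))"
  proof (rule lborel_product.PiM_eqI [OF D])
    fix A :: "'e \<Rightarrow> real set" assume A: "\<And>b. b \<in> D \<Longrightarrow> A b \<in> sets lborel"
    define A' where "A' i = (if i \<in> J then A (q i) else {0..1})" for i
    have A': "A' i \<in> sets borel" for i using A rq by (auto simp: A'_def)
    have PiE: "Pi\<^sub>E D A \<in> sets (\<Pi>\<^sub>M b\<in>D. (lborel :: real measure))"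
      using D A by (intro sets_PiM_I_finite) auto
    have "emeasure (distr (density lborel (indicator C)) (\<Pi>\<^sub>M b\<in>D. lborel) R) (Pi\<^sub>E D A) =
        emeasure (density lborel (indicator C)) (R -` Pi\<^sub>E D A)"
      using PiE R by (subst emeasure_distr) auto
    also have "\<dots> = emeasure lborel (C \<inter> R -` Pi\<^sub>E D A)"
      using C measurable_sets [OF R PiE] by (subst emeasure_density_const [symmetric] emeasure_density)
        (auto simp: indicator_inter_arith [symmetric] intro!: nn_integral_indicator)
    also have "C \<inter> R -` Pi\<^sub>E D A = {x. \<forall>i. x $ i \<in> A' i}"
    proof (intro subset_antisym subsetI)
      fix x assume x: "x \<in> C \<inter> R -` Pi\<^sub>E D A"
      have "x $ i \<in> A' i" for i
      proof (cases "i \<in> J")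
        case True
        then have "R x (q i) \<in> A (q i)" using x rq by (auto simp: PiE_iff)
        then show ?thesis using True by (simp add: R_def A'_def rq)
      qed (use x in \<open>auto simp: C_def A'_def\<close>)
      then show "x \<in> {x. \<forall>i. x $ i \<in> A' i}" by simp
    next
      fix x assume "x \<in> {x. \<forall>i. x $ i \<in> A' i}"
      then have x: "x $ i \<in> A' i" for i by simp
      have "x $ r b \<in> A b" if "b \<in> D" for b
        using x [of "r b"] r [OF that] by (simp add: A'_def)
      moreover have "x $ i \<in> {0..1}" if "i \<notin> J" for i
        using x [of i] that by (simp add: A'_def)
      ultimately show "x \<in> C \<inter> R -` Pi\<^sub>E D A"
        by (simp add: C_def R_def PiE_iff)
    qed
    also have "emeasure lborel \<dots> = (\<Prod>i\<in>UNIV. emeasure lborel (A' i))"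
      by (rule emeasure_lborel_cart_box [OF A'])
    also have "\<dots> = (\<Prod>i\<in>J. emeasure lborel (A (q i)))"
      by (rule prod.mono_neutral_cong_right) (auto simp: A'_def)
    also have "\<dots> = (\<Prod>b\<in>D. emeasure lborel (A b))"
      by (rule prod.reindex_bij_betw [OF q])
    finally show "emeasure (distr (density lborel (indicator C)) (\<Pi>\<^sub>M b\<in>D. lborel) R) (Pi\<^sub>E D A) =
        (\<Prod>b\<in>D. emeasure lborel (A b))" .
  qed simp
  then have "emeasure (lborel_on D) B =
      emeasure (distr (distr (density lborel (indicator C)) (\<Pi>\<^sub>M b\<in>D. lborel) R) borel
        (\<lambda>x. \<Sum>b\<in>D. x b *\<^sub>R b)) B"
    by (simp add: lborel_on_def)
  also have "\<dots> = emeasure (density lborel (indicator C)) ((\<lambda>x. \<Sum>b\<in>D. R x b *\<^sub>R b) -` B)"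
    by (subst distr_distr) (auto simp: emeasure_distr comp_def)
  also have "(\<lambda>x. \<Sum>b\<in>D. R x b *\<^sub>R b) = (\<lambda>x. \<Sum>i\<in>J. x $ i *\<^sub>R q i)"
  proof
    fix x
    have "(\<Sum>b\<in>D. R x b *\<^sub>R b) = (\<Sum>i\<in>J. R x (q i) *\<^sub>R q i)"
      by (rule sum.reindex_bij_betw [OF q, symmetric])
    also have "\<dots> = (\<Sum>i\<in>J. x $ i *\<^sub>R q i)"
      by (intro sum.cong) (auto simp: R_def rq)
    finally show "(\<Sum>b\<in>D. R x b *\<^sub>R b) = (\<Sum>i\<in>J. x $ i *\<^sub>R q i)" .
  qed
  also have "emeasure (density lborel (indicator C)) ((\<lambda>x. \<Sum>i\<in>J. x $ i *\<^sub>R q i) -` B) =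
      emeasure lborel (C \<inter> ((\<lambda>x. \<Sum>i\<in>J. x $ i *\<^sub>R q i) -` B))"
  proof -
    have "(\<lambda>x :: real^'n. \<Sum>i\<in>J. x $ i *\<^sub>R q i) -` B \<in> sets borel"
      using measurable_sets [OF measurable_combination B] by simp
    then show ?thesis
      using C by (subst emeasure_density) (auto simp: indicator_inter_arith [symmetric])
  qed
  also have "C \<inter> ((\<lambda>x. \<Sum>i\<in>J. x $ i *\<^sub>R q i) -` B) =
      {x :: real ^ 'n. (\<Sum>i\<in>J. x $ i *\<^sub>R q i) \<in> B \<and> (\<forall>i. i \<notin> J \<longrightarrow> x $ i \<in> {0..1})}"
    by (auto simp: C_def)
  finally show ?thesis .
qed

lemma nn_integral_lborel_on_eq_cylinder:
  fixes D :: "'e::euclidean_space set" and J :: "'n::finite set"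
  assumes q: "bij_betw q J D" and g: "g \<in> borel_measurable borel"
  shows "(\<integral>\<^sup>+u. g u \<partial>lborel_on D) =
    (\<integral>\<^sup>+x. g (\<Sum>i\<in>J. x $ i *\<^sub>R q i) * indicator {x. \<forall>i. i \<notin> J \<longrightarrow> x $ i \<in> {0..1}} x \<partial>(lborel :: (real ^ 'n) measure))"
proof -
  define C where "C = {x :: real ^ 'n. \<forall>i. i \<notin> J \<longrightarrow> x $ i \<in> {0..1}}"
  have C [measurable]: "C \<in> sets borel" unfolding C_def by measurable
  note [measurable] = g
  have "lborel_on D = distr (density lborel (indicator C)) borel (\<lambda>x. \<Sum>i\<in>J. x $ i *\<^sub>R q i)"
  proof (rule measure_eqI)
    fix B assume "B \<in> sets (lborel_on D)"
    then have B [measurable]: "B \<in> sets borel" by simp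
    have "(\<lambda>x :: real^'n. \<Sum>i\<in>J. x $ i *\<^sub>R q i) -` B \<in> sets borel"
      using measurable_sets [OF measurable_combination B] by simp
    moreover have "{x :: real ^ 'n. (\<Sum>i\<in>J. x $ i *\<^sub>R q i) \<in> B \<and> (\<forall>i. i \<notin> J \<longrightarrow> x $ i \<in> {0..1})} =
        C \<inter> ((\<lambda>x. \<Sum>i\<in>J. x $ i *\<^sub>R q i) -` B)"
      by (auto simp: C_def)
    ultimately show "emeasure (lborel_on D) B =
        emeasure (distr (density lborel (indicator C)) borel (\<lambda>x. \<Sum>i\<in>J. x $ i *\<^sub>R q i)) B"
      using C B unfolding emeasure_lborel_on_eq_cylinder [OF q B]
      by (auto simp: emeasure_distr emeasure_density indicator_inter_arith [symmetric])
  qed simp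
  then have "(\<integral>\<^sup>+u. g u \<partial>lborel_on D) =
      (\<integral>\<^sup>+u. g u \<partial>distr (density lborel (indicator C)) borel (\<lambda>x. \<Sum>i\<in>J. x $ i *\<^sub>R q i))"
    by simp
  also have "\<dots> = (\<integral>\<^sup>+x. g (\<Sum>i\<in>J. x $ i *\<^sub>R q i) * indicator C x \<partial>lborel)"
    by (simp add: nn_integral_distr nn_integral_density mult.commute)
  finally show ?thesis by (simp add: C_def)
qed

text \<open>\<open>has_measure_differentiable_image\<close> relates a finite measure of the image to
  a finite integral of the Jacobian. If one side is finite, it yields equality; otherwise both sides
  are infinite.\<close>

lemma emeasure_differentiable_image:
  fixes f :: "real ^ 'n::{finite,wellorder} \<Rightarrow> real ^ 'n::_"
  assumes S: "S \<in> sets borel" and fS: "f ` S \<in> sets borel" and inj: "inj_on f S"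
    and f': "\<And>x. x \<in> S \<Longrightarrow> (f has_derivative f' x) (at x within S)"
    and meas: "(\<lambda>x. \<bar>det (matrix (f' x))\<bar> * indicator S x) \<in> borel_measurable borel"
  shows "emeasure lborel (f ` S) = (\<integral>\<^sup>+x. ennreal \<bar>det (matrix (f' x))\<bar> * indicator S x \<partial>lborel)"
proof -
  have S': "S \<in> sets lebesgue" using S by auto
  have int_eq: "(\<integral>\<^sup>+x. ennreal \<bar>det (matrix (f' x))\<bar> * indicator S x \<partial>lborel) =
      (\<integral>\<^sup>+x. ennreal (\<bar>det (matrix (f' x))\<bar> * indicator S x) \<partial>lborel)"
    by (intro nn_integral_cong) (auto simp: indicator_def)
  have eq: "emeasure lborel (f ` S) = (\<integral>\<^sup>+x. ennreal \<bar>det (matrix (f' x))\<bar> * indicator S x \<partial>lborel)"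
    if "((\<lambda>x. \<bar>det (matrix (f' x))\<bar>) has_integral m) S" for m
  proof -
    have "f ` S \<in> lmeasurable" and m: "measure lebesgue (f ` S) = m"
      using that has_measure_differentiable_image [OF S' f' inj] by auto
    then have "emeasure lebesgue (f ` S) = ennreal m"
      by (simp add: emeasure_eq_measure2)
    then have "emeasure lborel (f ` S) = ennreal m"
      using fS by simp
    moreover have "(\<integral>\<^sup>+x. ennreal (indicator S x * \<bar>det (matrix (f' x))\<bar>) \<partial>lborel) = ennreal m"
      using nn_integral_has_integral_lebesgue [OF _ that] by simp
    ultimately show ?thesis
      unfolding int_eq by (simp add: mult.commute)
  qed
  show ?thesis
  proof (cases "emeasure lborel (f ` S) < \<infinity>")
    case True
    then have "f ` S \<in> lmeasurable"
      using fS by (intro fmeasurableI) auto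
    then show ?thesis
      using eq has_measure_differentiable_image [OF S' f' inj] by blast
  next
    case False
    show ?thesis
    proof (cases "(\<integral>\<^sup>+x. ennreal (\<bar>det (matrix (f' x))\<bar> * indicator S x) \<partial>lborel) < \<infinity>")
      case True
      then have "(\<lambda>x. \<bar>det (matrix (f' x))\<bar> * indicator S x) integrable_on UNIV"
        using meas by (intro nn_integral_integrable_on) auto
      then have "(\<lambda>x. \<bar>det (matrix (f' x))\<bar>) integrable_on S"
        by (subst integrable_restrict_UNIV [symmetric])
          (simp add: indicator_def if_distrib of_bool_def cong: if_cong)
      then show ?thesis using eq by (auto simp: integrable_on_def)
    next
      case False2: False
      with False show ?thesis
        unfolding int_eq by (metis infinity_ennreal_def top.not_eq_extremum)
    qed
  qed
qed

lemma span_coords_expansion: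
  fixes D :: "'e::euclidean_space set"
  assumes D: "D \<subseteq> Basis" and w: "w \<in> span D"
  shows "(\<Sum>b\<in>D. (w \<bullet> b) *\<^sub>R b) = w"
proof -
  have "(\<Sum>b\<in>D. (w \<bullet> b) *\<^sub>R b) = (\<Sum>b\<in>Basis. (w \<bullet> b) *\<^sub>R b)"
    using D w unfolding span_substd_basis [OF D]
    by (intro sum.mono_neutral_left) auto
  then show ?thesis by (simp add: euclidean_representation)
qed

lemma inner_sum_coords:
  fixes D :: "'e::euclidean_space set"
  assumes D: "D \<subseteq> Basis" and b: "b \<in> D"
  shows "(\<Sum>c\<in>D. x c *\<^sub>R c) \<bullet> b = x b"
proof -
  have fin: "finite D" using D finite_Basis finite_subset by blast
  have "(\<Sum>c\<in>D. x c *\<^sub>R c) \<bullet> b = (\<Sum>c\<in>D. x c * (if c = b then 1 else 0))"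
    unfolding inner_sum_left using D b
    by (intro sum.cong) (auto simp: inner_Basis subset_iff)
  then show ?thesis using fin b by (simp add: if_distrib cong: if_cong)
qed

text \<open>On the cylinder over \<open>B\<close>, the map \<tau> in the coordinates of
  \<open>J\<close> together with the identity in the others is a full-dimensional map, and its
  derivative is the Jacobian of \<tau> padded with an identity block. The remaining coordinates run
  over the same unit cube on both sides.\<close>

lemma emeasure_lborel_on_image:
  fixes \<tau> :: "'e::euclidean_space \<Rightarrow> 'e"
  assumes D: "D \<subseteq> Basis" "D' \<subseteq> Basis" and \<beta>: "bij_betw \<beta> D' D"
    and B: "B \<subseteq> span D'" "B \<in> sets borel" and \<tau>B: "\<tau> ` B \<subseteq> span D" "\<tau> ` B \<in> sets borel"
    and inj: "inj_on \<tau> B"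
    and der: "\<And>u. u \<in> B \<Longrightarrow> (\<tau> has_derivative \<tau>' u) (at u within B)"
    and meas: "(\<lambda>u. det_on D' (\<lambda>i j. \<tau>' u j \<bullet> \<beta> i) * indicator B u) \<in> borel_measurable borel"
  shows "emeasure (lborel_on D) (\<tau> ` B) =
    (\<integral>\<^sup>+u. ennreal \<bar>det_on D' (\<lambda>i j. \<tau>' u j \<bullet> \<beta> i)\<bar> * indicator B u \<partial>lborel_on D')"
proof -
  define J where "J = {i :: 'e basis_index. basis_vec i \<in> D'}"
  define \<gamma> where "\<gamma> i = \<beta> (basis_vec i)" for i
  have q': "bij_betw basis_vec J D'"
    unfolding J_def by (rule bij_betw_basis_vec [OF D(2)])
  have q: "bij_betw \<gamma> J D"
    using bij_betw_trans [OF q' \<beta>] by (simp add: \<gamma>_def [abs_def] comp_def)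
  define \<delta> where "\<delta> u = det_on D' (\<lambda>i j. \<tau>' u j \<bullet> \<beta> i)" for u
  define P where "P x = (\<Sum>i\<in>J. x $ i *\<^sub>R basis_vec i)" for x :: "real ^ 'e basis_index"
  define T where "T x = (\<chi> i. if i \<in> J then \<tau> (P x) \<bullet> \<gamma> i else x $ i)" for x :: "real ^ 'e basis_index"
  define T' where "T' x h = (\<chi> i. if i \<in> J then \<tau>' (P x) (P h) \<bullet> \<gamma> i else h $ i)"
    for x h :: "real ^ 'e basis_index"
  define C where "C = {x :: real ^ 'e basis_index. \<forall>i. i \<notin> J \<longrightarrow> x $ i \<in> {0..1}}"
  define S where "S = {x. P x \<in> B \<and> (\<forall>i. i \<notin> J \<longrightarrow> x $ i \<in> {0..1})}"
  define S2 where "S2 = {y :: real ^ 'e basis_index.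
      (\<Sum>i\<in>J. y $ i *\<^sub>R \<gamma> i) \<in> \<tau> ` B \<and> (\<forall>i. i \<notin> J \<longrightarrow> y $ i \<in> {0..1})}"
  have P_lin: "bounded_linear P"
    unfolding P_def [abs_def] by (intro bounded_linear_sum bounded_linear_scaleR_const bounded_linear_vec_nth)
  have [measurable]: "P \<in> borel_measurable borel"
    unfolding P_def [abs_def] by measurable
  have C [measurable]: "C \<in> sets borel" unfolding C_def by measurable
  note [measurable] = B(2) \<tau>B(2)
  have expand: "(\<Sum>i\<in>J. (w \<bullet> \<gamma> i) *\<^sub>R \<gamma> i) = w" if "w \<in> span D" for w
    using sum.reindex_bij_betw [OF q, of "\<lambda>b. (w \<bullet> b) *\<^sub>R b"] span_coords_expansion [OF D(1) that]
    by simp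
  have coord': "(\<Sum>i\<in>J. x $ i *\<^sub>R basis_vec i) \<bullet> basis_vec j = x $ j" if "j \<in> J" for x :: "real ^ 'e basis_index" and j
  proof -
    have "(\<Sum>i\<in>J. x $ i *\<^sub>R basis_vec i) = (\<Sum>b\<in>D'. (x $ basis_index b) *\<^sub>R b)"
      using sum.reindex_bij_betw [OF q', of "\<lambda>b. (x $ basis_index b) *\<^sub>R b"]
      by (simp add: basis_vec_inverse)
    then show ?thesis
      using that inner_sum_coords [OF D(2), of "basis_vec j" "\<lambda>b. x $ basis_index b"]
      by (simp add: J_def basis_vec_inverse)
  qed
  have coord: "(\<Sum>i\<in>J. y $ i *\<^sub>R \<gamma> i) \<bullet> \<gamma> j = y $ j" if "j \<in> J" for y :: "real ^ 'e basis_index" and j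
  proof -
    have inv: "inv_into J \<gamma> (\<gamma> i) = i" if "i \<in> J" for i
      using that q by (simp add: bij_betw_def)
    have "(\<Sum>i\<in>J. y $ i *\<^sub>R \<gamma> i) = (\<Sum>b\<in>D. (y $ inv_into J \<gamma> b) *\<^sub>R b)"
      using sum.reindex_bij_betw [OF q, of "\<lambda>b. (y $ inv_into J \<gamma> b) *\<^sub>R b"]
      by (simp add: inv)
    then show ?thesis
      using that inner_sum_coords [OF D(1), of "\<gamma> j" "\<lambda>b. y $ inv_into J \<gamma> b"] q
      by (auto simp: inv bij_betw_def)
  qed
  have TS: "T ` S = S2"
  proof (intro subset_antisym subsetI)
    fix y assume "y \<in> T ` S"
    then obtain x where x: "x \<in> S" "y = T x" by auto
    have "(\<Sum>i\<in>J. y $ i *\<^sub>R \<gamma> i) = \<tau> (P x)"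
      using x \<tau>B(1) expand [of "\<tau> (P x)"] by (auto simp: T_def S_def)
    then show "y \<in> S2" using x by (auto simp: S2_def S_def T_def)
  next
    fix y assume y: "y \<in> S2"
    then obtain u where u: "u \<in> B" "(\<Sum>i\<in>J. y $ i *\<^sub>R \<gamma> i) = \<tau> u"
      by (auto simp: S2_def)
    define x where "x = (\<chi> i. if i \<in> J then u \<bullet> basis_vec i else y $ i)"
    have Px: "P x = u"
      using sum.reindex_bij_betw [OF q', of "\<lambda>b. (u \<bullet> b) *\<^sub>R b"] span_coords_expansion [OF D(2)] u B(1)
      by (auto simp: P_def x_def)
    then have "x \<in> S" using u y by (auto simp: S_def x_def S2_def)
    moreover have "T x = y"
      using coord [of _ y] Px u by (auto simp: T_def vec_eq_iff x_def)
    ultimately show "y \<in> T ` S" by blast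
  qed
  have S_eq: "S = C \<inter> P -` B" by (auto simp: S_def C_def)
  have S [measurable]: "S \<in> sets borel"
    unfolding S_eq using measurable_sets [OF \<open>P \<in> borel_measurable borel\<close> B(2)] C by auto
  have S2: "S2 \<in> sets borel"
  proof -
    have "S2 = C \<inter> (\<lambda>y. \<Sum>i\<in>J. y $ i *\<^sub>R \<gamma> i) -` (\<tau> ` B)"
      by (auto simp: S2_def C_def)
    then show ?thesis
      using measurable_sets [OF measurable_combination \<tau>B(2)] C by auto
  qed
  have injT: "inj_on T S"
  proof
    fix x y assume xy: "x \<in> S" "y \<in> S" "T x = T y"
    then have "\<tau> (P x) \<bullet> \<gamma> i = \<tau> (P y) \<bullet> \<gamma> i" if "i \<in> J" for i
      using that by (auto simp: T_def vec_eq_iff split: if_splits)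
    then have "(\<Sum>i\<in>J. (\<tau> (P x) \<bullet> \<gamma> i) *\<^sub>R \<gamma> i) = (\<Sum>i\<in>J. (\<tau> (P y) \<bullet> \<gamma> i) *\<^sub>R \<gamma> i)"
      by (intro sum.cong) auto
    moreover have "P x \<in> B" "P y \<in> B" using xy by (auto simp: S_def)
    moreover from this have "\<tau> (P x) \<in> span D" "\<tau> (P y) \<in> span D" using \<tau>B(1) by auto
    ultimately have "P x = P y"
      using inj_onD [OF inj, of "P x" "P y"] by (simp add: expand)
    then have "x $ i = y $ i" if "i \<in> J" for i
      using coord' [OF that, of x] coord' [OF that, of y] by (simp add: P_def)
    moreover have "x $ i = y $ i" if "i \<notin> J" for i
      using xy(3) that by (auto simp: T_def vec_eq_iff split: if_splits)
    ultimately show "x = y" by (auto simp: vec_eq_iff)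
  qed
  have derT: "(T has_derivative T' x) (at x within S)" if x: "x \<in> S" for x
  proof (subst has_derivative_componentwise_within, intro ballI)
    fix a :: "real ^ 'e basis_index" assume "a \<in> Basis"
    then obtain i where a: "a = axis i 1" by (auto simp: Basis_vec_def)
    have "((\<lambda>x. \<tau> (P x)) has_derivative (\<lambda>h. \<tau>' (P x) (P h))) (at x within S)"
    proof (rule has_derivative_in_compose2 [of B \<tau> \<tau>' P S x P])
      show "(P has_derivative P) (at x within S)"
        using P_lin by (rule bounded_linear_imp_has_derivative)
    qed (use x der in \<open>auto simp: S_def\<close>)
    then have 1: "((\<lambda>x. \<tau> (P x) \<bullet> \<gamma> i) has_derivative (\<lambda>h. \<tau>' (P x) (P h) \<bullet> \<gamma> i)) (at x within S)"
      by (rule has_derivative_inner_left)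
    have 2: "((\<lambda>x. x $ i) has_derivative (\<lambda>h. h $ i)) (at x within S)"
      by (intro bounded_linear_imp_has_derivative bounded_linear_vec_nth)
    show "((\<lambda>x. T x \<bullet> a) has_derivative (\<lambda>h. T' x h \<bullet> a)) (at x within S)"
      using 1 2 by (cases "i \<in> J") (simp_all add: a inner_axis T_def T'_def)
  qed
  have det: "det (matrix (T' x)) = \<delta> (P x)" if x: "x \<in> S" for x
  proof -
    have lin: "linear (\<tau>' (P x))"
      using der [of "P x"] x by (auto simp: S_def dest: has_derivative_linear)
    \<comment> \<open>\<open>P\<close> annihilates the axes outside \<open>J\<close>. Hence the
      corresponding columns of the Jacobian are those of the identity, which is the pattern of
      \<open>pad_matrix\<close>.\<close>
    have P_axis: "P (axis j 1) = (if j \<in> J then basis_vec j else 0)" for j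
      by (auto simp: P_def axis_def if_distrib [where f = "\<lambda>a. a *\<^sub>R _"] cong: if_cong)
    have axis_nth: "axis j (1::real) $ i = (if i = j then 1 else 0)" for i j :: "'e basis_index"
      by (simp add: axis_def)
    have "matrix (T' x) = pad_matrix J (\<lambda>i j. \<tau>' (P x) (basis_vec j) \<bullet> \<beta> (basis_vec i))"
      by (auto simp: vec_eq_iff matrix_def pad_matrix_def T'_def P_axis \<gamma>_def linear_0 [OF lin] axis_nth)
    then show ?thesis
      by (simp add: det_pad_matrix \<delta>_def det_on_reindex [OF q'])
  qed
  have \<delta> [measurable]: "(\<lambda>u. \<delta> u * indicator B u) \<in> borel_measurable borel"
    using meas by (simp add: \<delta>_def)
  have "emeasure (lborel_on D) (\<tau> ` B) = emeasure lborel (T ` S)"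
    using emeasure_lborel_on_eq_cylinder [OF q \<tau>B(2)] by (simp add: TS S2_def)
  also have "\<dots> = (\<integral>\<^sup>+x. ennreal \<bar>det (matrix (T' x))\<bar> * indicator S x \<partial>lborel)"
  proof (rule emeasure_differentiable_image [OF S _ injT derT])
    show "T ` S \<in> sets borel" using S2 TS by simp
    have "(\<lambda>x. \<bar>det (matrix (T' x))\<bar> * indicator S x) =
        (\<lambda>x. \<bar>\<delta> (P x) * indicator B (P x)\<bar> * indicator C x)"
      using det by (auto simp: fun_eq_iff S_eq indicator_def)
    also have "\<dots> \<in> borel_measurable borel"
      using measurable_compose [OF \<open>P \<in> borel_measurable borel\<close> \<delta>] by measurable
    finally show "(\<lambda>x. \<bar>det (matrix (T' x))\<bar> * indicator S x) \<in> borel_measurable borel" .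
  qed
  also have "\<dots> = (\<integral>\<^sup>+x. ennreal \<bar>\<delta> (P x) * indicator B (P x)\<bar> * indicator C x \<partial>lborel)"
    using det by (intro nn_integral_cong) (auto simp: S_eq indicator_def)
  also have "\<dots> = (\<integral>\<^sup>+u. ennreal \<bar>\<delta> u * indicator B u\<bar> \<partial>lborel_on D')"
    unfolding P_def C_def by (rule nn_integral_lborel_on_eq_cylinder [OF q', symmetric]) measurable
  also have "\<dots> = (\<integral>\<^sup>+u. ennreal \<bar>\<delta> u\<bar> * indicator B u \<partial>lborel_on D')"
    by (intro nn_integral_cong) (auto simp: indicator_def)
  finally show ?thesis by (simp add: \<delta>_def)
qed

text \<open>The image formula, applied to Borel subsets of \<open>W'\<close>, says that \<tau>
  pushes the measure with density the absolute Jacobian forward to Lebesgue measure on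
  \<open>W\<close>. Equal measures have equal integrals.\<close>

lemma nn_integral_lborel_on_substitution:
  fixes \<tau> :: "'e::euclidean_space \<Rightarrow> 'e"
  assumes D: "D \<subseteq> Basis" "D' \<subseteq> Basis" and \<beta>: "bij_betw \<beta> D' D"
    and hom: "homeomorphism W' W \<tau> \<sigma>"
    and W': "W' \<subseteq> span D'" "W' \<in> sets borel" and W: "W \<subseteq> span D" "W \<in> sets borel"
    and der: "\<And>u. u \<in> W' \<Longrightarrow> (\<tau> has_derivative \<tau>' u) (at u within W')"
    and meas: "(\<lambda>u. det_on D' (\<lambda>i j. \<tau>' u j \<bullet> \<beta> i) * indicator W' u) \<in> borel_measurable borel"
    and g: "g \<in> borel_measurable borel"
  shows "(\<integral>\<^sup>+x. g x * indicator W x \<partial>lborel_on D) =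
    (\<integral>\<^sup>+u. g (\<tau> u) * ennreal \<bar>det_on D' (\<lambda>i j. \<tau>' u j \<bullet> \<beta> i)\<bar> * indicator W' u \<partial>lborel_on D')"
proof -
  define \<delta> where "\<delta> u = det_on D' (\<lambda>i j. \<tau>' u j \<bullet> \<beta> i) * indicator W' u" for u
  \<comment> \<open>Extending \<tau> by 0 makes it Borel on the whole space; the density vanishes
    off \<open>W'\<close>, so the value chosen there is irrelevant.\<close>
  define t where "t u = (if u \<in> W' then \<tau> u else 0)" for u
  note [measurable] = W'(2) W(2) g
  have [measurable]: "\<delta> \<in> borel_measurable borel"
    using meas by (simp add: \<delta>_def [abs_def])
  have t [measurable]: "t \<in> borel_measurable borel"
  proof -
    have "continuous_on W' \<tau>" using hom by (simp add: homeomorphism_def)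
    then have "(\<lambda>u. indicator W' u *\<^sub>R \<tau> u) \<in> borel_measurable borel"
      using W' by (intro borel_measurable_continuous_on_indicator) auto
    moreover have "(\<lambda>u. indicator W' u *\<^sub>R \<tau> u) = t"
      by (auto simp: t_def fun_eq_iff)
    ultimately show ?thesis by simp
  qed
  have "density (lborel_on D) (indicator W) =
      distr (density (lborel_on D') (\<lambda>u. ennreal \<bar>\<delta> u\<bar>)) borel t"
  proof (rule measure_eqI)
    fix A assume "A \<in> sets (density (lborel_on D) (indicator W))"
    then have A [measurable]: "A \<in> sets borel" by simp
    define B where "B = W' \<inter> t -` A"
    have tA: "t -` A \<in> sets borel" using measurable_sets [OF t A] by simp
    then have B: "B \<in> sets borel" "B \<subseteq> W'" using W' by (auto simp: B_def)
    have \<tau>B: "\<tau> ` B = W \<inter> A"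
      using hom by (force simp: B_def t_def homeomorphism_def)
    have "emeasure (density (lborel_on D) (indicator W)) A = emeasure (lborel_on D) (\<tau> ` B)"
      unfolding \<tau>B using W A by (simp add: emeasure_density indicator_inter_arith [symmetric])
    also have "\<dots> = (\<integral>\<^sup>+u. ennreal \<bar>det_on D' (\<lambda>i j. \<tau>' u j \<bullet> \<beta> i)\<bar> * indicator B u \<partial>lborel_on D')"
    proof (rule emeasure_lborel_on_image [OF D \<beta>])
      show "B \<subseteq> span D'" "\<tau> ` B \<subseteq> span D" "B \<in> sets borel" using B W' W \<tau>B by auto
      show "\<tau> ` B \<in> sets borel" unfolding \<tau>B using W A by auto
      show "inj_on \<tau> B" using hom B by (intro inj_on_inverseI [of _ \<sigma>]) (auto simp: homeomorphism_def)
      show "(\<tau> has_derivative \<tau>' u) (at u within B)" if "u \<in> B" for u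
        using has_derivative_subset [OF der] that B by blast
      have "(\<lambda>u. det_on D' (\<lambda>i j. \<tau>' u j \<bullet> \<beta> i) * indicator B u) = (\<lambda>u. \<delta> u * indicator B u)"
        using B by (auto simp: \<delta>_def fun_eq_iff indicator_def)
      then show "(\<lambda>u. det_on D' (\<lambda>i j. \<tau>' u j \<bullet> \<beta> i) * indicator B u) \<in> borel_measurable borel"
        using B by simp
    qed
    also have "\<dots> = (\<integral>\<^sup>+u. ennreal \<bar>\<delta> u\<bar> * indicator (t -` A) u \<partial>lborel_on D')"
      by (intro nn_integral_cong) (auto simp: \<delta>_def B_def indicator_def)
    also have "\<dots> = emeasure (distr (density (lborel_on D') (\<lambda>u. ennreal \<bar>\<delta> u\<bar>)) borel t) A"
      using tA by (simp add: emeasure_distr emeasure_density)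
    finally show "emeasure (density (lborel_on D) (indicator W)) A =
        emeasure (distr (density (lborel_on D') (\<lambda>u. ennreal \<bar>\<delta> u\<bar>)) borel t) A" .
  qed simp
  then have "(\<integral>\<^sup>+x. g x \<partial>density (lborel_on D) (indicator W)) =
      (\<integral>\<^sup>+x. g x \<partial>distr (density (lborel_on D') (\<lambda>u. ennreal \<bar>\<delta> u\<bar>)) borel t)"
    by simp
  then have "(\<integral>\<^sup>+x. g x * indicator W x \<partial>lborel_on D) =
      (\<integral>\<^sup>+u. g (t u) * ennreal \<bar>\<delta> u\<bar> \<partial>lborel_on D')"
    by (simp add: nn_integral_distr nn_integral_density mult.commute)
  also have "\<dots> = (\<integral>\<^sup>+u. g (\<tau> u) * ennreal \<bar>det_on D' (\<lambda>i j. \<tau>' u j \<bullet> \<beta> i)\<bar> * indicator W' u \<partial>lborel_on D')"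
    by (intro nn_integral_cong) (auto simp: \<delta>_def t_def indicator_def)
  finally show ?thesis .
qed

section \<open>Calculus on relatively open subsets of a subspace\<close>

lemma eventually_line_in:
  fixes u b :: "'e::euclidean_space"
  assumes U: "openin (top_of_set (span D)) U" and u: "u \<in> U" and b: "b \<in> span D"
  shows "\<forall>\<^sub>F t in nhds (0::real). u + t *\<^sub>R b \<in> U"
proof -
  obtain V where V: "open V" "U = span D \<inter> V"
    using U by (auto simp: openin_open)
  have "open ((\<lambda>t. u + t *\<^sub>R b) -` V)"
    by (intro continuous_open_vimage V continuous_intros)
  then have "\<forall>\<^sub>F t in nhds (0::real). t \<in> (\<lambda>t. u + t *\<^sub>R b) -` V"
    using u V by (intro eventually_nhds_in_open) auto
  then show ?thesis
    by (rule eventually_mono) (use u b V in \<open>auto intro: span_add span_scale\<close>)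
qed

text \<open>The outer function is differentiable only within \<open>U\<close>. On an open set of
  times at which the curve stays in \<open>U\<close> the chain rule within sets applies, and the
  filter within an open set is the full filter at \<open>t\<close>.\<close>

lemma has_vector_derivative_within_curve:
  fixes c :: "real \<Rightarrow> 'e::real_normed_vector"
  assumes f: "(f has_derivative f') (at (c t) within U)"
    and c: "(c has_vector_derivative c') (at t)" and U: "\<forall>\<^sub>F s in nhds t. c s \<in> U"
  shows "((\<lambda>s. f (c s)) has_vector_derivative f' c') (at t)"
proof -
  obtain T where T: "open T" "t \<in> T" "\<And>s. s \<in> T \<Longrightarrow> c s \<in> U"
    using U by (auto simp: eventually_nhds)
  interpret f': bounded_linear f' using f by (rule has_derivative_bounded_linear)
  have "(c has_derivative (\<lambda>h. h *\<^sub>R c')) (at t within T)"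
    using c by (auto simp: has_vector_derivative_def intro: has_derivative_at_withinI)
  then have "((\<lambda>s. f (c s)) has_derivative (\<lambda>h. f' (h *\<^sub>R c'))) (at t within T)"
    by (rule has_derivative_in_compose) (use T in \<open>auto intro: has_derivative_subset [OF f]\<close>)
  then show ?thesis
    unfolding has_vector_derivative_def f'.scaleR at_within_open [OF T(2,1)] .
qed

lemma has_vector_derivative_line:
  fixes u b :: "'e::euclidean_space"
  assumes "(f has_derivative f') (at u within U)"
    and "openin (top_of_set (span D)) U" "u \<in> U" "b \<in> span D"
  shows "((\<lambda>t. f (u + t *\<^sub>R b)) has_vector_derivative f' b) (at 0)"
proof (rule has_vector_derivative_within_curve [where c = "\<lambda>t. u + t *\<^sub>R b"])
  show "(f has_derivative f') (at (u + 0 *\<^sub>R b) within U)" using assms by simp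
  show "((\<lambda>t. u + t *\<^sub>R b) has_vector_derivative b) (at 0)"
    by (auto intro!: derivative_eq_intros)
  show "\<forall>\<^sub>F t in nhds 0. u + t *\<^sub>R b \<in> U"
    using assms by (intro eventually_line_in)
qed

text \<open>A direction in \<open>span D\<close> is tested along a short segment, which stays in
  \<open>U\<close>; this is why derivatives within \<open>U\<close> are compared in such directions
  only.\<close>

lemma has_derivative_within_unique_on:
  fixes f :: "'e::euclidean_space \<Rightarrow> 'b::real_normed_vector"
  assumes "(f has_derivative f') (at u within U)" "(f has_derivative f'') (at u within U)"
    and "openin (top_of_set (span D)) U" "u \<in> U" "b \<in> span D"
  shows "f' b = f'' b"
  by (rule vector_derivative_unique_at [OF has_vector_derivative_line [OF assms(1,3-5)]
        has_vector_derivative_line [OF assms(2-5)]])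

lemma frechet_derivative_within_on:
  fixes f :: "'e::euclidean_space \<Rightarrow> 'b::real_normed_vector"
  assumes f: "(f has_derivative f') (at u within U)"
    and "openin (top_of_set (span D)) U" "u \<in> U" "b \<in> span D"
  shows "frechet_derivative f (at u within U) b = f' b"
proof (rule has_derivative_within_unique_on [OF _ f assms(2-4)])
  show "(f has_derivative frechet_derivative f (at u within U)) (at u within U)"
    using f by (simp add: frechet_derivative_works [symmetric] differentiable_def exI)
qed

lemma C_on_Suc_imp: "C_on (Suc k) D f U \<Longrightarrow> C_on k D f U"
proof (induction k arbitrary: f)
  case 0
  then show ?case by (simp add: differentiable_imp_continuous_on)
qed auto

lemma C_on_1_iff:
  "C_on 1 D f U \<longleftrightarrow> f differentiable_on U \<and>
    (\<forall>b\<in>D. continuous_on U (\<lambda>u. frechet_derivative f (at u within U) b))"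
  by (simp add: One_nat_def)

lemma C_on_1I:
  fixes f :: "'e::euclidean_space \<Rightarrow> 'b::real_normed_vector"
  assumes U: "openin (top_of_set (span D)) U"
    and der: "\<And>u. u \<in> U \<Longrightarrow> (f has_derivative f' u) (at u within U)"
    and cont: "\<And>b. b \<in> D \<Longrightarrow> continuous_on U (\<lambda>u. f' u b)"
  shows "C_on 1 D f U"
  unfolding C_on_1_iff
proof (intro conjI ballI)
  show "f differentiable_on U"
    using der by (auto simp: differentiable_on_def differentiable_def)
  show "continuous_on U (\<lambda>u. frechet_derivative f (at u within U) b)" if b: "b \<in> D" for b
    by (rule continuous_on_eq [OF cont [OF b]])
      (simp add: frechet_derivative_within_on [OF der U] span_base [OF b])
qed

text \<open>No inverse function theorem is needed: continuity of \<open>h\<close> together with a linear left inverse of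
  the derivative of \<open>f\<close> gives differentiability.\<close>

lemma has_derivative_of_lift:
  fixes f :: "'e::euclidean_space \<Rightarrow> 'b::euclidean_space" and h :: "'a::real_normed_vector \<Rightarrow> 'e"
  assumes f: "(f has_derivative f') (at (h a) within U)"
    and E: "subspace E" "U \<subseteq> E" and inj: "\<And>x. x \<in> E \<Longrightarrow> f' x = 0 \<Longrightarrow> x = 0"
    and a: "a \<in> A" and hA: "h ` A \<subseteq> U" and cont: "continuous (at a within A) h"
    and fh: "((\<lambda>x. f (h x)) has_derivative g') (at a within A)"
  obtains h' where "(h has_derivative h') (at a within A)" "range h' \<subseteq> E"
proof -
  have lin: "linear f'" using f by (rule has_derivative_linear)
  have "inj_on f' E"
  proof (rule inj_onI)
    fix x y assume "x \<in> E" "y \<in> E" "f' x = f' y"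
    then show "x = y"
      using inj [of "x - y"] E(1) by (simp add: subspace_diff linear_diff [OF lin])
  qed
  then obtain l where l: "range l \<subseteq> E" "linear l" "\<And>x. x \<in> E \<Longrightarrow> l (f' x) = x"
    using linear_exists_left_inverse_on [OF lin E(1)] by blast
  have l_bl: "bounded_linear l" using l(2) by (rule linear_conv_bounded_linear [THEN iffD1])
  define L where "L = (\<lambda>x. l (g' x))"
  have lf: "((\<lambda>y. l (f y)) has_derivative (\<lambda>x. l (f' x))) (at (h a) within U)"
    by (rule bounded_linear.has_derivative [OF l_bl f])
  have lfh: "((\<lambda>x. l (f (h x))) has_derivative L) (at a within A)"
    unfolding L_def by (rule bounded_linear.has_derivative [OF l_bl fh])
  then interpret L: bounded_linear L by (rule has_derivative_bounded_linear)
  obtain K where K: "K > 0" "\<And>x. norm (L x) \<le> norm x * K" using L.pos_bounded by blast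
  \<comment> \<open>Since \<open>l\<close> inverts \<open>f'\<close> on \<open>E\<close>, the
    increments of \<open>l \<circ> f\<close> and of the identity agree up to a small multiple of the
    increment. Continuity of \<open>h\<close> brings \<open>h x\<close> close enough to
    \<open>h a\<close> for this to apply.\<close>
  have near: "\<forall>\<^sub>F x in at a within A. norm (l (f (h x)) - l (f (h a)) - (h x - h a)) \<le> e * norm (h x - h a)"
    if "e > 0" for e
  proof -
    obtain d where d: "d > 0" "\<And>y. y \<in> U \<Longrightarrow> norm (y - h a) < d \<Longrightarrow>
        norm (l (f y) - l (f (h a)) - l (f' (y - h a))) \<le> e * norm (y - h a)"
      using lf \<open>e > 0\<close> unfolding has_derivative_within_alt by blast
    have "\<forall>\<^sub>F x in at a within A. dist (h x) (h a) < d"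
      using cont d(1) by (simp add: continuous_within tendsto_iff)
    moreover have "\<forall>\<^sub>F x in at a within A. x \<in> A"
      by (simp add: eventually_at_filter)
    ultimately show ?thesis
    proof eventually_elim
      case (elim x)
      then have "h x \<in> U" "h a \<in> U" using hA a by auto
      then have "h x - h a \<in> E" using E by (auto intro: subspace_diff)
      then show ?case using d(2) [OF \<open>h x \<in> U\<close>] elim l(3) by (simp add: dist_norm)
    qed
  qed
  have "(h has_derivative L) (at a within A)"
    unfolding has_derivative_within_alt2
  proof (intro conjI allI impI)
    show "bounded_linear L" by (rule L.bounded_linear_axioms)
    fix e :: real assume e: "e > 0"
    \<comment> \<open>The increment of \<open>h\<close> will be at most
      \<open>2 * (K + 1) * norm (x - a)\<close>, so that \<open>e1\<close> times it is half of the
      allowed error. The other half is spent on the differentiability of the composition.\<close>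
    define e1 where "e1 = e / (4 * (K + 1))"
    have e1: "e1 > 0" using e K by (simp add: e1_def)
    have 3: "\<forall>\<^sub>F x in at a within A. norm (l (f (h x)) - l (f (h a)) - L (x - a)) \<le> c * norm (x - a)"
      if "c > 0" for c
      using lfh that unfolding has_derivative_within_alt2 by blast
    show "\<forall>\<^sub>F x in at a within A. norm (h x - h a - L (x - a)) \<le> e * norm (x - a)"
      using near [OF e1] near [OF half_gt_zero [OF zero_less_one]] 3 [OF zero_less_one] 3 [OF half_gt_zero [OF e]]
    proof eventually_elim
      case (elim x)
      let ?d = "h x - h a" and ?g = "l (f (h x)) - l (f (h a))"
      \<comment> \<open>The term \<open>norm (?g - ?d)\<close> is at most half of
        \<open>norm ?d\<close>, by \<open>near\<close> with constant 1/2. Absorbing it on the left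
        gives a Lipschitz bound for \<open>h\<close> at \<open>a\<close>.\<close>
      have "norm ?d \<le> norm ?g + norm (?g - ?d)"
        using norm_triangle_sub [of ?d ?g] by (simp add: norm_minus_commute)
      then have "norm ?d \<le> 2 * norm ?g" using elim(2) by simp
      also have "norm ?g \<le> norm (L (x - a)) + norm (?g - L (x - a))"
        by (rule norm_triangle_sub)
      also have "\<dots> \<le> (K + 1) * norm (x - a)"
        using K(2) [of "x - a"] elim(3) by (simp add: algebra_simps)
      finally have d: "norm ?d \<le> 2 * ((K + 1) * norm (x - a))" by simp
      have "?d - L (x - a) = (?g - L (x - a)) - (?g - ?d)" by simp
      then have "norm (?d - L (x - a)) \<le> norm (?g - ?d) + norm (?g - L (x - a))"
        by (metis add.commute norm_triangle_ineq4)
      also have "\<dots> \<le> e1 * (2 * ((K + 1) * norm (x - a))) + e / 2 * norm (x - a)"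
        using elim(1) elim(4) mult_left_mono [OF d, of e1] e1 by linarith
      also have "\<dots> = e * norm (x - a)"
        using K(1) by (simp add: e1_def field_simps)
      finally show ?case .
    qed
  qed
  moreover have "range L \<subseteq> E" using l(1) by (auto simp: L_def)
  ultimately show ?thesis using that by blast
qed

section \<open>Left-invariant frames in charts\<close>

lemma smooth_on_derivative:
  fixes f :: "'e::euclidean_space \<Rightarrow> 'b::real_normed_vector"
  assumes f: "smooth_on f U" and U: "open U"
  shows "\<And>u. u \<in> U \<Longrightarrow> (f has_derivative frechet_derivative f (at u)) (at u)"
    and "\<And>b. b \<in> Basis \<Longrightarrow> continuous_on U (\<lambda>u. frechet_derivative f (at u) b)"
proof -
  have C: "C_on 1 Basis f U" using f by (simp add: smooth_on_def)
  show "(f has_derivative frechet_derivative f (at u)) (at u)" if "u \<in> U" for u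
    using C that unfolding C_on_1_iff frechet_derivative_works [symmetric]
    by (auto simp: differentiable_on_def at_within_open [OF that U, symmetric])
  show "continuous_on U (\<lambda>u. frechet_derivative f (at u) b)" if "b \<in> Basis" for b
  proof (rule continuous_on_eq)
    show "continuous_on U (\<lambda>u. frechet_derivative f (at u within U) b)"
      using C that unfolding C_on_1_iff by auto
  qed (simp add: at_within_open [OF _ U])
qed

lemma has_derivative_snd_slice:
  assumes "(M has_derivative M') (at (a, b))"
  shows "((\<lambda>z. M (a, z)) has_derivative (\<lambda>w. M' (0, w))) (at b)"
proof -
  have "((\<lambda>z. (a, z)) has_derivative (\<lambda>w. (0, w))) (at b)"
    by (intro has_derivative_Pair has_derivative_const has_derivative_ident)
  from has_derivative_compose [OF this, of M M'] assms show ?thesis by simp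
qed

lemma continuous_on_map_prod:
  "continuous_on A f \<Longrightarrow> continuous_on B g \<Longrightarrow> continuous_on (A \<times> B) (map_prod f g)"
  unfolding map_prod_def case_prod_unfold
  by (intro continuous_on_Pair continuous_on_compose2 [of A f _ fst] continuous_on_compose2 [of B g _ snd]
      continuous_intros) auto

lemma homeomorphism_map_prod:
  assumes "homeomorphism A A' f f'" "homeomorphism B B' g g'"
  shows "homeomorphism (A \<times> B) (A' \<times> B') (map_prod f g) (map_prod f' g')"
  using assms unfolding homeomorphism_def
  by (simp add: continuous_on_map_prod map_prod_surj_on)

context carnot_group
begin

lemma in_carrier [simp]: "p \<in> carrier G"
  by (simp add: carrier_UNIV)

lemma chart:
  assumes "(V, y) \<in> atlas G"
  shows open_chart: "open V" and open_chart_image: "open (y ` V)"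
    and chart_homeomorphism: "homeomorphism V (y ` V) y (inv_into V y)"
proof -
  from assms smooth_atlas have *: "open V" "open (y ` V)" "\<exists>h. homeomorphism V (y ` V) y h"
    by (auto simp: smooth_atlas_def)
  then show "open V" "open (y ` V)" by auto
  obtain h where h: "homeomorphism V (y ` V) y h" using * by blast
  then have inj: "inj_on y V" by (auto simp: homeomorphism_def intro: inj_on_inverseI)
  have eq: "inv_into V y c = h c" if "c \<in> y ` V" for c
    using that h inj by (auto simp: homeomorphism_def)
  have "homeomorphism V (y ` V) y (inv_into V y)"
    by (rule homeomorphism_cong [OF h]) (simp_all add: eq)
  then show "homeomorphism V (y ` V) y (inv_into V y)" .
qed

lemma chart_inj: "(V, y) \<in> atlas G \<Longrightarrow> inj_on y V"
  by (drule chart_homeomorphism) (auto simp: homeomorphism_def intro: inj_on_inverseI)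

lemma chart_continuous: "(V, y) \<in> atlas G \<Longrightarrow> continuous_on V y"
  by (drule chart_homeomorphism) (auto simp: homeomorphism_def)

lemma chart_inverse [simp]: "(V, y) \<in> atlas G \<Longrightarrow> p \<in> V \<Longrightarrow> inv_into V y (y p) = p"
  by (simp add: chart_inj inv_into_f_f)

lemma chart_around: obtains V y where "(V, y) \<in> atlas G" "p \<in> V"
  using smooth_atlas unfolding smooth_atlas_def by blast

lemma continuous_mult: "continuous_on UNIV (\<lambda>(p, q). p \<otimes> q)"
  using smooth_mult by (simp add: smooth_map_def)

lemma continuous_inv: "continuous_on UNIV (\<lambda>p. inv p)"
  using smooth_inv by (simp add: smooth_map_def)

lemma continuous_on_mult [continuous_intros]:
  "continuous_on A f \<Longrightarrow> continuous_on A g \<Longrightarrow> continuous_on A (\<lambda>x. f x \<otimes> g x)"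
  using continuous_on_compose2 [OF continuous_mult, of A "\<lambda>x. (f x, g x)"]
  by (auto intro: continuous_on_Pair)

lemma continuous_on_inv [continuous_intros]: "continuous_on A f \<Longrightarrow> continuous_on A (\<lambda>x. inv f x)"
  using continuous_on_compose2 [OF continuous_inv, of A f] by auto

text \<open>\<Omega> is the coordinate image of the pairs whose product lies in \<open>C\<close>,
  where smoothness is known; it is open because multiplication is continuous. The formula for
  \<open>M\<close> holds for all pairs in the two domains, charts being total functions.\<close>

lemma mult_in_charts:
  assumes A: "(A, a) \<in> atlas G" and B: "(B, b) \<in> atlas G" and C: "(C, c) \<in> atlas G"
  obtains M \<Omega> where "open \<Omega>"
    "\<And>p q. p \<in> A \<Longrightarrow> q \<in> B \<Longrightarrow> p \<otimes> q \<in> C \<Longrightarrow> (a p, b q) \<in> \<Omega>"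
    "\<And>p q. p \<in> A \<Longrightarrow> q \<in> B \<Longrightarrow> M (a p, b q) = c (p \<otimes> q)"
    "\<And>z. z \<in> \<Omega> \<Longrightarrow> (M has_derivative frechet_derivative M (at z)) (at z)"
    "\<And>i. i \<in> Basis \<Longrightarrow> continuous_on \<Omega> (\<lambda>z. frechet_derivative M (at z) i)"
proof -
  define M where "M = c \<circ> (\<lambda>(p, q). p \<otimes> q) \<circ> inv_into (A \<times> B) (map_prod a b)"
  define W where "W = (A \<times> B) \<inter> (\<lambda>(p, q). p \<otimes> q) -` C"
  define \<Omega> where "\<Omega> = map_prod a b ` W"
  have inj: "inj_on (map_prod a b) (A \<times> B)"
    using chart_inj [OF A] chart_inj [OF B] by (auto simp: inj_on_def)
  have "(A \<times> B, map_prod a b) \<in> prod_atlas (atlas G) (atlas G)"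
    using A B by (auto simp: prod_atlas_def)
  then have smooth: "smooth_on M \<Omega>"
    using smooth_mult C unfolding smooth_map_def M_def \<Omega>_def W_def by fast
  have "open W"
    unfolding W_def using open_chart [OF A] open_chart [OF B] open_chart [OF C]
    by (intro open_Int open_Times open_vimage [OF _ continuous_mult])
  have hom: "homeomorphism (A \<times> B) (a ` A \<times> b ` B) (map_prod a b) (map_prod (inv_into A a) (inv_into B b))"
    using chart_homeomorphism [OF A] chart_homeomorphism [OF B]
    by (rule homeomorphism_map_prod)
  have "openin (top_of_set (A \<times> B)) W"
    using \<open>open W\<close> by (intro open_subset) (auto simp: W_def)
  then have "openin (top_of_set (a ` A \<times> b ` B)) \<Omega>"
    unfolding \<Omega>_def by (rule homeomorphism_imp_open_map [OF hom])
  then have \<Omega>: "open \<Omega>"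
    using open_Times [OF open_chart_image [OF A] open_chart_image [OF B]] openin_open_trans by blast
  show ?thesis
  proof (rule that [OF \<Omega>, of M])
    show "(a p, b q) \<in> \<Omega>" if "p \<in> A" "q \<in> B" "p \<otimes> q \<in> C" for p q
      using that by (force simp: \<Omega>_def W_def)
    show "M (a p, b q) = c (p \<otimes> q)" if "p \<in> A" "q \<in> B" for p q
      using that inv_into_f_f [OF inj, of "(p, q)"] by (simp add: M_def)
  qed (use smooth_on_derivative [OF smooth \<Omega>] in auto)
qed

text \<open>\<open>coframe (V, y) p w\<close> is the expression in the left-invariant frame of the vector at \<open>p\<close>
  with coordinates \<open>w\<close> in the chart \<open>(V, y)\<close>.\<close>

definition coframe :: "('g, 'e) chart \<Rightarrow> 'g \<Rightarrow> 'e \<Rightarrow> 'e" where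
  "coframe c p = frechet_derivative
     (\<lambda>z. id_coord G (inv p \<otimes> inv_into (fst c) (snd c) z)) (at (snd c p))"

lemma id_chart': "(fst (id_chart G), id_coord G) \<in> atlas G"
  using id_chart(1) by simp

text \<open>The linear map in question is a partial derivative of multiplication in charts, taken at
  the coordinates of \<open>inv p\<close> and \<open>p\<close>. A second chart around
  \<open>inv p0\<close> is needed to write it so; continuity in \<open>p\<close> then follows from
  that of the derivative of \<open>M\<close>.\<close>

lemma coframe_local:
  assumes V: "(V, y) \<in> atlas G" and p0: "p0 \<in> V"
  obtains O' where "open O'" "p0 \<in> O'" "O' \<subseteq> V"
    "\<And>p. p \<in> O' \<Longrightarrow> ((\<lambda>z. id_coord G (inv p \<otimes> inv_into V y z)) has_derivative coframe (V, y) p) (at (y p))"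
    "\<And>w. continuous_on O' (\<lambda>p. coframe (V, y) p w)"
proof -
  obtain V1 y1 where V1: "(V1, y1) \<in> atlas G" "inv p0 \<in> V1" by (rule chart_around)
  obtain M \<Omega> where M: "open \<Omega>"
    "\<And>p q. p \<in> V1 \<Longrightarrow> q \<in> V \<Longrightarrow> p \<otimes> q \<in> fst (id_chart G) \<Longrightarrow> (y1 p, y q) \<in> \<Omega>"
    "\<And>p q. p \<in> V1 \<Longrightarrow> q \<in> V \<Longrightarrow> M (y1 p, y q) = id_coord G (p \<otimes> q)"
    "\<And>z. z \<in> \<Omega> \<Longrightarrow> (M has_derivative frechet_derivative M (at z)) (at z)"
    "\<And>i. i \<in> Basis \<Longrightarrow> continuous_on \<Omega> (\<lambda>z. frechet_derivative M (at z) i)"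
    using mult_in_charts [OF V1(1) V id_chart'] by metis
  define O' where "O' = V \<inter> (\<lambda>p. inv p) -` V1"
  have "open O'"
    unfolding O'_def using open_chart [OF V] open_chart [OF V1(1)]
    by (intro open_Int open_vimage [OF _ continuous_inv])
  have in_\<Omega>: "(y1 (inv p), y p) \<in> \<Omega>" if "p \<in> O'" for p
    using M(2) [of "inv p" p] that id_chart(2) by (auto simp: O'_def)
  define L where "L p w = frechet_derivative M (at (y1 (inv p), y p)) (0, w)" for p w
  have der: "((\<lambda>z. id_coord G (inv p \<otimes> inv_into V y z)) has_derivative L p) (at (y p))" if p: "p \<in> O'" for p
  proof (rule has_derivative_transform_within_open)
    show "((\<lambda>z. M (y1 (inv p), z)) has_derivative L p) (at (y p))"
      using has_derivative_snd_slice [OF M(4) [OF in_\<Omega> [OF p]]] by (simp add: L_def [abs_def])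
    show "open (y ` V)" "y p \<in> y ` V" using open_chart_image [OF V] p by (auto simp: O'_def)
    show "M (y1 (inv p), z) = id_coord G (inv p \<otimes> inv_into V y z)" if "z \<in> y ` V" for z
      using that M(3) p V by (auto simp: O'_def)
  qed
  have coframe: "coframe (V, y) p = L p" if "p \<in> O'" for p
    using frechet_derivative_at [OF der [OF that]] by (simp add: coframe_def)
  have cont: "continuous_on O' (\<lambda>p. L p w)" for w
  proof -
    have c: "continuous_on O' (\<lambda>p. (y1 (inv p), y p))"
      by (intro continuous_on_Pair continuous_on_subset [OF chart_continuous [OF V]]
          continuous_on_compose2 [OF chart_continuous [OF V1(1)] continuous_on_inv [OF continuous_on_id]])
        (auto simp: O'_def)
    have b: "continuous_on O' (\<lambda>p. L p b)" if "b \<in> Basis" for b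
      unfolding L_def
      by (rule continuous_on_compose2 [OF M(5) c]) (use that in_\<Omega> in \<open>auto simp: Basis_prod_def\<close>)
    have "L p w = (\<Sum>b\<in>Basis. (w \<bullet> b) *\<^sub>R L p b)" if "p \<in> O'" for p
    proof -
      have lin: "linear (L p)" using der [OF that] by (rule has_derivative_linear)
      have "L p w = L p (\<Sum>b\<in>Basis. (w \<bullet> b) *\<^sub>R b)" by (simp add: euclidean_representation)
      then show ?thesis by (simp add: linear_sum [OF lin] linear_scale [OF lin])
    qed
    moreover have "continuous_on O' (\<lambda>p. \<Sum>b\<in>Basis. (w \<bullet> b) *\<^sub>R L p b)"
      using b by (intro continuous_intros)
    ultimately show ?thesis by (auto intro: continuous_on_eq)
  qed
  show ?thesis
  proof (rule that [OF \<open>open O'\<close>])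
    show "p0 \<in> O'" "O' \<subseteq> V" using p0 V1 by (auto simp: O'_def)
    show "((\<lambda>z. id_coord G (inv p \<otimes> inv_into V y z)) has_derivative coframe (V, y) p) (at (y p))"
      if "p \<in> O'" for p using der coframe that by simp
    show "continuous_on O' (\<lambda>p. coframe (V, y) p w)" for w
      using cont by (rule continuous_on_eq) (simp add: coframe)
  qed
qed

lemma coframe_has_derivative:
  assumes "(V, y) \<in> atlas G" "p \<in> V"
  shows "((\<lambda>z. id_coord G (inv p \<otimes> inv_into V y z)) has_derivative coframe (V, y) p) (at (y p))"
  using coframe_local [OF assms] by metis

lemma linear_coframe: "(V, y) \<in> atlas G \<Longrightarrow> p \<in> V \<Longrightarrow> linear (coframe (V, y) p)"
  by (rule has_derivative_linear [OF coframe_has_derivative])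

lemma continuous_on_coframe:
  assumes V: "(V, y) \<in> atlas G"
  shows "continuous_on V (\<lambda>p. coframe (V, y) p w)"
proof (subst continuous_on_eq_continuous_at [OF open_chart [OF V]], intro ballI)
  fix p assume "p \<in> V"
  then obtain O' where "open O'" "p \<in> O'" "continuous_on O' (\<lambda>p. coframe (V, y) p w)"
    using coframe_local [OF V] by metis
  then show "isCont (\<lambda>p. coframe (V, y) p w) p"
    by (simp add: continuous_on_eq_continuous_at)
qed

text \<open>\<open>N\<close> is left translation by \<open>p\<close>, read from the identity chart
  into \<open>(V, y)\<close>. It undoes the translation to the identity that is built into
  \<open>has_velocity\<close>.\<close>

lemma has_derivative_left_translation:
  assumes V: "(V, y) \<in> atlas G" and p: "p \<in> V"
  obtains N N' where "(N has_derivative N') (at (id_coord G \<one>))"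
    "\<And>q. inv p \<otimes> q \<in> fst (id_chart G) \<Longrightarrow> N (id_coord G (inv p \<otimes> q)) = y q"
proof -
  obtain M \<Omega> where M: "open \<Omega>"
    "\<And>p q. p \<in> V \<Longrightarrow> q \<in> fst (id_chart G) \<Longrightarrow> p \<otimes> q \<in> V \<Longrightarrow> (y p, id_coord G q) \<in> \<Omega>"
    "\<And>p q. p \<in> V \<Longrightarrow> q \<in> fst (id_chart G) \<Longrightarrow> M (y p, id_coord G q) = y (p \<otimes> q)"
    "\<And>z. z \<in> \<Omega> \<Longrightarrow> (M has_derivative frechet_derivative M (at z)) (at z)"
    using mult_in_charts [OF V id_chart' V] by metis
  have "(y p, id_coord G \<one>) \<in> \<Omega>"
    using M(2) [of p \<one>] p id_chart(2) by simp
  note has_derivative_snd_slice [OF M(4) [OF this]]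
  moreover have "M (y p, id_coord G (inv p \<otimes> q)) = y q" if "inv p \<otimes> q \<in> fst (id_chart G)" for q
    using M(3) [OF p that] by (simp add: m_assoc [symmetric])
  ultimately show ?thesis by (rule that)
qed

lemma left_translate_open: "open U \<Longrightarrow> open {q. inv p \<otimes> q \<in> U}"
  using open_vimage [of U "\<lambda>q. inv p \<otimes> q"] continuous_on_mult [of UNIV "\<lambda>_. inv p" "\<lambda>q. q"]
  by (simp add: vimage_def continuous_on_id continuous_on_const)

text \<open>\<open>has_velocity\<close> reads the curve in the identity chart after translation by
  the inverse of \<open>\<gamma> t\<close>. \<open>coframe\<close> leads from the chart
  \<open>(V, y)\<close> to this reading and \<open>has_derivative_left_translation\<close> leads
  back; continuity keeps the curve in both chart domains near \<open>t\<close>.\<close>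

lemma has_velocity_iff:
  assumes V: "(V, y) \<in> atlas G" and p: "\<gamma> t \<in> V"
  shows "has_velocity G \<gamma> v t \<longleftrightarrow> isCont \<gamma> t \<and>
    (\<exists>w. ((\<lambda>s. y (\<gamma> s)) has_vector_derivative w) (at t) \<and> v = coframe (V, y) (\<gamma> t) w)"
proof (cases "isCont \<gamma> t")
  case False
  then show ?thesis by (simp add: has_velocity_def)
next
  case cont: True
  let ?p = "\<gamma> t"
  let ?\<kappa> = "\<lambda>s. id_coord G (inv ?p \<otimes> \<gamma> s)"
  have ev: "\<forall>\<^sub>F s in nhds t. \<gamma> s \<in> U" if "open U" "?p \<in> U" for U
    using cont that by (simp add: continuous_at_imp_continuous_within isCont_def tendsto_at_iff_tendsto_nhds topological_tendstoD)
  have fwd: "(?\<kappa> has_vector_derivative coframe (V, y) ?p w) (at t)"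
    if w: "((\<lambda>s. y (\<gamma> s)) has_vector_derivative w) (at t)" for w
  proof -
    have "((\<lambda>s. id_coord G (inv ?p \<otimes> inv_into V y (y (\<gamma> s)))) has_vector_derivative coframe (V, y) ?p w) (at t)"
      using has_vector_derivative_within_curve [OF coframe_has_derivative [OF V p] w] by simp
    then show ?thesis
    proof (rule has_vector_derivative_cong_ev [THEN iffD1, rotated 2])
      show "\<forall>\<^sub>F s in nhds t. s \<in> UNIV \<longrightarrow> id_coord G (inv ?p \<otimes> inv_into V y (y (\<gamma> s))) = ?\<kappa> s"
        using ev [OF open_chart [OF V] p] V by (auto elim!: eventually_mono)
    qed (use V p in simp)
  qed
  have bwd: "\<exists>w. ((\<lambda>s. y (\<gamma> s)) has_vector_derivative w) (at t)" if v: "(?\<kappa> has_vector_derivative v) (at t)" for v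
  proof -
    obtain N N' where N: "(N has_derivative N') (at (id_coord G \<one>))"
      "\<And>q. inv ?p \<otimes> q \<in> fst (id_chart G) \<Longrightarrow> N (id_coord G (inv ?p \<otimes> q)) = y q"
      using has_derivative_left_translation [OF V p] by metis
    have "((\<lambda>s. N (?\<kappa> s)) has_vector_derivative N' v) (at t)"
      by (rule has_vector_derivative_within_curve [OF _ v, where U = UNIV]) (use N(1) in simp_all)
    then have "((\<lambda>s. y (\<gamma> s)) has_vector_derivative N' v) (at t)"
    proof (rule has_vector_derivative_cong_ev [THEN iffD1, rotated 2])
      have "\<forall>\<^sub>F s in nhds t. \<gamma> s \<in> {q. inv ?p \<otimes> q \<in> fst (id_chart G)}"
        using id_chart(2) by (intro ev left_translate_open open_chart [OF id_chart']) simp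
      then show "\<forall>\<^sub>F s in nhds t. s \<in> UNIV \<longrightarrow> N (?\<kappa> s) = y (\<gamma> s)"
        by (rule eventually_mono) (simp add: N(2))
      show "N (?\<kappa> t) = y (\<gamma> t)" by (rule N(2)) (simp add: id_chart(2))
    qed
    then show ?thesis by blast
  qed
  show ?thesis
    using cont fwd bwd vector_derivative_unique_at unfolding has_velocity_def by metis
qed

lemma has_velocity_unique: "has_velocity G \<gamma> v t \<Longrightarrow> has_velocity G \<gamma> v' t \<Longrightarrow> v = v'"
  unfolding has_velocity_def using vector_derivative_unique_at by blast

end

section \<open>Local parametrizations\<close>

lemma at_within_openin:
  assumes "openin (top_of_set U) W" "u \<in> W"
  shows "at u within W = at u within U"
proof -
  obtain T where "open T" "W = U \<inter> T" using assms(1) by (auto simp: openin_open)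
  then show ?thesis using assms(2) by (intro at_within_nhd [of u T]) auto
qed

lemma continuous_on_locally:
  fixes f :: "'a::t2_space \<Rightarrow> 'b::topological_space"
  assumes "\<And>u. u \<in> U \<Longrightarrow> \<exists>W. openin (top_of_set U) W \<and> u \<in> W \<and> continuous_on W f"
  shows "continuous_on U f"
  unfolding continuous_on_eq_continuous_within
proof
  fix u assume "u \<in> U"
  then obtain W where W: "openin (top_of_set U) W" "u \<in> W" "continuous_on W f" using assms by blast
  then have "continuous (at u within W) f" by (simp add: continuous_on_eq_continuous_within)
  then show "continuous (at u within U) f" using at_within_openin [OF W(1,2)] by simp
qed

lemma isCont_eventually:
  assumes "isCont f t" "open O'" "f t \<in> O'"
  shows "\<forall>\<^sub>F s in nhds t. f s \<in> O'"
  using assms unfolding isCont_def tendsto_at_iff_tendsto_nhds by (rule topological_tendstoD)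

lemma local_paramD:
  assumes "local_param G k N D U f"
  shows "D \<subseteq> Basis" "finite D" "openin (top_of_set (span D)) U" "U \<subseteq> span D" "openin (top_of_set N) (f ` U)"
    "f ` U \<subseteq> N" "homeomorphism U (f ` U) f (inv_into U f)" "inj_on f U" "continuous_on U f"
    "\<And>V y. (V, y) \<in> atlas G \<Longrightarrow> C_on k D (y \<circ> f) (U \<inter> f -` V)"
    "\<And>u c b. u \<in> U \<Longrightarrow> (\<Sum>b\<in>D. c b *\<^sub>R partial_velocity G f u b) = 0 \<Longrightarrow> b \<in> D \<Longrightarrow> c b = 0"
proof -
  show D: "D \<subseteq> Basis" and U: "openin (top_of_set (span D)) U" and fU: "openin (top_of_set N) (f ` U)"
    and "\<And>V y. (V, y) \<in> atlas G \<Longrightarrow> C_on k D (y \<circ> f) (U \<inter> f -` V)"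
    and "\<And>u c b. u \<in> U \<Longrightarrow> (\<Sum>b\<in>D. c b *\<^sub>R partial_velocity G f u b) = 0 \<Longrightarrow> b \<in> D \<Longrightarrow> c b = 0"
    using assms unfolding local_param_def by (blast, blast, blast, blast, blast)
  show "finite D" using D finite_Basis finite_subset by blast
  show "U \<subseteq> span D" "f ` U \<subseteq> N" using U fU openin_imp_subset by blast+
  obtain h where h: "homeomorphism U (f ` U) f h" using assms unfolding local_param_def by blast
  show inj: "inj_on f U" and "continuous_on U f"
    using h by (auto simp: homeomorphism_def intro: inj_on_inverseI)
  show "homeomorphism U (f ` U) f (inv_into U f)"
    by (rule homeomorphism_cong [OF h]) (use h inj in \<open>auto simp: homeomorphism_def\<close>)
qed

lemma local_param_2_imp_1: "local_param G 2 N D U f \<Longrightarrow> local_param G 1 N D U f"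
  unfolding local_param_def numeral_2_eq_2 One_nat_def using C_on_Suc_imp by blast

lemma submanifold_2_imp_1: "submanifold G 2 m N \<Longrightarrow> submanifold G 1 m N"
  unfolding submanifold_def using local_param_2_imp_1 by blast

context carnot_group
begin

lemma has_velocity_cong:
  assumes "has_velocity G \<gamma> v t" and ev: "\<forall>\<^sub>F s in nhds t. \<gamma> s = \<gamma>' s"
  shows "has_velocity G \<gamma>' v t"
proof -
  have eq: "\<gamma> t = \<gamma>' t" using ev by (rule eventually_nhds_x_imp_x)
  have "isCont \<gamma>' t" using assms isCont_cong [OF ev] by (simp add: has_velocity_def)
  moreover have "((\<lambda>s. id_coord G (inv (\<gamma>' t) \<otimes> \<gamma>' s)) has_vector_derivative v) (at t)"
  proof (rule has_vector_derivative_cong_ev [THEN iffD1])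
    show "((\<lambda>s. id_coord G (inv (\<gamma> t) \<otimes> \<gamma> s)) has_vector_derivative v) (at t)"
      using assms(1) by (simp add: has_velocity_def)
    show "\<forall>\<^sub>F s in nhds t. s \<in> UNIV \<longrightarrow> id_coord G (inv (\<gamma> t) \<otimes> \<gamma> s) = id_coord G (inv (\<gamma>' t) \<otimes> \<gamma>' s)"
      using ev by eventually_elim (simp add: eq)
  qed (simp add: eq)
  ultimately show ?thesis by (simp add: has_velocity_def)
qed

context
  fixes N D U f
  assumes P: "local_param G 1 N D U f"
begin

lemmas param = local_paramD [OF P]

lemma param_chart_domain:
  assumes V: "(V, y) \<in> atlas G"
  shows "openin (top_of_set U) (U \<inter> f -` V)" "openin (top_of_set (span D)) (U \<inter> f -` V)"
proof -
  show *: "openin (top_of_set U) (U \<inter> f -` V)"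
    using param(9) open_chart [OF V] by (simp add: continuous_on_open_gen openin_open_Int continuous_openin_preimage_gen)
  show "openin (top_of_set (span D)) (U \<inter> f -` V)"
    using openin_trans [OF * param(3)] .
qed

lemma param_derivative:
  assumes V: "(V, y) \<in> atlas G" and u: "u \<in> U" "f u \<in> V"
  shows "((\<lambda>u. y (f u)) has_derivative frechet_derivative (y \<circ> f) (at u within U \<inter> f -` V)) (at u within U \<inter> f -` V)"
proof -
  have "(y \<circ> f) differentiable (at u within U \<inter> f -` V)"
    using param(10) [OF V] u unfolding C_on_1_iff differentiable_on_def by auto
  then have "((y \<circ> f) has_derivative frechet_derivative (y \<circ> f) (at u within U \<inter> f -` V)) (at u within U \<inter> f -` V)"
    by (rule frechet_derivative_works [THEN iffD1])
  then show ?thesis by (simp add: comp_def)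
qed

lemma param_curve_velocity_chart:
  assumes V: "(V, y) \<in> atlas G" and c: "(c has_vector_derivative c') (at t)"
    and U: "\<forall>\<^sub>F s in nhds t. c s \<in> U" and fV: "f (c t) \<in> V"
  shows "has_velocity G (\<lambda>s. f (c s))
    (coframe (V, y) (f (c t)) (frechet_derivative (y \<circ> f) (at (c t) within U \<inter> f -` V) c')) t"
proof -
  have ct: "c t \<in> U" using U by (rule eventually_nhds_x_imp_x)
  have cont_c: "isCont c t" using c by (rule has_vector_derivative_continuous)
  have ev: "\<forall>\<^sub>F s in nhds t. c s \<in> W" if W: "openin (top_of_set U) W" "c t \<in> W" for W
  proof -
    obtain T where T: "open T" "W = U \<inter> T" using W(1) by (auto simp: openin_open)
    have "\<forall>\<^sub>F s in nhds t. c s \<in> T"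
      using cont_c T W by (intro isCont_eventually) auto
    then show ?thesis using U by eventually_elim (simp add: T)
  qed
  have "((\<lambda>s. f (c s)) \<longlongrightarrow> f (c t)) (nhds t)"
  proof (rule topological_tendstoI)
    fix T assume T: "open T" "f (c t) \<in> T"
    have "openin (top_of_set U) (U \<inter> f -` T)"
      using param(9) T(1) by (rule continuous_openin_preimage_gen)
    from ev [OF this] show "\<forall>\<^sub>F s in nhds t. f (c s) \<in> T"
      using ct T by (auto elim: eventually_mono)
  qed
  then have "isCont (\<lambda>s. f (c s)) t"
    unfolding isCont_def by (rule tendsto_mono [OF at_within_le_nhds])
  moreover have "((\<lambda>s. y (f (c s))) has_vector_derivative
      frechet_derivative (y \<circ> f) (at (c t) within U \<inter> f -` V) c') (at t)"
    using ct fV by (intro has_vector_derivative_within_curve [OF param_derivative [OF V] c] ev param_chart_domain [OF V]) auto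
  ultimately show ?thesis
    using has_velocity_iff [OF V, of "\<lambda>s. f (c s)" t] fV by blast
qed

lemma has_velocity_partial:
  assumes u: "u \<in> U" and b: "b \<in> span D"
  shows "has_velocity G (\<lambda>t. f (u + t *\<^sub>R b)) (partial_velocity G f u b) 0"
proof -
  obtain V y where V: "(V, y) \<in> atlas G" "f u \<in> V" by (rule chart_around)
  have "((\<lambda>t. u + t *\<^sub>R b) has_vector_derivative b) (at 0)"
    by (auto intro!: derivative_eq_intros)
  from param_curve_velocity_chart [OF V(1) this] obtain v where "has_velocity G (\<lambda>t. f (u + t *\<^sub>R b)) v 0"
    using V u eventually_line_in [OF param(3) u b] by auto
  then show ?thesis
    unfolding partial_velocity_def by (rule theI) (rule has_velocity_unique [OF _ \<open>has_velocity G _ v 0\<close>])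
qed

lemma partial_velocity_chart:
  assumes V: "(V, y) \<in> atlas G" "f u \<in> V" and u: "u \<in> U" and b: "b \<in> span D"
  shows "partial_velocity G f u b =
    coframe (V, y) (f u) (frechet_derivative (y \<circ> f) (at u within U \<inter> f -` V) b)"
proof -
  have "((\<lambda>t. u + t *\<^sub>R b) has_vector_derivative b) (at 0)"
    by (auto intro!: derivative_eq_intros)
  from param_curve_velocity_chart [OF V(1) this] show ?thesis
    using V u eventually_line_in [OF param(3) u b] has_velocity_unique [OF has_velocity_partial [OF u b]] by simp
qed

lemma linear_chart_velocity:
  assumes V: "(V, y) \<in> atlas G" "f u \<in> V" and u: "u \<in> U" and d: "d \<in> span D"
  shows "coframe (V, y) (f u) (frechet_derivative (y \<circ> f) (at u within U \<inter> f -` V) d) =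
    (\<Sum>b\<in>D. (d \<bullet> b) *\<^sub>R partial_velocity G f u b)"
proof -
  let ?A = "\<lambda>d. coframe (V, y) (f u) (frechet_derivative (y \<circ> f) (at u within U \<inter> f -` V) d)"
  have lin: "linear ?A"
    using linear_compose [OF has_derivative_linear [OF param_derivative [OF V(1) u V(2)]] linear_coframe [OF V]]
    by (simp add: comp_def)
  have "?A (\<Sum>b\<in>D. (d \<bullet> b) *\<^sub>R b) = (\<Sum>b\<in>D. (d \<bullet> b) *\<^sub>R ?A b)"
    by (simp add: linear_sum [OF lin] linear_scale [OF lin])
  also have "\<dots> = (\<Sum>b\<in>D. (d \<bullet> b) *\<^sub>R partial_velocity G f u b)"
    by (intro sum.cong) (simp_all add: partial_velocity_chart [OF V u] span_base)
  finally show ?thesis using span_coords_expansion [OF param(1) d] by simp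
qed

lemma param_curve_velocity:
  assumes "(c has_vector_derivative c') (at t)" "\<forall>\<^sub>F s in nhds t. c s \<in> U" "c' \<in> span D"
  shows "has_velocity G (\<lambda>s. f (c s)) (\<Sum>b\<in>D. (c' \<bullet> b) *\<^sub>R partial_velocity G f (c t) b) t"
proof -
  obtain V y where V: "(V, y) \<in> atlas G" "f (c t) \<in> V" by (rule chart_around)
  show ?thesis
    using param_curve_velocity_chart [OF V(1) assms(1,2) V(2)]
      linear_chart_velocity [OF V eventually_nhds_x_imp_x [OF assms(2)] assms(3)] by simp
qed

text \<open>A vector in the kernel of the derivative of \<open>f\<close> in a chart would give a
  vanishing combination of the partial velocities, which are independent. This supplies the
  injectivity that \<open>has_derivative_of_lift\<close> asks for.\<close>

lemma param_chart_immersion: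
  assumes V: "(V, y) \<in> atlas G" "f u \<in> V" and u: "u \<in> U" and d: "d \<in> span D"
    and 0: "frechet_derivative (y \<circ> f) (at u within U \<inter> f -` V) d = 0"
  shows "d = 0"
proof -
  have "(\<Sum>b\<in>D. (d \<bullet> b) *\<^sub>R partial_velocity G f u b) = 0"
    using linear_chart_velocity [OF V u d] 0 linear_0 [OF linear_coframe [OF V]] by simp
  then have "d \<bullet> b = 0" if "b \<in> D" for b
    using param(11) [OF u, of "\<lambda>b. d \<bullet> b"] that by blast
  then have "(\<Sum>b\<in>D. (d \<bullet> b) *\<^sub>R b) = 0" by simp
  then show ?thesis using span_coords_expansion [OF param(1) d] by simp
qed

text \<open>Continuity of \<open>coframe\<close> in the base point is known for a fixed argument, so
  the argument, which varies with \<open>u\<close>, is expanded in \<open>Basis\<close>.\<close>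

lemma continuous_on_partial_velocity:
  assumes b: "b \<in> D"
  shows "continuous_on U (\<lambda>u. partial_velocity G f u b)"
proof (rule continuous_on_locally)
  fix u assume u: "u \<in> U"
  obtain V y where V: "(V, y) \<in> atlas G" "f u \<in> V" by (rule chart_around)
  let ?W = "U \<inter> f -` V"
  let ?d = "\<lambda>u. frechet_derivative (y \<circ> f) (at u within ?W) b"
  have cd: "continuous_on ?W ?d"
    using param(10) [OF V(1)] b unfolding C_on_1_iff by blast
  have cf: "continuous_on ?W (\<lambda>u. coframe (V, y) (f u) i)" for i
    by (rule continuous_on_compose2 [OF continuous_on_coframe [OF V(1)] continuous_on_subset [OF param(9)]]) auto
  have "continuous_on ?W (\<lambda>u. \<Sum>i\<in>Basis. (?d u \<bullet> i) *\<^sub>R coframe (V, y) (f u) i)"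
    by (intro continuous_intros cd cf)
  then have "continuous_on ?W (\<lambda>u. partial_velocity G f u b)"
  proof (rule continuous_on_eq)
    fix u assume u: "u \<in> ?W"
    then have lin: "linear (coframe (V, y) (f u))" using V by (intro linear_coframe) auto
    have "(\<Sum>i\<in>Basis. (?d u \<bullet> i) *\<^sub>R coframe (V, y) (f u) i) =
        coframe (V, y) (f u) (\<Sum>i\<in>Basis. (?d u \<bullet> i) *\<^sub>R i)"
      by (simp only: linear_sum [OF lin] linear_scale [OF lin])
    also have "\<dots> = partial_velocity G f u b"
      using u V b by (simp add: euclidean_representation partial_velocity_chart [OF V(1)] span_base)
    finally show "(\<Sum>i\<in>Basis. (?d u \<bullet> i) *\<^sub>R coframe (V, y) (f u) i) = partial_velocity G f u b" .
  qed
  then show "\<exists>W. openin (top_of_set U) W \<and> u \<in> W \<and> continuous_on W (\<lambda>u. partial_velocity G f u b)"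
    using param_chart_domain(1) [OF V(1)] u V(2) by blast
qed

text \<open>\<open>has_derivative_of_lift\<close> for the inverse of a parametrization, which is
  known to be continuous only. It is applied to curves in \<open>velocity_lift\<close> and to
  transition maps in \<open>param_transition\<close>.\<close>

lemma has_derivative_param_lift:
  fixes h :: "'z::real_normed_vector \<Rightarrow> 'e" and g :: "'z \<Rightarrow> 'g"
  assumes V: "(V, y) \<in> atlas G" and a: "a \<in> A" and cont: "continuous (at a within A) g"
    and gA: "g ` A \<subseteq> f ` U \<inter> V"
    and g: "((\<lambda>x. y (g x)) has_derivative g') (at a within A)"
  obtains h' where "((\<lambda>x. inv_into U f (g x)) has_derivative h') (at a within A)" "range h' \<subseteq> span D"
proof -
  let ?h = "\<lambda>x. inv_into U f (g x)"
  have fh: "f (?h x) = g x" and hU: "?h x \<in> U \<inter> f -` V" if "x \<in> A" for x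
    using that gA f_inv_into_f [of "g x" f U] inv_into_into [of "g x" f U] by auto
  have gaU: "g a \<in> f ` U" using gA a by auto
  have cont_h: "continuous (at a within A) ?h"
  proof -
    have "continuous_on (f ` U) (inv_into U f)" using param(7) by (simp add: homeomorphism_def)
    moreover have "(g \<longlongrightarrow> g a) (at a within A)" using cont by (simp add: continuous_within)
    moreover have "\<forall>\<^sub>F x in at a within A. g x \<in> f ` U"
      unfolding eventually_at_filter using gA by (intro always_eventually) auto
    ultimately have "(?h \<longlongrightarrow> ?h a) (at a within A)"
      using gaU by (intro continuous_on_tendsto_compose [of "f ` U" "inv_into U f"])
    then show ?thesis by (simp add: continuous_within)
  qed
  show ?thesis
  proof (rule has_derivative_of_lift [where f = "\<lambda>u. y (f u)" and h = ?h and a = a and A = A and E = "span D"])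
    show "((\<lambda>u. y (f u)) has_derivative frechet_derivative (y \<circ> f) (at (?h a) within U \<inter> f -` V)) (at (?h a) within U \<inter> f -` V)"
      using hU [OF a] by (intro param_derivative [OF V]) auto
    show "subspace (span D)" by simp
    show "U \<inter> f -` V \<subseteq> span D" using param(4) by auto
    show "d = 0" if "d \<in> span D" "frechet_derivative (y \<circ> f) (at (?h a) within U \<inter> f -` V) d = 0" for d
      using hU [OF a] that by (intro param_chart_immersion [OF V, of "?h a" d]) auto
    show "?h ` A \<subseteq> U \<inter> f -` V" using hU by blast
    show "continuous (at a within A) ?h" by (rule cont_h)
    show "((\<lambda>x. y (f (?h x))) has_derivative g') (at a within A)"
      by (rule has_derivative_transform [OF a _ g]) (simp add: fh)
  qed (use a that in auto)
qed

text \<open>The curve need neither be differentiable away from \<open>t\<close> nor stay in the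
  image of \<open>f\<close>. Continuity at \<open>t\<close> keeps it in that relatively open image
  at nearby times, where it has parameters, and these inherit the derivative at
  \<open>t\<close>.\<close>

lemma velocity_lift:
  assumes \<gamma>: "range \<gamma> \<subseteq> N" "\<gamma> t = f u" "has_velocity G \<gamma> v t" and u: "u \<in> U"
  obtains c d where "\<forall>\<^sub>F s in nhds t. c s \<in> U \<and> f (c s) = \<gamma> s" "c t = u" "(c has_vector_derivative d) (at t)"
    "d \<in> span D" "v = (\<Sum>b\<in>D. (d \<bullet> b) *\<^sub>R partial_velocity G f u b)"
proof -
  obtain V y where V: "(V, y) \<in> atlas G" "f u \<in> V" by (rule chart_around)
  have cont: "isCont \<gamma> t" using \<gamma> by (simp add: has_velocity_def)
  obtain T where T: "open T" "f ` U = N \<inter> T" using param(5) by (auto simp: openin_open)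
  have "f u \<in> T \<inter> V" using u T V by auto
  then have "\<forall>\<^sub>F s in nhds t. \<gamma> s \<in> T \<inter> V"
    using \<gamma>(2) T open_chart [OF V(1)] by (intro isCont_eventually [OF cont]) auto
  then obtain A where A: "open A" "t \<in> A" "\<And>s. s \<in> A \<Longrightarrow> \<gamma> s \<in> T \<inter> V"
    by (auto simp: eventually_nhds)
  have \<gamma>A: "\<gamma> ` A \<subseteq> f ` U \<inter> V" using A \<gamma>(1) T by auto
  obtain w where "((\<lambda>s. y (\<gamma> s)) has_vector_derivative w) (at t)"
    using \<gamma> V has_velocity_iff [OF V(1), of \<gamma> t v] by auto
  then have w: "((\<lambda>s. y (\<gamma> s)) has_derivative (\<lambda>h. h *\<^sub>R w)) (at t within A)"
    by (auto simp: has_vector_derivative_def intro: has_derivative_at_withinI)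
  let ?c = "\<lambda>s. inv_into U f (\<gamma> s)"
  obtain h' where h': "(?c has_derivative h') (at t within A)" "range h' \<subseteq> span D"
    using has_derivative_param_lift [OF V(1) A(2) _ \<gamma>A w] cont by (metis continuous_at_imp_continuous_at_within)
  have c: "(?c has_vector_derivative h' 1) (at t)"
  proof -
    have "h' r = r *\<^sub>R h' 1" for r
      using linear_scale [OF has_derivative_linear [OF h'(1)], of r 1] by simp
    then have "(\<lambda>r. r *\<^sub>R h' 1) = h'" by (intro ext) (rule sym)
    then show ?thesis
      using h'(1) by (simp only: has_vector_derivative_def at_within_open [OF A(2,1)])
  qed
  have fc: "\<forall>\<^sub>F s in nhds t. ?c s \<in> U \<and> f (?c s) = \<gamma> s"
    unfolding eventually_nhds
    using A(1,2) \<gamma>A by (intro exI [of _ A]) (auto simp: inv_into_into f_inv_into_f image_subset_iff)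
  have ct: "?c t = u" using \<gamma>(2) u param(8) by simp
  have d: "h' 1 \<in> span D" using h'(2) by auto
  have "has_velocity G (\<lambda>s. f (?c s)) (\<Sum>b\<in>D. (h' 1 \<bullet> b) *\<^sub>R partial_velocity G f (?c t) b) t"
    using fc by (intro param_curve_velocity [OF c _ d]) (auto elim: eventually_mono)
  then have "has_velocity G \<gamma> (\<Sum>b\<in>D. (h' 1 \<bullet> b) *\<^sub>R partial_velocity G f u b) t"
    unfolding ct by (rule has_velocity_cong) (use fc in \<open>auto elim: eventually_mono\<close>)
  then have "v = (\<Sum>b\<in>D. (h' 1 \<bullet> b) *\<^sub>R partial_velocity G f u b)"
    using has_velocity_unique \<gamma>(3) by blast
  then show ?thesis using that [OF fc ct c d] by blast
qed

lemma tangent_curve: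
  assumes u: "u \<in> U"
  obtains \<gamma> where "range \<gamma> \<subseteq> N" "\<gamma> 0 = f u" "\<forall>\<^sub>F s in nhds 0. \<gamma> s = f (u + s *\<^sub>R (\<Sum>b\<in>D. c b *\<^sub>R b))"
    "has_velocity G \<gamma> (\<Sum>b\<in>D. c b *\<^sub>R partial_velocity G f u b) 0"
proof -
  let ?d = "\<Sum>b\<in>D. c b *\<^sub>R b"
  \<comment> \<open>\<open>tangent_space\<close> admits only curves that lie in \<open>N\<close> at
    all times, so the image of the line is replaced by the constant \<open>f u\<close> wherever the
    line is outside \<open>U\<close>.\<close>
  let ?\<gamma> = "\<lambda>s::real. if u + s *\<^sub>R ?d \<in> U then f (u + s *\<^sub>R ?d) else f u"
  have d: "?d \<in> span D" by (intro span_sum span_scale span_base)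
  have coords: "?d \<bullet> b = c b" if "b \<in> D" for b by (rule inner_sum_coords [OF param(1) that])
  have ev: "\<forall>\<^sub>F s in nhds 0. u + s *\<^sub>R ?d \<in> U" by (rule eventually_line_in [OF param(3) u d])
  then have eq: "\<forall>\<^sub>F s in nhds 0. f (u + s *\<^sub>R ?d) = ?\<gamma> s" by (auto elim: eventually_mono)
  have "has_velocity G (\<lambda>s. f (u + s *\<^sub>R ?d)) (\<Sum>b\<in>D. (?d \<bullet> b) *\<^sub>R partial_velocity G f (u + 0 *\<^sub>R ?d) b) 0"
    by (rule param_curve_velocity [OF _ ev d]) (auto intro!: derivative_eq_intros)
  then have "has_velocity G (\<lambda>s. f (u + s *\<^sub>R ?d)) (\<Sum>b\<in>D. c b *\<^sub>R partial_velocity G f u b) 0"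
    by (simp add: coords cong: sum.cong)
  then have "has_velocity G ?\<gamma> (\<Sum>b\<in>D. c b *\<^sub>R partial_velocity G f u b) 0"
    by (rule has_velocity_cong [OF _ eq])
  moreover have "range ?\<gamma> \<subseteq> N" using param(6) u by auto
  moreover have "\<forall>\<^sub>F s in nhds 0. ?\<gamma> s = f (u + s *\<^sub>R ?d)" using eq by (auto elim: eventually_mono)
  moreover have "?\<gamma> 0 = f u" using u by simp
  ultimately show ?thesis using that by blast
qed

lemma tangent_space_param:
  assumes u: "u \<in> U"
  shows "tangent_space G N (f u) = range (\<lambda>c. \<Sum>b\<in>D. c b *\<^sub>R partial_velocity G f u b)"
proof (intro subset_antisym subsetI)
  fix v assume "v \<in> tangent_space G N (f u)"
  then obtain \<gamma> where "range \<gamma> \<subseteq> N" "\<gamma> 0 = f u" "has_velocity G \<gamma> v 0"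
    by (auto simp: tangent_space_def)
  from velocity_lift [OF this u] obtain d where "v = (\<Sum>b\<in>D. (d \<bullet> b) *\<^sub>R partial_velocity G f u b)" .
  then show "v \<in> range (\<lambda>c. \<Sum>b\<in>D. c b *\<^sub>R partial_velocity G f u b)"
    by (intro image_eqI [where x = "\<lambda>b. d \<bullet> b"]) simp_all
next
  fix v assume "v \<in> range (\<lambda>c. \<Sum>b\<in>D. c b *\<^sub>R partial_velocity G f u b)"
  then obtain c where v: "v = (\<Sum>b\<in>D. c b *\<^sub>R partial_velocity G f u b)" by auto
  obtain \<gamma> where "range \<gamma> \<subseteq> N" "\<gamma> 0 = f u" "has_velocity G \<gamma> v 0"
    using tangent_curve [OF u, of c] unfolding v .
  then show "v \<in> tangent_space G N (f u)"
    unfolding tangent_space_def by blast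
qed

lemma subspace_tangent_space:
  assumes u: "u \<in> U"
  shows "subspace (tangent_space G N (f u))"
  unfolding tangent_space_param [OF u]
proof (rule subspaceI)
  let ?L = "\<lambda>c. \<Sum>b\<in>D. c b *\<^sub>R partial_velocity G f u b"
  show "0 \<in> range ?L" by (intro image_eqI [where x = "\<lambda>_. 0"]) simp_all
  show "v + w \<in> range ?L" if vw: "v \<in> range ?L" "w \<in> range ?L" for v w
  proof -
    obtain c d where "v = ?L c" "w = ?L d" using vw by auto
    then show ?thesis
      by (intro image_eqI [where x = "\<lambda>b. c b + d b"]) (simp_all add: scaleR_add_left sum.distrib)
  qed
  show "r *\<^sub>R v \<in> range ?L" if v: "v \<in> range ?L" for r v
  proof -
    obtain c where "v = ?L c" using v by auto
    then show ?thesis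
      by (intro image_eqI [where x = "\<lambda>b. r * c b"]) (simp_all add: scaleR_sum_right)
  qed
qed

end

text \<open>The transition map is the lift of \<open>f'\<close> through \<open>f\<close>, hence
  differentiable. A coordinate line of \<open>f'\<close> has only one velocity; computing it also
  through \<open>f\<close> gives the transformation rule of the partial velocities.\<close>

lemma param_transition:
  assumes P: "local_param G 1 N D U f" and P': "local_param G 1 N D' U' f'"
    and u: "u \<in> U'" "f' u \<in> f ` U"
  obtains \<tau>' where "((\<lambda>u. inv_into U f (f' u)) has_derivative \<tau>') (at u within U' \<inter> f' -` (f ` U))"
    "range \<tau>' \<subseteq> span D"
    "\<And>b. b \<in> D' \<Longrightarrow> partial_velocity G f' u b = (\<Sum>a\<in>D. (\<tau>' b \<bullet> a) *\<^sub>R partial_velocity G f (inv_into U f (f' u)) a)"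
proof -
  note param = local_paramD [OF P] and param' = local_paramD [OF P']
  obtain V y where V: "(V, y) \<in> atlas G" "f' u \<in> V" by (rule chart_around)
  let ?W = "U' \<inter> f' -` (f ` U)"
  let ?A = "?W \<inter> f' -` V"
  let ?\<tau> = "\<lambda>u. inv_into U f (f' u)"
  obtain T where T: "open T" "f ` U = N \<inter> T" using param(5) by (auto simp: openin_open)
  have W_eq: "?W = U' \<inter> f' -` T" using T param'(6) by auto
  have W: "openin (top_of_set U') ?W"
    unfolding W_eq using param'(9) T(1) by (rule continuous_openin_preimage_gen)
  have A: "openin (top_of_set ?W) ?A"
    using continuous_openin_preimage_gen [OF continuous_on_subset [OF param'(9)] open_chart [OF V(1)], of ?W] by blast
  have uA: "u \<in> ?A" using u V by auto
  have "((\<lambda>u. y (f' u)) has_derivative frechet_derivative (y \<circ> f') (at u within U' \<inter> f' -` V)) (at u within ?A)"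
    by (rule has_derivative_subset [OF param_derivative [OF P' V(1) u(1) V(2)]]) auto
  moreover have "continuous (at u within ?A) f'"
    using continuous_on_subset [OF param'(9), of ?A] uA by (auto simp: continuous_on_eq_continuous_within)
  moreover have "f' ` ?A \<subseteq> f ` U \<inter> V" by auto
  ultimately obtain \<tau>' where \<tau>': "(?\<tau> has_derivative \<tau>') (at u within ?A)" "range \<tau>' \<subseteq> span D"
    using has_derivative_param_lift [OF P V(1) uA] by metis
  then have der: "(?\<tau> has_derivative \<tau>') (at u within ?W)"
    using at_within_openin [OF A uA] by simp
  have WD: "openin (top_of_set (span D')) ?W" by (rule openin_trans [OF W param'(3)])
  have "partial_velocity G f' u b = (\<Sum>a\<in>D. (\<tau>' b \<bullet> a) *\<^sub>R partial_velocity G f (?\<tau> u) a)" if b: "b \<in> D'" for b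
  proof -
    have b': "b \<in> span D'" using b by (rule span_base)
    have ev: "\<forall>\<^sub>F t in nhds 0. u + t *\<^sub>R b \<in> ?W" using uA by (intro eventually_line_in [OF WD _ b']) auto
    have "((\<lambda>t. ?\<tau> (u + t *\<^sub>R b)) has_vector_derivative \<tau>' b) (at 0)"
      using uA by (intro has_vector_derivative_line [OF der WD _ b']) auto
    then have "has_velocity G (\<lambda>t. f (?\<tau> (u + t *\<^sub>R b))) (\<Sum>a\<in>D. (\<tau>' b \<bullet> a) *\<^sub>R partial_velocity G f (?\<tau> (u + 0 *\<^sub>R b)) a) 0"
    proof (rule param_curve_velocity [OF P])
      show "\<forall>\<^sub>F t in nhds 0. ?\<tau> (u + t *\<^sub>R b) \<in> U"
        using ev by (rule eventually_mono) (auto intro: inv_into_into)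
    qed (use \<tau>'(2) in auto)
    then have "has_velocity G (\<lambda>t. f' (u + t *\<^sub>R b)) (\<Sum>a\<in>D. (\<tau>' b \<bullet> a) *\<^sub>R partial_velocity G f (?\<tau> u) a) 0"
      by (rule has_velocity_cong [THEN back_subst [of "\<lambda>v. has_velocity G _ v 0"]])
        (use ev in \<open>auto elim!: eventually_mono simp: f_inv_into_f\<close>)
    then show ?thesis
      using has_velocity_unique [OF has_velocity_partial [OF P' u(1) b']] by blast
  qed
  then show ?thesis using that [OF der \<tau>'(2)] by blast
qed

end

section \<open>The Riemannian measure\<close>

text \<open>The Lindelof property of second countable spaces. Since \<open>M\<close> is nonempty,
  the countable subfamily is nonempty and can be enumerated, with repetitions, by all natural
  numbers.\<close>

lemma countable_indexed_cover:
  fixes W :: "'i \<Rightarrow> 'a::second_countable_topology set"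
  assumes "\<And>x. Q x \<Longrightarrow> openin (top_of_set N) (W x)"
    and cover: "\<And>p. p \<in> M \<Longrightarrow> \<exists>x. Q x \<and> p \<in> W x" and "M \<noteq> {}"
  obtains x :: "nat \<Rightarrow> 'i" where "\<And>n. Q (x n)" "M \<subseteq> (\<Union>n. W (x n))"
proof -
  obtain F where F: "F \<subseteq> W ` Collect Q" "countable F" "\<Union>F = \<Union>(W ` Collect Q)"
    using Lindelof_openin [of "W ` Collect Q" N] assms(1) by auto
  have "F \<noteq> {}" using F(3) cover \<open>M \<noteq> {}\<close> by blast
  then have range: "range (from_nat_into F) = F"
    using F(2) by (rule range_from_nat_into)
  then have "\<exists>x. Q x \<and> from_nat_into F n = W x" for n
    using F(1) by (metis (mono_tags, lifting) imageE mem_Collect_eq rangeI subsetD)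
  then obtain x where x: "\<And>n. Q (x n)" "\<And>n. from_nat_into F n = W (x n)" by metis
  have "(\<Union>n. W (x n)) = \<Union>F" using x(2) range by auto
  moreover have "M \<subseteq> \<Union>F"
  proof
    fix p assume "p \<in> M"
    then obtain z where "Q z" "p \<in> W z" using cover by blast
    then show "p \<in> \<Union>F" unfolding F(3) by auto
  qed
  ultimately have "M \<subseteq> (\<Union>n. W (x n))" by simp
  with x(1) show ?thesis by (rule that)
qed

lemma borel_openin: "openin (top_of_set N) A \<Longrightarrow> A \<in> sets (restrict_space borel N)"
  unfolding openin_open sets_restrict_space by (auto intro: borel_open)

lemma borel_param_domain: "openin (top_of_set (span D)) U \<Longrightarrow> U \<in> sets borel"
  for U :: "'e::euclidean_space set"
  using borel_closed [OF closed_span, of D] by (auto simp: openin_open)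

lemma borel_param_preimage:
  assumes U: "U \<in> sets borel" and f: "continuous_on U f" "f ` U \<subseteq> N"
    and A: "A \<in> sets (restrict_space borel N)"
  shows "U \<inter> f -` A \<in> sets borel"
proof -
  obtain B where B: "B \<in> sets borel" "A = N \<inter> B"
    using A by (auto simp: sets_restrict_space)
  have "f -` B \<inter> space (restrict_space borel U) \<in> sets (restrict_space borel U)"
    by (rule measurable_sets [OF borel_measurable_continuous_on_restrict [OF f(1)] B(1)])
  then have "f -` B \<inter> U \<in> sets borel"
    using U by (simp add: space_restrict_space sets_restrict_space_iff)
  moreover have "U \<inter> f -` A = f -` B \<inter> U" using B f(2) by auto
  ultimately show ?thesis by simp
qed

text \<open>An image under \<open>f\<close> is a preimage under its continuous inverse, hence Borel
  relative to the image of \<open>U\<close>, which is relatively open in \<open>N\<close>.\<close>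

lemma borel_param_image:
  assumes hom: "homeomorphism U (f ` U) f h" and open_img: "openin (top_of_set N) (f ` U)"
    and B: "B \<in> sets borel" "B \<subseteq> U"
  shows "f ` B \<in> sets (restrict_space borel N)"
proof -
  have "f ` B = f ` U \<inter> h -` B"
    using hom B(2) by (auto simp: homeomorphism_def subset_iff)
  moreover have "h -` B \<inter> space (restrict_space borel (f ` U)) \<in> sets (restrict_space borel (f ` U))"
    using hom B by (intro measurable_sets [OF borel_measurable_continuous_on_restrict]) (auto simp: homeomorphism_def)
  ultimately have "f ` B \<in> sets (restrict_space borel (f ` U))"
    by (simp add: space_restrict_space Int_commute)
  then obtain C where "C \<in> sets borel" "f ` B = f ` U \<inter> C" by (auto simp: sets_restrict_space)
  moreover obtain T where "open T" "f ` U = N \<inter> T" using open_img by (auto simp: openin_open)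
  ultimately show ?thesis
    by (auto simp: sets_restrict_space intro!: image_eqI [of _ _ "T \<inter> C"])
qed

lemma borel_measurable_det_on:
  "(\<And>i j. i \<in> D \<Longrightarrow> j \<in> D \<Longrightarrow> (\<lambda>x. m x i j) \<in> borel_measurable M) \<Longrightarrow>
    (\<lambda>x. det_on D (m x)) \<in> borel_measurable M"
  unfolding det_on_def
  by (intro borel_measurable_sum borel_measurable_times borel_measurable_const borel_measurable_prod)
    (auto simp: permutes_in_image)

lemma continuous_on_det_on:
  "(\<And>i j. i \<in> D \<Longrightarrow> j \<in> D \<Longrightarrow> continuous_on A (\<lambda>x. m x i j)) \<Longrightarrow> continuous_on A (\<lambda>x. det_on D (m x))"
  unfolding det_on_def
  by (intro continuous_on_sum continuous_on_mult continuous_on_const continuous_on_prod)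
    (auto simp: permutes_in_image)

lemma has_vector_derivative_difference_quotient:
  fixes u b :: "'a::real_vector"
  assumes "((\<lambda>s. \<tau> (u + s *\<^sub>R b)) has_vector_derivative d) (at 0)"
  shows "((\<lambda>s. (\<tau> (u + s *\<^sub>R b) - \<tau> u) /\<^sub>R s) \<longlongrightarrow> d) (at 0)"
proof -
  have "((\<lambda>s. norm (\<tau> (u + s *\<^sub>R b) - \<tau> u - s *\<^sub>R d) / norm s) \<longlongrightarrow> 0) (at 0)"
    using assms unfolding has_vector_derivative_def has_derivative_at by simp
  then have "((\<lambda>s. norm ((\<tau> (u + s *\<^sub>R b) - \<tau> u) /\<^sub>R s - d)) \<longlongrightarrow> 0) (at 0)"
  proof (rule Lim_transform_eventually)
    have "norm (x - s *\<^sub>R d) / norm s = norm (x /\<^sub>R s - d)" if "s \<noteq> 0" for x and s :: real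
    proof -
      have "norm (x /\<^sub>R s - d) = norm ((x - s *\<^sub>R d) /\<^sub>R s)"
        using that by (simp add: scaleR_diff_right)
      then show ?thesis by (simp add: divide_inverse mult.commute)
    qed
    then show "\<forall>\<^sub>F s in at 0. norm (\<tau> (u + s *\<^sub>R b) - \<tau> u - s *\<^sub>R d) / norm s =
        norm ((\<tau> (u + s *\<^sub>R b) - \<tau> u) /\<^sub>R s - d)"
      by (simp add: eventually_at_filter)
  qed
  then show ?thesis
    by (subst Lim_null) (rule tendsto_norm_zero_cancel)
qed

text \<open>Partial derivatives are limits of difference quotients, hence Borel without any continuity.\<close>

lemma borel_measurable_within_derivative:
  fixes \<tau> :: "'e::euclidean_space \<Rightarrow> 'b::euclidean_space"
  assumes W: "openin (top_of_set (span D)) W" and cont: "continuous_on W \<tau>" and b: "b \<in> span D"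
    and der: "\<And>u. u \<in> W \<Longrightarrow> (\<tau> has_derivative \<tau>' u) (at u within W)"
  shows "(\<lambda>u. indicator W u *\<^sub>R \<tau>' u b) \<in> borel_measurable borel"
proof (rule borel_measurable_LIMSEQ_metric)
  \<comment> \<open>For \<open>u\<close> in \<open>W\<close> the translated points eventually lie in
    \<open>W\<close>, so extending \<tau> by 0 does not affect the limit of the difference
    quotients.\<close>
  define t where "t = (\<lambda>u. indicator W u *\<^sub>R \<tau> u)"
  note [measurable] = borel_param_domain [OF W]
  have [measurable]: "t \<in> borel_measurable borel"
    unfolding t_def using cont borel_param_domain [OF W] by (intro borel_measurable_continuous_on_indicator)
  show "(\<lambda>u. indicator W u *\<^sub>R (real (Suc n) *\<^sub>R (t (u + (1 / real (Suc n)) *\<^sub>R b) - t u))) \<in> borel_measurable borel" for n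
    by measurable
  fix u :: 'e
  show "(\<lambda>n. indicator W u *\<^sub>R (real (Suc n) *\<^sub>R (t (u + (1 / real (Suc n)) *\<^sub>R b) - t u))) \<longlonglongrightarrow>
      indicator W u *\<^sub>R \<tau>' u b"
  proof (cases "u \<in> W")
    case True
    have "((\<lambda>s. \<tau> (u + s *\<^sub>R b)) has_vector_derivative \<tau>' u b) (at 0)"
      by (rule has_vector_derivative_line [OF der [OF True] W True b])
    then have "((\<lambda>s. (\<tau> (u + s *\<^sub>R b) - \<tau> u) /\<^sub>R s) \<longlongrightarrow> \<tau>' u b) (at 0)"
      by (rule has_vector_derivative_difference_quotient)
    moreover have lim: "filterlim (\<lambda>n. 1 / real (Suc n)) (at 0) sequentially"
      unfolding filterlim_at using LIMSEQ_inverse_real_of_nat by (simp add: inverse_eq_divide)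
    ultimately have "(\<lambda>n. (\<tau> (u + (1 / real (Suc n)) *\<^sub>R b) - \<tau> u) /\<^sub>R (1 / real (Suc n))) \<longlonglongrightarrow> \<tau>' u b"
      by (rule filterlim_compose)
    then have "(\<lambda>n. real (Suc n) *\<^sub>R (t (u + (1 / real (Suc n)) *\<^sub>R b) - t u)) \<longlonglongrightarrow> \<tau>' u b"
    proof (rule Lim_transform_eventually)
      have "filterlim (\<lambda>n. 1 / real (Suc n)) (nhds 0) sequentially"
        using lim by (rule filterlim_mono [OF _ at_within_le_nhds order_refl])
      then have "\<forall>\<^sub>F n in sequentially. u + (1 / real (Suc n)) *\<^sub>R b \<in> W"
        using eventually_line_in [OF W True b] by (rule eventually_compose_filterlim [rotated])
      then show "\<forall>\<^sub>F n in sequentially. (\<tau> (u + (1 / real (Suc n)) *\<^sub>R b) - \<tau> u) /\<^sub>R (1 / real (Suc n)) =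
          real (Suc n) *\<^sub>R (t (u + (1 / real (Suc n)) *\<^sub>R b) - t u)"
        by (rule eventually_mono) (use True in \<open>simp add: t_def\<close>)
    qed
    then show ?thesis using True by simp
  qed simp
qed

section \<open>Riemannian densities and their transformation\<close>

context carnot_group
begin

lemma continuous_on_gram_det:
  assumes P: "local_param G 1 N D U f"
  shows "continuous_on U (gram_det G D f)"
  unfolding gram_det_def [abs_def]
  by (intro continuous_on_det_on continuous_on_inner continuous_on_partial_velocity [OF P])

text \<open>The indicator makes the density Borel on the whole space and lets integrals over
  preimages ignore the values of \<open>f\<close> outside \<open>U\<close>.\<close>

definition param_density :: "'e set \<Rightarrow> 'e set \<Rightarrow> ('e \<Rightarrow> 'g) \<Rightarrow> 'e \<Rightarrow> ennreal" where
  "param_density D U f u = ennreal (sqrt (gram_det G D f u)) * indicator U u"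

lemma borel_measurable_param_density [measurable]:
  assumes P: "local_param G 1 N D U f"
  shows "param_density D U f \<in> borel_measurable borel"
proof -
  have "(\<lambda>u. indicator U u *\<^sub>R sqrt (gram_det G D f u)) \<in> borel_measurable borel"
    using borel_param_domain [OF local_paramD(3) [OF P]] continuous_on_gram_det [OF P]
    by (intro borel_measurable_continuous_on_indicator continuous_intros)
  then have "(\<lambda>u. ennreal (indicator U u *\<^sub>R sqrt (gram_det G D f u))) \<in> borel_measurable borel"
    by measurable
  moreover have "(\<lambda>u. ennreal (indicator U u *\<^sub>R sqrt (gram_det G D f u))) = param_density D U f"
    by (auto simp: param_density_def fun_eq_iff indicator_def)
  ultimately show ?thesis by simp
qed

text \<open>The Jacobian of the transition map is the matrix that expresses one frame by the other.
  Its determinant enters squared, and the square root of this factor is the one in the substitution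
  rule.\<close>

lemma gram_det_transition:
  assumes "D \<subseteq> Basis" "D' \<subseteq> Basis" "bij_betw \<beta> D' D"
    and "\<And>b. b \<in> D' \<Longrightarrow> partial_velocity G f' u b = (\<Sum>a\<in>D. (\<tau>' b \<bullet> a) *\<^sub>R partial_velocity G f w a)"
  shows "gram_det G D' f' u = (det_on D' (\<lambda>i j. \<tau>' j \<bullet> \<beta> i))\<^sup>2 * gram_det G D f w"
proof -
  have "gram_det G D' f' u = det_on D' (\<lambda>i j. \<Sum>k\<in>D. \<Sum>l\<in>D.
      (\<tau>' i \<bullet> k) * (\<tau>' j \<bullet> l) * (partial_velocity G f w k \<bullet> partial_velocity G f w l))"
    unfolding gram_det_def
  proof (rule det_on_cong)
    fix i j assume "i \<in> D'" "j \<in> D'"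
    then show "partial_velocity G f' u i \<bullet> partial_velocity G f' u j = (\<Sum>k\<in>D. \<Sum>l\<in>D.
        (\<tau>' i \<bullet> k) * (\<tau>' j \<bullet> l) * (partial_velocity G f w k \<bullet> partial_velocity G f w l))"
      unfolding assms(4) [OF \<open>i \<in> D'\<close>] assms(4) [OF \<open>j \<in> D'\<close>] inner_sum_left
      unfolding inner_sum_right by (simp add: sum_distrib_left mult_ac)
  qed
  also have "\<dots> = (det_on D' (\<lambda>i j. \<tau>' j \<bullet> \<beta> i))\<^sup>2 * gram_det G D f w"
    unfolding gram_det_def
    by (rule det_on_congruence [OF assms(1-3), of "\<lambda>k i. \<tau>' i \<bullet> k"])
  finally show ?thesis .
qed

text \<open>The Jacobian factor of the substitution is exactly the one by which the square roots of
  the Gram determinants differ. This compatibility allows the local densities to be glued to one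
  measure.\<close>

lemma param_density_transition:
  assumes P: "local_param G 1 N D U f" and P': "local_param G 1 N D' U' f'" and card: "card D = card D'"
    and A: "A \<in> sets (restrict_space borel N)" "A \<subseteq> f ` U" "A \<subseteq> f' ` U'"
  shows "(\<integral>\<^sup>+u. param_density D U f u * indicator (f -` A) u \<partial>lborel_on D) =
    (\<integral>\<^sup>+u. param_density D' U' f' u * indicator (f' -` A) u \<partial>lborel_on D')"
proof -
  note param = local_paramD [OF P] and param' = local_paramD [OF P']
  obtain \<beta> where \<beta>: "bij_betw \<beta> D' D"
    using finite_same_card_bij [OF param'(2) param(2)] card by auto
  define W where "W = U \<inter> f -` (f' ` U')"
  define W' where "W' = U' \<inter> f' -` (f ` U)"
  define \<tau> where "\<tau> u = inv_into U f (f' u)" for u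
  define \<sigma> where "\<sigma> u = inv_into U' f' (f u)" for u
  have "\<exists>\<tau>'. \<forall>u\<in>W'. (\<tau> has_derivative \<tau>' u) (at u within W') \<and>
      (\<forall>b\<in>D'. partial_velocity G f' u b = (\<Sum>a\<in>D. (\<tau>' u b \<bullet> a) *\<^sub>R partial_velocity G f (\<tau> u) a))"
  proof (intro bchoice ballI)
    fix u assume u: "u \<in> W'"
    then obtain \<tau>' where "(\<tau> has_derivative \<tau>') (at u within W')"
      "\<And>b. b \<in> D' \<Longrightarrow> partial_velocity G f' u b = (\<Sum>a\<in>D. (\<tau>' b \<bullet> a) *\<^sub>R partial_velocity G f (\<tau> u) a)"
      unfolding \<tau>_def [abs_def] W'_def by (auto intro: param_transition [OF P P', of u])
    then show "\<exists>\<tau>'. (\<tau> has_derivative \<tau>') (at u within W') \<and>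
        (\<forall>b\<in>D'. partial_velocity G f' u b = (\<Sum>a\<in>D. (\<tau>' b \<bullet> a) *\<^sub>R partial_velocity G f (\<tau> u) a))"
      by blast
  qed
  then obtain \<tau>' where der: "\<And>u. u \<in> W' \<Longrightarrow> (\<tau> has_derivative \<tau>' u) (at u within W')"
    and vel: "\<And>u b. u \<in> W' \<Longrightarrow> b \<in> D' \<Longrightarrow>
      partial_velocity G f' u b = (\<Sum>a\<in>D. (\<tau>' u b \<bullet> a) *\<^sub>R partial_velocity G f (\<tau> u) a)"
    by blast
  have hom: "homeomorphism W' W \<tau> \<sigma>"
  proof (rule homeomorphismI)
    have "continuous_on (f ` U) (inv_into U f)" "continuous_on (f' ` U') (inv_into U' f')"
      using param(7) param'(7) by (auto simp: homeomorphism_def)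
    then show "continuous_on W' \<tau>" "continuous_on W \<sigma>"
      unfolding \<tau>_def [abs_def] \<sigma>_def [abs_def]
      using continuous_on_compose2 [OF _ continuous_on_subset [OF param'(9)], of "f ` U" "inv_into U f" W']
        continuous_on_compose2 [OF _ continuous_on_subset [OF param(9)], of "f' ` U'" "inv_into U' f'" W]
      by (auto simp: W_def W'_def)
    show "\<tau> ` W' \<subseteq> W" "\<sigma> ` W \<subseteq> W'"
      by (auto simp: \<tau>_def \<sigma>_def W_def W'_def inv_into_into f_inv_into_f) (metis imageI)+
    show "\<sigma> (\<tau> u) = u" if "u \<in> W'" for u
      using that param'(8) by (simp add: \<tau>_def \<sigma>_def W'_def f_inv_into_f)
    show "\<tau> (\<sigma> u) = u" if "u \<in> W" for u
      using that param(8) by (simp add: \<tau>_def \<sigma>_def W_def f_inv_into_f)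
  qed
  have "W \<in> sets borel" "W' \<in> sets borel"
    unfolding W_def W'_def
    using borel_param_preimage [OF borel_param_domain [OF param(3)] param(9,6) borel_openin [OF param'(5)]]
      borel_param_preimage [OF borel_param_domain [OF param'(3)] param'(9,6) borel_openin [OF param(5)]]
    by auto
  have W'_open: "openin (top_of_set (span D')) W'"
  proof -
    obtain T where T: "open T" "f ` U = N \<inter> T" using param(5) by (auto simp: openin_open)
    have "W' = U' \<inter> f' -` T" using T param'(6) by (auto simp: W'_def)
    then have "openin (top_of_set U') W'"
      using continuous_openin_preimage_gen [OF param'(9) T(1)] by simp
    then show ?thesis using param'(3) by (rule openin_trans)
  qed
  \<comment> \<open>The derivatives \<open>\<tau>'\<close> were picked pointwise. Their values on
    \<open>D'\<close> are nevertheless Borel, being limits of difference quotients of the continuous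
    map \<tau>.\<close>
  have meas: "(\<lambda>u. det_on D' (\<lambda>i j. \<tau>' u j \<bullet> \<beta> i) * indicator W' u) \<in> borel_measurable borel"
  proof -
    have [measurable]: "W' \<in> sets borel" by fact
    have "continuous_on W' \<tau>" using hom by (simp add: homeomorphism_def)
    then have "(\<lambda>u. (indicator W' u *\<^sub>R \<tau>' u j) \<bullet> \<beta> i) \<in> borel_measurable borel" if "j \<in> D'" for i j
      using borel_measurable_within_derivative [OF W'_open _ span_base [OF that] der]
      by (intro borel_measurable_inner) auto
    then have "(\<lambda>u. det_on D' (\<lambda>i j. (indicator W' u *\<^sub>R \<tau>' u j) \<bullet> \<beta> i) * indicator W' u) \<in> borel_measurable borel"
      by (intro borel_measurable_times borel_measurable_det_on) auto
    moreover have "(\<lambda>u. det_on D' (\<lambda>i j. (indicator W' u *\<^sub>R \<tau>' u j) \<bullet> \<beta> i) * indicator W' u) =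
        (\<lambda>u. det_on D' (\<lambda>i j. \<tau>' u j \<bullet> \<beta> i) * indicator W' u)"
      by (auto simp: fun_eq_iff indicator_def)
    ultimately show ?thesis by simp
  qed
  have fA: "U \<inter> f -` A \<in> sets borel"
    by (rule borel_param_preimage [OF borel_param_domain [OF param(3)] param(9,6) A(1)])
  define g where "g u = param_density D U f u * indicator (U \<inter> f -` A) u" for u
  have g: "g \<in> borel_measurable borel"
    unfolding g_def [abs_def] using fA borel_measurable_param_density [OF P] by measurable
  have "(\<integral>\<^sup>+u. param_density D U f u * indicator (f -` A) u \<partial>lborel_on D) =
      (\<integral>\<^sup>+u. g u * indicator W u \<partial>lborel_on D)"
    using A(3) by (intro nn_integral_cong) (auto simp: g_def W_def param_density_def indicator_def)
  also have "\<dots> = (\<integral>\<^sup>+u. g (\<tau> u) * ennreal \<bar>det_on D' (\<lambda>i j. \<tau>' u j \<bullet> \<beta> i)\<bar> * indicator W' u \<partial>lborel_on D')"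
    using param(4) param'(4) \<open>W \<in> sets borel\<close> \<open>W' \<in> sets borel\<close>
    by (intro nn_integral_lborel_on_substitution [OF param(1) param'(1) \<beta> hom _ _ _ _ der meas g])
      (auto simp: W_def W'_def)
  also have "\<dots> = (\<integral>\<^sup>+u. param_density D' U' f' u * indicator (f' -` A) u \<partial>lborel_on D')"
  proof (intro nn_integral_cong)
    fix u
    show "g (\<tau> u) * ennreal \<bar>det_on D' (\<lambda>i j. \<tau>' u j \<bullet> \<beta> i)\<bar> * indicator W' u =
        param_density D' U' f' u * indicator (f' -` A) u"
    proof (cases "u \<in> W'")
      case True
      then have \<tau>u: "\<tau> u \<in> U" "f (\<tau> u) = f' u" "u \<in> U'"
        by (auto simp: W'_def \<tau>_def inv_into_into f_inv_into_f)
      have "sqrt (gram_det G D' f' u) =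
          \<bar>det_on D' (\<lambda>i j. \<tau>' u j \<bullet> \<beta> i)\<bar> * sqrt (gram_det G D f (\<tau> u))"
        using gram_det_transition [OF param(1) param'(1) \<beta> vel [OF True]] by (simp add: real_sqrt_mult)
      then show ?thesis
        using True \<tau>u by (simp add: g_def param_density_def ennreal_mult'' mult_ac indicator_def)
    next
      case False
      then show ?thesis using A(2) by (auto simp: W'_def param_density_def indicator_def)
    qed
  qed
  finally show ?thesis .
qed

end

section \<open>Gluing the local densities to a measure\<close>

context carnot_group
begin

lemma submanifold_cover:
  assumes N: "submanifold G 1 m N" "N \<noteq> {}"
  obtains D U f where "\<And>n::nat. local_param G 1 N (D n) (U n) (f n)" "\<And>n. card (D n) = m"
    "N = (\<Union>n. f n ` U n)"
proof -
  let ?Q = "\<lambda>(D, U, f). local_param G 1 N D U f \<and> card D = m"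
  let ?W = "\<lambda>(D, U, f). f ` U"
  obtain x where x: "\<And>n::nat. ?Q (x n)" "N \<subseteq> (\<Union>n. ?W (x n))"
  proof (rule countable_indexed_cover [of ?Q N ?W N])
    show "openin (top_of_set N) (?W x)" if "?Q x" for x
      using that local_paramD(5) by (auto split: prod.splits)
    show "\<exists>x. ?Q x \<and> p \<in> ?W x" if "p \<in> N" for p
      using N(1) that unfolding submanifold_def by fast
  qed (use N(2) in auto)
  have P: "local_param G 1 N (fst (x n)) (fst (snd (x n))) (snd (snd (x n)))" "card (fst (x n)) = m" for n
    using x(1) [of n] by (auto split: prod.splits)
  have "N = (\<Union>n. snd (snd (x n)) ` fst (snd (x n)))"
    using x(2) local_paramD(6) [OF P(1)] by (intro subset_antisym UN_least) (simp_all add: case_prod_unfold)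
  with P show ?thesis by (rule that)
qed

text \<open>The disjoint pieces of a countable parametrized cover leave no freedom to a measure with
  the prescribed local densities. This gives uniqueness in \<open>ex_riem_measure\<close>, where the
  right-hand side also serves as the definition of the measure.\<close>

lemma emeasure_disjointed_image:
  fixes D U and f :: "nat \<Rightarrow> 'e \<Rightarrow> 'g"
  assumes P: "\<And>n. local_param G 1 N (D n) (U n) (f n)" and card: "\<And>n. card (D n) = m"
    and N: "N = (\<Union>n. f n ` U n)" and \<mu>: "sets \<mu> = sets (restrict_space borel N)"
    and form: "\<And>D U f B. local_param G 1 N D U f \<Longrightarrow> card D = m \<Longrightarrow> B \<in> sets borel \<Longrightarrow> B \<subseteq> U \<Longrightarrow>
      emeasure \<mu> (f ` B) = (\<integral>\<^sup>+u\<in>B. ennreal (sqrt (gram_det G D f u)) \<partial>lborel_on D)"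
    and A: "A \<in> sets (restrict_space borel N)"
  shows "emeasure \<mu> A = (\<Sum>n. \<integral>\<^sup>+u. param_density (D n) (U n) (f n) u *
    indicator (f n -` (A \<inter> disjointed (\<lambda>n. f n ` U n) n)) u \<partial>lborel_on (D n))"
proof -
  let ?d = "disjointed (\<lambda>n. f n ` U n)"
  have d: "?d n \<in> sets (restrict_space borel N)" for n
    using borel_openin [OF local_paramD(5) [OF P]] by (intro sets.range_disjointed_sets [THEN range_subsetD]) auto
  have "A \<subseteq> N" using sets.sets_into_space [OF A] by (simp add: space_restrict_space)
  then have "A = (\<Union>n. A \<inter> ?d n)" using N UN_disjointed_eq [of "\<lambda>n. f n ` U n"] by auto
  then have "emeasure \<mu> A = emeasure \<mu> (\<Union>n. A \<inter> ?d n)" by simp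
  also have "\<dots> = (\<Sum>n. emeasure \<mu> (A \<inter> ?d n))"
    using A d disjoint_family_disjointed [of "\<lambda>n. f n ` U n"]
    by (intro suminf_emeasure [symmetric]) (auto simp: \<mu> disjoint_family_on_def)
  also have "\<dots> = (\<Sum>n. \<integral>\<^sup>+u. param_density (D n) (U n) (f n) u * indicator (f n -` (A \<inter> ?d n)) u \<partial>lborel_on (D n))"
  proof (intro suminf_cong)
    fix n
    note param = local_paramD [OF P [of n]]
    let ?B = "U n \<inter> f n -` (A \<inter> ?d n)"
    have "A \<inter> ?d n \<subseteq> f n ` U n" using disjointed_subset [of "\<lambda>n. f n ` U n" n] by auto
    then have img: "f n ` ?B = A \<inter> ?d n" by auto
    have B: "?B \<in> sets borel"
      using A d by (intro borel_param_preimage [OF borel_param_domain [OF param(3)] param(9,6)]) auto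
    have "emeasure \<mu> (A \<inter> ?d n) = (\<integral>\<^sup>+u\<in>?B. ennreal (sqrt (gram_det G (D n) (f n) u)) \<partial>lborel_on (D n))"
      using form [OF P [of n] card B] unfolding img by auto
    also have "\<dots> = (\<integral>\<^sup>+u. param_density (D n) (U n) (f n) u * indicator (f n -` (A \<inter> ?d n)) u \<partial>lborel_on (D n))"
      by (intro nn_integral_cong) (auto simp: param_density_def indicator_def)
    finally show "emeasure \<mu> (A \<inter> ?d n) =
        (\<integral>\<^sup>+u. param_density (D n) (U n) (f n) u * indicator (f n -` (A \<inter> ?d n)) u \<partial>lborel_on (D n))" .
  qed
  finally show ?thesis .
qed

text \<open>For existence, the densities are summed over the disjoint pieces of a countable cover,
  and \<open>param_density_transition\<close> carries each piece over to an arbitrary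
  parametrization.\<close>

lemma ex_riem_measure:
  assumes N: "submanifold G 1 m N"
  shows "\<exists>!\<mu>. sets \<mu> = sets (restrict_space borel N) \<and>
     (\<forall>D U f. local_param G 1 N D U f \<and> card D = m \<longrightarrow>
        (\<forall>B\<in>sets borel. B \<subseteq> U \<longrightarrow>
           emeasure \<mu> (f ` B) = (\<integral>\<^sup>+u\<in>B. ennreal (sqrt (gram_det G D f u)) \<partial>lborel_on D)))"
proof (cases "N = {}")
  \<comment> \<open>\<open>submanifold_cover\<close> is available for nonempty \<open>N\<close>. On
    the empty set the sigma-algebra is trivial and carries only the null measure.\<close>
  case True
  have empty: "sets (restrict_space borel {}) = {{} :: 'g set}"
    by (auto simp: sets_restrict_space)
  show ?thesis unfolding True
  proof (intro ex1I [of _ "null_measure (restrict_space borel {})"] conjI allI impI ballI)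
    fix D U f and B :: "'e set"
    assume "local_param G 1 {} D U f \<and> card D = m" "B \<subseteq> U"
    then have "B = {}" using local_paramD(6) [of G 1 "{}" D U f] by auto
    then show "emeasure (null_measure (restrict_space borel {})) (f ` B) =
        (\<integral>\<^sup>+u\<in>B. ennreal (sqrt (gram_det G D f u)) \<partial>lborel_on D)" by simp
  next
    fix \<mu> assume "sets \<mu> = sets (restrict_space borel ({} :: 'g set)) \<and>
      (\<forall>D U f. local_param G 1 {} D U f \<and> card D = m \<longrightarrow> (\<forall>B\<in>sets borel. B \<subseteq> U \<longrightarrow>
        emeasure \<mu> (f ` B) = (\<integral>\<^sup>+u\<in>B. ennreal (sqrt (gram_det G D f u)) \<partial>lborel_on D)))"
    then show "\<mu> = null_measure (restrict_space borel {})"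
      using empty by (intro measure_eqI) auto
  qed simp
next
  case False
  obtain D U f where P: "\<And>n::nat. local_param G 1 N (D n) (U n) (f n)" and card: "\<And>n. card (D n) = m"
    and N_eq: "N = (\<Union>n. f n ` U n)"
    using submanifold_cover [OF N False] by metis
  let ?d = "disjointed (\<lambda>n. f n ` U n)"
  define \<nu> where "\<nu> n A = (\<integral>\<^sup>+u. param_density (D n) (U n) (f n) u * indicator (f n -` (A \<inter> ?d n)) u \<partial>lborel_on (D n))"
    for n A
  have d: "?d n \<in> sets (restrict_space borel N)" for n
    using borel_openin [OF local_paramD(5) [OF P]] by (intro sets.range_disjointed_sets [THEN range_subsetD]) auto
  have d_sub: "?d n \<subseteq> f n ` U n" for n by (rule disjointed_subset)
  have d_N: "(\<Union>n. ?d n) = N" using N_eq UN_disjointed_eq [of "\<lambda>n. f n ` U n"] by simp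
  have meas: "(\<lambda>u. param_density (D n) (U n) (f n) u * indicator (f n -` (A \<inter> ?d n)) u) \<in> borel_measurable borel"
    if "A \<in> sets (restrict_space borel N)" for n A
  proof -
    have [measurable]: "U n \<inter> f n -` (A \<inter> ?d n) \<in> sets borel"
      using that d local_paramD [OF P [of n]] by (intro borel_param_preimage [where N = N] borel_param_domain) auto
    have "(\<lambda>u. param_density (D n) (U n) (f n) u * indicator (U n \<inter> f n -` (A \<inter> ?d n)) u) \<in> borel_measurable borel"
      using borel_measurable_param_density [OF P [of n]] by measurable
    moreover have "(\<lambda>u. param_density (D n) (U n) (f n) u * indicator (U n \<inter> f n -` (A \<inter> ?d n)) u) =
        (\<lambda>u. param_density (D n) (U n) (f n) u * indicator (f n -` (A \<inter> ?d n)) u)"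
      by (auto simp: fun_eq_iff param_density_def indicator_def)
    ultimately show ?thesis by simp
  qed
  define \<mu> where "\<mu> = measure_of N (sets (restrict_space borel N)) (\<lambda>A. \<Sum>n. \<nu> n A)"
  have \<mu>_sets: "sets \<mu> = sets (restrict_space borel N)"
    unfolding \<mu>_def using sets.sigma_sets_eq [of "restrict_space borel N"] sets.space_closed [of "restrict_space borel N"]
    by (simp add: space_restrict_space)
  have \<mu>: "emeasure \<mu> A = (\<Sum>n. \<nu> n A)" if A: "A \<in> sets (restrict_space borel N)" for A
  proof (rule emeasure_measure_of [OF \<mu>_def])
    show "sets (restrict_space borel N) \<subseteq> Pow N"
      using sets.space_closed [of "restrict_space borel N"] by (simp add: space_restrict_space)
    show "A \<in> sets \<mu>" using A \<mu>_sets by simp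
    show "positive (sets \<mu>) (\<lambda>A. \<Sum>n. \<nu> n A)"
      by (simp add: positive_def \<nu>_def)
    show "countably_additive (sets \<mu>) (\<lambda>A. \<Sum>n. \<nu> n A)"
    proof (rule countably_additiveI)
      fix F :: "nat \<Rightarrow> 'g set" assume F: "range F \<subseteq> sets \<mu>" "disjoint_family F"
      have add: "\<nu> n (\<Union>i. F i) = (\<Sum>i. \<nu> n (F i))" for n
      proof -
        have "\<nu> n (\<Union>i. F i) = (\<integral>\<^sup>+u. (\<Sum>i. param_density (D n) (U n) (f n) u * indicator (f n -` (F i \<inter> ?d n)) u) \<partial>lborel_on (D n))"
          unfolding \<nu>_def
        proof (intro nn_integral_cong)
          fix u
          have "disjoint_family (\<lambda>i. f n -` (F i \<inter> ?d n))"
            using F(2) by (auto simp: disjoint_family_on_def)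
          then have "(\<Sum>i. indicator (f n -` (F i \<inter> ?d n)) u :: ennreal) = indicator (\<Union>i. f n -` (F i \<inter> ?d n)) u"
            by (rule suminf_indicator)
          moreover have "(\<Union>i. f n -` (F i \<inter> ?d n)) = f n -` ((\<Union>i. F i) \<inter> ?d n)" by auto
          ultimately show "param_density (D n) (U n) (f n) u * indicator (f n -` ((\<Union>i. F i) \<inter> ?d n)) u =
              (\<Sum>i. param_density (D n) (U n) (f n) u * indicator (f n -` (F i \<inter> ?d n)) u)"
            by (simp add: ennreal_suminf_cmult)
        qed
        also have "\<dots> = (\<Sum>i. \<nu> n (F i))"
          unfolding \<nu>_def using F(1) \<mu>_sets meas by (intro nn_integral_suminf) auto
        finally show ?thesis .
      qed
      \<comment> \<open>The two sums are interchanged by reading one of them as an integral against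
        counting measure.\<close>
      have "(\<Sum>i. \<Sum>n. \<nu> n (F i)) = (\<integral>\<^sup>+i. (\<Sum>n. \<nu> n (F i)) \<partial>count_space UNIV)"
        by (simp add: nn_integral_count_space_nat)
      also have "\<dots> = (\<Sum>n. \<integral>\<^sup>+i. \<nu> n (F i) \<partial>count_space UNIV)"
        by (rule nn_integral_suminf) simp
      also have "\<dots> = (\<Sum>n. \<nu> n (\<Union>i. F i))"
        by (simp add: nn_integral_count_space_nat add)
      finally show "(\<Sum>i. \<Sum>n. \<nu> n (F i)) = (\<Sum>n. \<nu> n (\<Union>i. F i))" .
    qed
  qed
  have form: "emeasure \<mu> (f' ` B) = (\<integral>\<^sup>+u\<in>B. ennreal (sqrt (gram_det G D' f' u)) \<partial>lborel_on D')"
    if P': "local_param G 1 N D' U' f'" and card': "card D' = m" and B: "B \<in> sets borel" "B \<subseteq> U'" for D' U' f' B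
  proof -
    note param' = local_paramD [OF P']
    have fB: "f' ` B \<in> sets (restrict_space borel N)"
      by (rule borel_param_image [OF param'(7,5) B])
    let ?C = "\<lambda>n. f' ` B \<inter> ?d n"
    have C: "U' \<inter> f' -` ?C n \<in> sets borel" for n
      using fB d by (intro borel_param_preimage [OF borel_param_domain [OF param'(3)] param'(9,6)]) auto
    have "emeasure \<mu> (f' ` B) = (\<Sum>n. \<nu> n (f' ` B))" by (rule \<mu> [OF fB])
    also have "\<dots> = (\<Sum>n. \<integral>\<^sup>+u. param_density D' U' f' u * indicator (f' -` ?C n) u \<partial>lborel_on D')"
    proof (intro suminf_cong)
      fix n
      have "\<nu> n (f' ` B) = (\<integral>\<^sup>+u. param_density (D n) (U n) (f n) u * indicator (f n -` ?C n) u \<partial>lborel_on (D n))"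
        by (simp add: \<nu>_def)
      also have "\<dots> = (\<integral>\<^sup>+u. param_density D' U' f' u * indicator (f' -` ?C n) u \<partial>lborel_on D')"
        using fB d d_sub B(2) card card' by (intro param_density_transition [OF P P']) auto
      finally show "\<nu> n (f' ` B) = (\<integral>\<^sup>+u. param_density D' U' f' u * indicator (f' -` ?C n) u \<partial>lborel_on D')" .
    qed
    also have "\<dots> = (\<Sum>n. \<integral>\<^sup>+u. param_density D' U' f' u * indicator (U' \<inter> f' -` ?C n) u \<partial>lborel_on D')"
      by (intro suminf_cong nn_integral_cong) (auto simp: param_density_def indicator_def)
    also have "\<dots> = (\<integral>\<^sup>+u. (\<Sum>n. param_density D' U' f' u * indicator (U' \<inter> f' -` ?C n) u) \<partial>lborel_on D')"
      using C borel_measurable_param_density [OF P'] by (intro nn_integral_suminf [symmetric]) auto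
    also have "\<dots> = (\<integral>\<^sup>+u\<in>B. ennreal (sqrt (gram_det G D' f' u)) \<partial>lborel_on D')"
    proof (intro nn_integral_cong)
      fix u
      have "disjoint_family (\<lambda>n. U' \<inter> f' -` ?C n)"
        using disjoint_family_disjointed [of "\<lambda>n. f n ` U n"] unfolding disjoint_family_on_def by blast
      then have "(\<Sum>n. indicator (U' \<inter> f' -` ?C n) u :: ennreal) = indicator (\<Union>n. U' \<inter> f' -` ?C n) u"
        by (rule suminf_indicator)
      moreover have "(\<Union>n. U' \<inter> f' -` ?C n) = B"
      proof -
        have "(\<Union>n. U' \<inter> f' -` ?C n) = U' \<inter> f' -` (f' ` B \<inter> (\<Union>n. ?d n))" by blast
        also have "\<dots> = B"
          unfolding d_N using B(2) param'(6,8) by (auto simp: inj_on_def subset_iff)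
        finally show ?thesis .
      qed
      ultimately show "(\<Sum>n. param_density D' U' f' u * indicator (U' \<inter> f' -` ?C n) u) =
          ennreal (sqrt (gram_det G D' f' u)) * indicator B u"
        using B(2) by (auto simp: ennreal_suminf_cmult param_density_def indicator_def)
    qed
    finally show ?thesis .
  qed
  show ?thesis
  proof (intro ex1I [of _ \<mu>] conjI allI impI ballI)
    show "sets \<mu> = sets (restrict_space borel N)" by fact
    show "emeasure \<mu> (f ` B) = (\<integral>\<^sup>+u\<in>B. ennreal (sqrt (gram_det G D f u)) \<partial>lborel_on D)"
      if "local_param G 1 N D U f \<and> card D = m" "B \<in> sets borel" "B \<subseteq> U" for D U f B
      using form that by blast
    fix \<mu>' assume \<mu>': "sets \<mu>' = sets (restrict_space borel N) \<and>
      (\<forall>D U f. local_param G 1 N D U f \<and> card D = m \<longrightarrow> (\<forall>B\<in>sets borel. B \<subseteq> U \<longrightarrow>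
        emeasure \<mu>' (f ` B) = (\<integral>\<^sup>+u\<in>B. ennreal (sqrt (gram_det G D f u)) \<partial>lborel_on D)))"
    show "\<mu>' = \<mu>"
    proof (rule measure_eqI)
      show "sets \<mu>' = sets \<mu>" using \<mu>' \<mu>_sets by simp
      fix A assume "A \<in> sets \<mu>'"
      then have A: "A \<in> sets (restrict_space borel N)" using \<mu>' by simp
      have "emeasure \<mu>' A = (\<Sum>n. \<nu> n A)"
        unfolding \<nu>_def using \<mu>' by (intro emeasure_disjointed_image [OF P card N_eq _ _ A]) auto
      then show "emeasure \<mu>' A = emeasure \<mu> A" using \<mu> [OF A] by simp
    qed
  qed
qed

lemma
  assumes N: "submanifold G 1 m N"
  shows sets_riem_measure: "sets (riem_measure G m N) = sets (restrict_space borel N)"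
    and space_riem_measure: "space (riem_measure G m N) = N"
    and emeasure_riem_measure: "\<And>D U f B. local_param G 1 N D U f \<Longrightarrow> card D = m \<Longrightarrow> B \<in> sets borel \<Longrightarrow> B \<subseteq> U \<Longrightarrow>
      emeasure (riem_measure G m N) (f ` B) = (\<integral>\<^sup>+u\<in>B. ennreal (sqrt (gram_det G D f u)) \<partial>lborel_on D)"
proof -
  note * = theI' [OF ex_riem_measure [OF N], folded riem_measure_def]
  show 1: "sets (riem_measure G m N) = sets (restrict_space borel N)" using * by blast
  show "space (riem_measure G m N) = N"
    using sets_eq_imp_space_eq [OF 1] by (simp add: space_restrict_space)
  show "emeasure (riem_measure G m N) (f ` B) = (\<integral>\<^sup>+u\<in>B. ennreal (sqrt (gram_det G D f u)) \<partial>lborel_on D)"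
    if "local_param G 1 N D U f" "card D = m" "B \<in> sets borel" "B \<subseteq> U" for D U f B
    using * that by blast
qed

text \<open>On the image of \<open>U\<close> the Riemannian measure is the push-forward of the
  density, because both measures give the same value to every Borel set.\<close>

lemma nn_integral_riem_measure:
  assumes N: "submanifold G 1 m N" and P: "local_param G 1 N D U f" and card: "card D = m"
    and g: "g \<in> borel_measurable (restrict_space borel N)"
  shows "(\<integral>\<^sup>+p. g p * indicator (f ` U) p \<partial>riem_measure G m N) =
    (\<integral>\<^sup>+u. g (f u) * param_density D U f u \<partial>lborel_on D)"
proof (cases "U = {}")
  case True
  then show ?thesis by (simp add: param_density_def)
next
  case False
  then obtain u0 where u0: "u0 \<in> U" by auto
  note param = local_paramD [OF P]
  let ?\<mu> = "riem_measure G m N" and ?R = "restrict_space borel N"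
  note sets_\<mu> = sets_riem_measure [OF N]
  have g\<mu>: "g \<in> borel_measurable ?\<mu>" using g measurable_cong_sets [OF sets_\<mu> refl] by blast
  \<comment> \<open>A default value in \<open>N\<close> is needed so that \<open>t\<close> maps the
    whole parameter space into \<open>N\<close>; the density vanishes where it is used.\<close>
  define t where "t u = (if u \<in> U then f u else f u0)" for u
  have U: "U \<in> sets borel" by (rule borel_param_domain [OF param(3)])
  have t: "t \<in> borel \<rightarrow>\<^sub>M ?R"
  proof (rule measurableI)
    show "t u \<in> space ?R" for u using param(6) u0 by (auto simp: t_def space_restrict_space)
    fix A assume A: "A \<in> sets ?R"
    have UA: "U \<inter> f -` A \<in> sets borel"
      by (rule borel_param_preimage [OF U param(9,6) A])
    have "t -` A \<inter> space borel = (U \<inter> f -` A) \<union> (if f u0 \<in> A then - U else {})"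
      by (auto simp: t_def split: if_splits)
    also have "\<dots> \<in> sets borel" using UA U by auto
    finally show "t -` A \<inter> space borel \<in> sets borel" .
  qed
  have fU: "f ` U \<in> sets ?R" by (rule borel_openin [OF param(5)])
  have ind: "(indicator (f ` U) :: 'g \<Rightarrow> ennreal) \<in> borel_measurable ?\<mu>"
    using fU by (intro borel_measurable_indicator) (simp add: sets_\<mu>)
  note [measurable] = borel_measurable_param_density [OF P]
  have "density ?\<mu> (indicator (f ` U)) = distr (density (lborel_on D) (param_density D U f)) ?R t"
  proof (rule measure_eqI)
    show "sets (density ?\<mu> (indicator (f ` U))) = sets (distr (density (lborel_on D) (param_density D U f)) ?R t)"
      by (simp add: sets_\<mu>)
    fix A assume "A \<in> sets (density ?\<mu> (indicator (f ` U)))"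
    then have A: "A \<in> sets ?R" by (simp add: sets_\<mu>)
    let ?B = "U \<inter> f -` A"
    have B: "?B \<in> sets borel" by (rule borel_param_preimage [OF U param(9,6) A])
    have tA: "t -` A \<in> sets borel" using measurable_sets [OF t A] by simp
    have "emeasure (density ?\<mu> (indicator (f ` U))) A = emeasure ?\<mu> (f ` U \<inter> A)"
      using A fU ind by (subst emeasure_density) (auto simp: sets_\<mu> indicator_inter_arith [symmetric])
    also have "f ` U \<inter> A = f ` ?B" by auto
    also have "emeasure ?\<mu> (f ` ?B) = (\<integral>\<^sup>+u\<in>?B. ennreal (sqrt (gram_det G D f u)) \<partial>lborel_on D)"
      using B by (intro emeasure_riem_measure [OF N P card]) auto
    also have "\<dots> = (\<integral>\<^sup>+u. param_density D U f u * indicator (t -` A) u \<partial>lborel_on D)"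
      by (intro nn_integral_cong) (auto simp: param_density_def indicator_def t_def)
    also have "\<dots> = emeasure (distr (density (lborel_on D) (param_density D U f)) ?R t) A"
      using A t tA by (subst emeasure_distr) (auto simp: emeasure_density)
    finally show "emeasure (density ?\<mu> (indicator (f ` U))) A =
        emeasure (distr (density (lborel_on D) (param_density D U f)) ?R t) A" .
  qed
  then have "(\<integral>\<^sup>+p. g p \<partial>density ?\<mu> (indicator (f ` U))) =
      (\<integral>\<^sup>+p. g p \<partial>distr (density (lborel_on D) (param_density D U f)) ?R t)" by simp
  moreover have "(\<integral>\<^sup>+p. g p \<partial>density ?\<mu> (indicator (f ` U))) = (\<integral>\<^sup>+p. g p * indicator (f ` U) p \<partial>?\<mu>)"
    using g\<mu> ind by (subst nn_integral_density) (auto simp: mult.commute)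
  moreover have "(\<integral>\<^sup>+p. g p \<partial>distr (density (lborel_on D) (param_density D U f)) ?R t) =
      (\<integral>\<^sup>+u. g (t u) * param_density D U f u \<partial>lborel_on D)"
    using g t measurable_compose [OF t g] by (simp add: nn_integral_distr nn_integral_density mult.commute)
  moreover have "(\<integral>\<^sup>+u. g (t u) * param_density D U f u \<partial>lborel_on D) =
      (\<integral>\<^sup>+u. g (f u) * param_density D U f u \<partial>lborel_on D)"
    by (intro nn_integral_cong) (auto simp: t_def param_density_def indicator_def)
  ultimately show ?thesis by simp
qed

end

section \<open>Gradients and normals\<close>

lemma subspace_orthogonal_unique:
  assumes E: "subspace E" and "w \<in> E" "w' \<in> E" "\<And>e. e \<in> E \<Longrightarrow> w \<bullet> e = w' \<bullet> e"
  shows "w = w'"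
proof -
  have "w - w' \<in> E" using assms by (intro subspace_diff)
  then have "(w - w') \<bullet> (w - w') = 0" using assms(4) [of "w - w'"] by (simp add: inner_diff_left)
  then show ?thesis by simp
qed

lemma orth_proj_eqI:
  assumes E: "subspace E" and w: "w \<in> E" "\<And>e. e \<in> E \<Longrightarrow> (v - w) \<bullet> e = 0"
  shows "orth_proj E v = w"
  unfolding orth_proj_def
proof (rule the_equality)
  show "w' = w" if "w' \<in> E \<and> (\<forall>e\<in>E. (v - w') \<bullet> e = 0)" for w'
    using that w by (intro subspace_orthogonal_unique [OF E]) (auto simp: inner_diff_left)
qed (use w in auto)

lemma orth_proj:
  fixes E :: "'e::euclidean_space set"
  assumes E: "subspace E"
  shows orth_proj_in: "orth_proj E v \<in> E"
    and orth_proj_inner: "e \<in> E \<Longrightarrow> orth_proj E v \<bullet> e = v \<bullet> e"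
proof -
  obtain y z where yz: "y \<in> span E" "\<And>w. w \<in> span E \<Longrightarrow> orthogonal z w" "v = y + z"
    using orthogonal_subspace_decomp_exists [of E v] by blast
  then have y: "y \<in> E" "\<And>e. e \<in> E \<Longrightarrow> (v - y) \<bullet> e = 0"
    using span_eq_iff [THEN iffD2, OF E] by (auto simp: orthogonal_def)
  then have "orth_proj E v = y" by (rule orth_proj_eqI [OF E])
  with y show "orth_proj E v \<in> E" "e \<in> E \<Longrightarrow> orth_proj E v \<bullet> e = v \<bullet> e"
    by (auto simp: inner_diff_left)
qed

lemma linear_orth_proj:
  fixes E :: "'e::euclidean_space set"
  assumes E: "subspace E"
  shows "linear (orth_proj E)"
proof (rule linearI)
  note * = orth_proj_in [OF E] orth_proj_inner [OF E]
  show "orth_proj E (v + w) = orth_proj E v + orth_proj E w" for v w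
    by (rule orth_proj_eqI [OF E]) (use * E in \<open>auto intro: subspace_add simp: inner_diff_left inner_add_left\<close>)
  show "orth_proj E (c *\<^sub>R v) = c *\<^sub>R orth_proj E v" for c v
    by (rule orth_proj_eqI [OF E]) (use * E in \<open>auto intro: subspace_scale simp: inner_diff_left\<close>)
qed

text \<open>Near each point the frame is uniformly independent, which bounds the coefficients of \<open>w\<close>.\<close>

lemma continuous_on_dual_frame:
  fixes X :: "'z::t2_space \<Rightarrow> 'e::euclidean_space \<Rightarrow> 'e"
  assumes D: "D \<subseteq> Basis" and X: "\<And>b. b \<in> D \<Longrightarrow> continuous_on U (\<lambda>u. X u b)"
    and ind: "\<And>u c b. u \<in> U \<Longrightarrow> (\<Sum>b\<in>D. c b *\<^sub>R X u b) = 0 \<Longrightarrow> b \<in> D \<Longrightarrow> c b = 0"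
    and w: "\<And>u. u \<in> U \<Longrightarrow> w u \<in> range (\<lambda>c. \<Sum>b\<in>D. c b *\<^sub>R X u b)"
    and wX: "\<And>b. b \<in> D \<Longrightarrow> continuous_on U (\<lambda>u. w u \<bullet> X u b)"
  shows "continuous_on U w"
  unfolding continuous_on_def
proof
  fix u0 assume u0: "u0 \<in> U"
  have fin: "finite D" using D finite_Basis finite_subset by blast
  define L where "L u x = (\<Sum>b\<in>D. (x \<bullet> b) *\<^sub>R X u b)" for u x
  have "linear (L u0)"
    unfolding L_def [abs_def]
    by (rule linearI) (simp_all add: inner_add_left scaleR_add_left sum.distrib scaleR_sum_right)
  then have "bounded_linear (L u0)" by (rule linear_conv_bounded_linear [THEN iffD1])
  moreover have "\<forall>x\<in>span D. L u0 x = 0 \<longrightarrow> x = 0"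
  proof (intro ballI impI)
    fix x assume x: "x \<in> span D" "L u0 x = 0"
    then have "x \<bullet> b = 0" if "b \<in> D" for b using ind [OF u0, of "\<lambda>b. x \<bullet> b"] that by (simp add: L_def)
    then show "x = 0" using span_coords_expansion [OF D x(1)] by simp
  qed
  ultimately obtain B where B: "B > 0" "\<And>x. x \<in> span D \<Longrightarrow> norm (L u0 x) \<ge> B * norm x"
    using injective_imp_isometric [OF closed_span subspace_span, of "L u0" D] by blast
  have lim: "((\<lambda>u. X u b) \<longlongrightarrow> X u0 b) (at u0 within U)" if "b \<in> D" for b
    using X [OF that] u0 by (simp add: continuous_on_def)
  have "((\<lambda>u. \<Sum>b\<in>D. norm (X u b - X u0 b)) \<longlongrightarrow> (\<Sum>b\<in>D. norm (X u0 b - X u0 b))) (at u0 within U)"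
    by (intro tendsto_intros lim)
  \<comment> \<open>A perturbation of the frame by less than \<open>B / 2\<close> costs at most half
    of the lower bound \<open>B\<close> for \<open>L u0\<close>.\<close>
  then have small: "\<forall>\<^sub>F u in at u0 within U. (\<Sum>b\<in>D. norm (X u b - X u0 b)) < B / 2"
    using B(1) by (intro order_tendstoD(2)) auto
  have lower: "\<forall>\<^sub>F u in at u0 within U. \<forall>x\<in>span D. B / 2 * norm x \<le> norm (L u x)"
    using small
  proof (rule eventually_mono, intro ballI)
    fix u x assume u: "(\<Sum>b\<in>D. norm (X u b - X u0 b)) < B / 2" and x: "x \<in> span D"
    have "norm (L u0 x - L u x) = norm (\<Sum>b\<in>D. (x \<bullet> b) *\<^sub>R (X u0 b - X u b))"
      by (simp add: L_def sum_subtractf scaleR_diff_right)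
    also have "\<dots> \<le> (\<Sum>b\<in>D. norm x * norm (X u b - X u0 b))"
      using D Basis_le_norm by (intro sum_norm_le) (auto simp: norm_minus_commute intro!: mult_right_mono)
    also have "\<dots> \<le> norm x * (B / 2)"
      using u unfolding sum_distrib_left [symmetric] by (intro mult_left_mono) auto
    finally show "B / 2 * norm x \<le> norm (L u x)"
      using B(2) [OF x] norm_triangle_sub [of "L u0 x" "L u x"] by (simp add: algebra_simps)
  qed
  obtain c0 where c0: "w u0 = (\<Sum>b\<in>D. c0 b *\<^sub>R X u0 b)" using w [OF u0] by auto
  \<comment> \<open>\<open>w'\<close> keeps the coefficients of \<open>w u0\<close> while the frame
    moves, so it tends to \<open>w u0\<close>. The quantity \<rho> measures how much
    \<open>w\<close> and \<open>w'\<close> differ in their inner products with the frame.\<close>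
  define w' where "w' u = (\<Sum>b\<in>D. c0 b *\<^sub>R X u b)" for u
  define \<rho> where "\<rho> u = (\<Sum>b\<in>D. \<bar>w u \<bullet> X u b - w' u \<bullet> X u b\<bar>)" for u
  have w': "(w' \<longlongrightarrow> w u0) (at u0 within U)"
    unfolding w'_def [abs_def] c0 by (intro tendsto_intros lim)
  have "(\<rho> \<longlongrightarrow> (\<Sum>b\<in>D. \<bar>w u0 \<bullet> X u0 b - w u0 \<bullet> X u0 b\<bar>)) (at u0 within U)"
    unfolding \<rho>_def [abs_def]
  proof (intro tendsto_sum tendsto_rabs tendsto_diff)
    fix b assume b: "b \<in> D"
    show "((\<lambda>u. w u \<bullet> X u b) \<longlongrightarrow> w u0 \<bullet> X u0 b) (at u0 within U)"
      using wX [OF b] u0 by (simp add: continuous_on_def)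
    show "((\<lambda>u. w' u \<bullet> X u b) \<longlongrightarrow> w u0 \<bullet> X u0 b) (at u0 within U)"
      by (intro tendsto_inner w' lim [OF b])
  qed
  then have \<rho>: "((\<lambda>u. 2 / B * \<rho> u) \<longlongrightarrow> 0) (at u0 within U)"
    by (intro tendsto_mult_right_zero) simp
  have "\<forall>\<^sub>F u in at u0 within U. u \<in> U" by (simp add: eventually_at_filter)
  with lower have "\<forall>\<^sub>F u in at u0 within U. norm (w u - w' u) \<le> 2 / B * \<rho> u"
  proof eventually_elim
    case (elim u)
    obtain c where c: "w u = (\<Sum>b\<in>D. c b *\<^sub>R X u b)" using w [OF elim(2)] by auto
    define k where "k = (\<Sum>b\<in>D. (c b - c0 b) *\<^sub>R b)"
    have k: "k \<in> span D" unfolding k_def by (intro span_sum span_scale span_base)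
    have kb: "k \<bullet> b = c b - c0 b" if "b \<in> D" for b
      unfolding k_def by (rule inner_sum_coords [OF D that])
    have e: "w u - w' u = L u k"
      by (simp add: L_def c w'_def kb scaleR_diff_left sum_subtractf cong: sum.cong)
    \<comment> \<open>Pairing the difference with its own expansion \<open>L u k\<close> bounds its
      squared norm by \<open>norm k * \<rho> u\<close>. Since \<open>norm k\<close> is at most
      \<open>2 / B\<close> times the norm of the difference, one factor cancels.\<close>
    have "(norm (w u - w' u))\<^sup>2 = (w u - w' u) \<bullet> L u k"
      by (simp add: e power2_norm_eq_inner)
    also have "\<dots> = (\<Sum>b\<in>D. (k \<bullet> b) * (w u \<bullet> X u b - w' u \<bullet> X u b))"
      by (simp add: L_def inner_sum_right inner_diff_left)
    also have "\<dots> \<le> (\<Sum>b\<in>D. norm k * \<bar>w u \<bullet> X u b - w' u \<bullet> X u b\<bar>)"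
    proof (rule sum_mono)
      fix b assume "b \<in> D"
      then have "\<bar>k \<bullet> b\<bar> \<le> norm k" using D Basis_le_norm by blast
      then have "\<bar>k \<bullet> b\<bar> * \<bar>w u \<bullet> X u b - w' u \<bullet> X u b\<bar> \<le> norm k * \<bar>w u \<bullet> X u b - w' u \<bullet> X u b\<bar>"
        by (intro mult_right_mono) auto
      then show "(k \<bullet> b) * (w u \<bullet> X u b - w' u \<bullet> X u b) \<le> norm k * \<bar>w u \<bullet> X u b - w' u \<bullet> X u b\<bar>"
        using abs_ge_self [of "(k \<bullet> b) * (w u \<bullet> X u b - w' u \<bullet> X u b)"] unfolding abs_mult by linarith
    qed
    also have "\<dots> = norm k * \<rho> u" by (simp add: \<rho>_def sum_distrib_left)
    also have "\<dots> \<le> (2 / B * norm (w u - w' u)) * \<rho> u"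
    proof (rule mult_right_mono)
      show "norm k \<le> 2 / B * norm (w u - w' u)"
        using elim(1) k B(1) unfolding e by (auto simp: field_simps)
      show "0 \<le> \<rho> u" by (simp add: \<rho>_def sum_nonneg)
    qed
    finally have "norm (w u - w' u) * norm (w u - w' u) \<le> norm (w u - w' u) * (2 / B * \<rho> u)"
      by (simp add: power2_eq_square mult_ac)
    moreover have "0 \<le> 2 / B * \<rho> u" using B(1) by (simp add: \<rho>_def sum_nonneg)
    ultimately show ?case
      by (metis mult_le_cancel_left_pos norm_ge_zero order_le_less)
  qed
  then have "((\<lambda>u. w u - w' u) \<longlongrightarrow> 0) (at u0 within U)"
    using \<rho> by (rule Lim_null_comparison)
  from tendsto_add [OF this w'] show "(w \<longlongrightarrow> w u0) (at u0 within U)" by simp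
qed

section \<open>Tangent vectors and gradients in a parametrization\<close>

context carnot_group
begin

context
  fixes N D U f
  assumes P: "local_param G 1 N D U f"
begin

lemma partial_velocity_in_tangent_space:
  assumes u: "u \<in> U" and b: "b \<in> D"
  shows "partial_velocity G f u b \<in> tangent_space G N (f u)"
proof -
  have "partial_velocity G f u b = (\<Sum>a\<in>D. (if a = b then 1 else 0) *\<^sub>R partial_velocity G f u a)"
    using local_paramD(2) [OF P] b by (simp add: if_distrib [where f = "\<lambda>c. c *\<^sub>R _"] cong: if_cong)
  then show ?thesis
    unfolding tangent_space_param [OF P u]
    by (intro image_eqI [where x = "\<lambda>a. if a = b then 1 else 0"]) simp_all
qed

lemma tangent_space_inner_eqI:
  assumes u: "u \<in> U" and v: "v \<in> tangent_space G N (f u)"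
    and eq: "\<And>b. b \<in> D \<Longrightarrow> x \<bullet> partial_velocity G f u b = y \<bullet> partial_velocity G f u b"
  shows "x \<bullet> v = y \<bullet> v"
  using v eq unfolding tangent_space_param [OF P u] by (auto simp: inner_sum_right)

text \<open>The differential of \<open>f\<close> at \<open>u\<close> in the left-invariant frame,
  extended from \<open>span D\<close> by ignoring the components orthogonal to it.\<close>

definition velocity_map :: "'e \<Rightarrow> 'e \<Rightarrow> 'e" where
  "velocity_map u x = (\<Sum>b\<in>D. (x \<bullet> b) *\<^sub>R partial_velocity G f u b)"

lemma linear_velocity_map: "linear (velocity_map u)"
  unfolding velocity_map_def [abs_def]
  by (rule linearI) (simp_all add: inner_add_left scaleR_add_left sum.distrib scaleR_sum_right)

lemma velocity_map_basis: "b \<in> D \<Longrightarrow> velocity_map u b = partial_velocity G f u b"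
proof -
  assume b: "b \<in> D"
  have "(b \<bullet> a) *\<^sub>R partial_velocity G f u a = (if a = b then partial_velocity G f u a else 0)" if "a \<in> D" for a
    using local_paramD(1) [OF P] b that by (auto simp: inner_Basis subset_iff)
  then show ?thesis using b local_paramD(2) [OF P] by (simp add: velocity_map_def cong: sum.cong)
qed

lemma inj_on_velocity_map:
  assumes u: "u \<in> U"
  shows "inj_on (velocity_map u) (span D)"
proof (rule inj_onI)
  fix x y assume x: "x \<in> span D" "y \<in> span D" "velocity_map u x = velocity_map u y"
  then have "velocity_map u (x - y) = 0" by (simp add: linear_diff [OF linear_velocity_map])
  then have "(x - y) \<bullet> b = 0" if "b \<in> D" for b
    using local_paramD(11) [OF P u, of "\<lambda>b. (x - y) \<bullet> b"] that by (simp add: velocity_map_def)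
  moreover have "x - y \<in> span D" using x by (simp add: span_diff)
  ultimately have "x - y = 0" using span_coords_expansion [OF local_paramD(1) [OF P], of "x - y"] by simp
  then show "x = y" by simp
qed

lemma dim_tangent_space:
  assumes u: "u \<in> U"
  shows "dim (tangent_space G N (f u)) = card D"
proof -
  have "tangent_space G N (f u) = velocity_map u ` span D"
  proof (intro subset_antisym subsetI)
    fix v assume "v \<in> tangent_space G N (f u)"
    then obtain c where c: "v = (\<Sum>b\<in>D. c b *\<^sub>R partial_velocity G f u b)"
      unfolding tangent_space_param [OF P u] by auto
    have "velocity_map u (\<Sum>b\<in>D. c b *\<^sub>R b) = v"
      by (simp add: velocity_map_def c inner_sum_coords [OF local_paramD(1) [OF P]] cong: sum.cong)
    moreover have "(\<Sum>b\<in>D. c b *\<^sub>R b) \<in> span D" by (intro span_sum span_scale span_base)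
    ultimately show "v \<in> velocity_map u ` span D" by blast
  next
    fix v assume "v \<in> velocity_map u ` span D"
    then show "v \<in> tangent_space G N (f u)"
      unfolding tangent_space_param [OF P u] velocity_map_def by auto
  qed
  then have "dim (tangent_space G N (f u)) = dim (span D)"
    using dim_image_eq [OF linear_velocity_map [of u], of "span D"] inj_on_velocity_map [OF u] by (simp add: span_span)
  also have "\<dots> = card D"
    using independent_mono [OF independent_Basis local_paramD(1) [OF P]] by (simp add: dim_eq_card_independent)
  finally show ?thesis .
qed

text \<open>Riesz representation on the tangent space. The adjoint of a left inverse of
  \<open>velocity_map\<close> gives an ambient vector with the prescribed inner products, and
  projecting it to the tangent space does not change them.\<close>

lemma ex_dual_vector:
  assumes u: "u \<in> U"
  shows "\<exists>w\<in>tangent_space G N (f u). \<forall>b\<in>D. w \<bullet> partial_velocity G f u b = \<alpha> b"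
proof -
  let ?T = "tangent_space G N (f u)"
  note T = subspace_tangent_space [OF P u]
  obtain l where l: "linear l" "\<And>x. x \<in> span D \<Longrightarrow> l (velocity_map u x) = x"
    using linear_exists_left_inverse_on [OF linear_velocity_map subspace_span inj_on_velocity_map [OF u]] by blast
  define a where "a = adjoint l (\<Sum>b\<in>D. \<alpha> b *\<^sub>R b)"
  have "orth_proj ?T a \<bullet> partial_velocity G f u b = \<alpha> b" if b: "b \<in> D" for b
  proof -
    have "orth_proj ?T a \<bullet> partial_velocity G f u b = a \<bullet> partial_velocity G f u b"
      by (rule orth_proj_inner [OF T partial_velocity_in_tangent_space [OF u b]])
    also have "\<dots> = (\<Sum>b\<in>D. \<alpha> b *\<^sub>R b) \<bullet> l (partial_velocity G f u b)"
      unfolding a_def using adjoint_works [OF l(1)] by (simp add: inner_commute)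
    also have "l (partial_velocity G f u b) = b"
      using l(2) [OF span_base [OF b]] by (simp add: velocity_map_basis b)
    finally show ?thesis using inner_sum_coords [OF local_paramD(1) [OF P] b] by simp
  qed
  then show ?thesis using orth_proj_in [OF T] by blast
qed

lemma continuous_on_tangent_vector:
  assumes "\<And>u. u \<in> U \<Longrightarrow> w u \<in> tangent_space G N (f u)"
    and "\<And>b. b \<in> D \<Longrightarrow> continuous_on U (\<lambda>u. w u \<bullet> partial_velocity G f u b)"
  shows "continuous_on U w"
proof (rule continuous_on_dual_frame [where X = "partial_velocity G f" and D = D])
  show "continuous_on U (\<lambda>u. partial_velocity G f u b)" if "b \<in> D" for b
    by (rule continuous_on_partial_velocity [OF P that])
  show "w u \<in> range (\<lambda>c. \<Sum>b\<in>D. c b *\<^sub>R partial_velocity G f u b)" if "u \<in> U" for u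
    using assms(1) [OF that] unfolding tangent_space_param [OF P that] .
qed (use local_paramD [OF P] assms in auto)

text \<open>The projection has the same inner products with tangent vectors as \<open>a\<close>
  itself, so \<open>continuous_on_tangent_vector\<close> applies without a formula for the
  projection.\<close>

lemma continuous_on_orth_proj_tangent:
  "continuous_on U (\<lambda>u. orth_proj (tangent_space G N (f u)) a)"
proof (rule continuous_on_tangent_vector)
  show "orth_proj (tangent_space G N (f u)) a \<in> tangent_space G N (f u)" if "u \<in> U" for u
    by (rule orth_proj_in [OF subspace_tangent_space [OF P that]])
  fix b assume b: "b \<in> D"
  have "continuous_on U (\<lambda>u. a \<bullet> partial_velocity G f u b)"
    by (intro continuous_intros continuous_on_partial_velocity [OF P b])
  then show "continuous_on U (\<lambda>u. orth_proj (tangent_space G N (f u)) a \<bullet> partial_velocity G f u b)"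
    by (rule continuous_on_eq)
      (simp add: orth_proj_inner subspace_tangent_space [OF P] partial_velocity_in_tangent_space b)
qed

text \<open>The definition tests all curves in \<open>N\<close>. Lifting a curve to the parameters
  reduces the test to the chain rule; conversely, every tangent vector is the velocity of some
  curve, which makes the gradient unique.\<close>

lemma tangential_grad_eqI:
  assumes u: "u \<in> U" and \<phi>: "((\<phi> \<circ> f) has_derivative \<phi>') (at u within U)"
    and w: "w \<in> tangent_space G N (f u)" "\<And>b. b \<in> D \<Longrightarrow> w \<bullet> partial_velocity G f u b = \<phi>' b"
  shows "tangential_grad G N \<phi> (f u) = w"
  unfolding tangential_grad_def
proof (rule the_equality)
  interpret \<phi>': bounded_linear \<phi>' using \<phi> by (rule has_derivative_bounded_linear)
  have deriv: "((\<phi> \<circ> \<gamma>) has_real_derivative w \<bullet> v) (at 0)"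
    if \<gamma>: "range \<gamma> \<subseteq> N" "\<gamma> 0 = f u" "has_velocity G \<gamma> v 0" for \<gamma> v
  proof -
    obtain c d where c: "\<forall>\<^sub>F s in nhds 0. c s \<in> U \<and> f (c s) = \<gamma> s" "c 0 = u" "(c has_vector_derivative d) (at 0)"
      "d \<in> span D" "v = (\<Sum>b\<in>D. (d \<bullet> b) *\<^sub>R partial_velocity G f u b)"
      using velocity_lift [OF P \<gamma> u] by blast
    have "\<phi>' d = \<phi>' (\<Sum>b\<in>D. (d \<bullet> b) *\<^sub>R b)"
      using span_coords_expansion [OF local_paramD(1) [OF P] c(4)] by simp
    also have "\<dots> = w \<bullet> v"
      by (simp add: c(5) inner_sum_right \<phi>'.sum \<phi>'.scaleR w(2) cong: sum.cong)
    finally have eq: "\<phi>' d = w \<bullet> v" .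
    have "((\<lambda>s. (\<phi> \<circ> f) (c s)) has_vector_derivative \<phi>' d) (at 0)"
      using \<phi> c by (intro has_vector_derivative_within_curve [of "\<phi> \<circ> f" \<phi>' c 0 U]) (auto elim: eventually_mono)
    then have "((\<lambda>s. (\<phi> \<circ> \<gamma>) s) has_vector_derivative \<phi>' d) (at 0)"
    proof (rule has_vector_derivative_cong_ev [THEN iffD1, rotated 2])
      show "\<forall>\<^sub>F s in nhds 0. s \<in> UNIV \<longrightarrow> (\<phi> \<circ> f) (c s) = (\<phi> \<circ> \<gamma>) s"
        using c(1) by (rule eventually_mono) simp
      show "(\<phi> \<circ> f) (c 0) = (\<phi> \<circ> \<gamma>) 0" using c(2) \<gamma>(2) by simp
    qed
    then show ?thesis by (simp add: eq has_real_derivative_iff_has_vector_derivative comp_def)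
  qed
  then show "w \<in> tangent_space G N (f u) \<and> (\<forall>\<gamma> v. range \<gamma> \<subseteq> N \<and> \<gamma> 0 = f u \<and> has_velocity G \<gamma> v 0 \<longrightarrow>
      ((\<phi> \<circ> \<gamma>) has_real_derivative w \<bullet> v) (at 0))" using w(1) by blast
  fix w' assume w': "w' \<in> tangent_space G N (f u) \<and> (\<forall>\<gamma> v. range \<gamma> \<subseteq> N \<and> \<gamma> 0 = f u \<and> has_velocity G \<gamma> v 0 \<longrightarrow>
      ((\<phi> \<circ> \<gamma>) has_real_derivative w' \<bullet> v) (at 0))"
  show "w' = w"
  proof (rule subspace_orthogonal_unique [OF subspace_tangent_space [OF P u]])
    fix v assume "v \<in> tangent_space G N (f u)"
    then obtain \<gamma> where \<gamma>: "range \<gamma> \<subseteq> N" "\<gamma> 0 = f u" "has_velocity G \<gamma> v 0"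
      by (auto simp: tangent_space_def)
    then have "((\<phi> \<circ> \<gamma>) has_real_derivative w' \<bullet> v) (at 0)" using w' by blast
    then show "w' \<bullet> v = w \<bullet> v" using deriv [OF \<gamma>] by (rule DERIV_unique)
  qed (use w w' in auto)
qed

lemma tangential_grad_param:
  assumes \<phi>: "C_on 1 D (\<phi> \<circ> f) U" and u: "u \<in> U"
  shows "tangential_grad G N \<phi> (f u) \<in> tangent_space G N (f u)"
    and "\<And>b. b \<in> D \<Longrightarrow> tangential_grad G N \<phi> (f u) \<bullet> partial_velocity G f u b =
      frechet_derivative (\<phi> \<circ> f) (at u within U) b"
proof -
  have der: "((\<phi> \<circ> f) has_derivative frechet_derivative (\<phi> \<circ> f) (at u within U)) (at u within U)"
    using \<phi> u unfolding C_on_1_iff differentiable_on_def frechet_derivative_works [symmetric] by blast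
  obtain w where w: "w \<in> tangent_space G N (f u)"
    "\<And>b. b \<in> D \<Longrightarrow> w \<bullet> partial_velocity G f u b = frechet_derivative (\<phi> \<circ> f) (at u within U) b"
    using ex_dual_vector [OF u, of "frechet_derivative (\<phi> \<circ> f) (at u within U)"] by blast
  then show "tangential_grad G N \<phi> (f u) \<in> tangent_space G N (f u)"
    "\<And>b. b \<in> D \<Longrightarrow> tangential_grad G N \<phi> (f u) \<bullet> partial_velocity G f u b =
      frechet_derivative (\<phi> \<circ> f) (at u within U) b"
    using tangential_grad_eqI [OF u der w] by simp_all
qed

lemma continuous_on_tangential_grad_param:
  assumes \<phi>: "C_on 1 D (\<phi> \<circ> f) U"
  shows "continuous_on U (\<lambda>u. tangential_grad G N \<phi> (f u))"
proof (rule continuous_on_tangent_vector)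
  show "tangential_grad G N \<phi> (f u) \<in> tangent_space G N (f u)" if "u \<in> U" for u
    by (rule tangential_grad_param(1) [OF \<phi> that])
  fix b assume b: "b \<in> D"
  then have "continuous_on U (\<lambda>u. frechet_derivative (\<phi> \<circ> f) (at u within U) b)"
    using \<phi> unfolding C_on_1_iff by blast
  then show "continuous_on U (\<lambda>u. tangential_grad G N \<phi> (f u) \<bullet> partial_velocity G f u b)"
    by (rule continuous_on_eq) (simp add: tangential_grad_param(2) [OF \<phi>] b)
qed

end

end

text \<open>By dimension, \<nu> and \<open>T\<close> span \<open>E\<close>, so the difference of the
  two sides is orthogonal to all of \<open>E\<close>, including itself. The lemma is used for
  hypersurfaces in the group and for level sets in a hypersurface.\<close>

lemma codim1_orthogonal:
  fixes E T :: "'e::euclidean_space set"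
  assumes E: "subspace E" "subspace T" "T \<subseteq> E" "dim E = dim T + 1"
    and \<nu>: "\<nu> \<in> E" "norm \<nu> = 1" "\<And>v. v \<in> T \<Longrightarrow> \<nu> \<bullet> v = 0"
    and x: "x \<in> E" "\<And>v. v \<in> T \<Longrightarrow> x \<bullet> v = 0"
  shows "x = (x \<bullet> \<nu>) *\<^sub>R \<nu>"
proof -
  have \<nu>\<nu>: "\<nu> \<bullet> \<nu> = 1" using \<nu>(2) by (simp add: norm_eq_1)
  have "\<nu> \<notin> span T" using \<nu>(3) [of \<nu>] \<nu>\<nu> unfolding span_eq_iff [THEN iffD2, OF E(2)] by auto
  then have "dim (span (insert \<nu> T)) = dim E" by (simp add: dim_insert E(4))
  moreover have "span (insert \<nu> T) \<subseteq> E" using E \<nu>(1) by (intro span_minimal) auto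
  ultimately have span: "span (insert \<nu> T) = E" using E(1) by (intro subspace_dim_equal) auto
  let ?y = "x - (x \<bullet> \<nu>) *\<^sub>R \<nu>"
  have "orthogonal ?y z" if "z \<in> span (insert \<nu> T)" for z
    using that
  proof (rule orthogonal_to_span)
    show "orthogonal ?y z" if "z \<in> insert \<nu> T" for z
      using that \<nu>(3) x(2) \<nu>\<nu> by (auto simp: orthogonal_def inner_diff_left)
  qed
  moreover have "?y \<in> E" using E x(1) \<nu>(1) by (intro subspace_diff subspace_scale)
  ultimately have "orthogonal ?y ?y" using span by blast
  then show ?thesis by (simp add: orthogonal_def)
qed

text \<open>Meant for \<open>grad_HS\<close>, with \<open>Z\<close> the characteristic set, where
  the rank of \<open>HS\<close> changes.\<close>

lemma borel_measurable_piecewise_continuous: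
  fixes g :: "'a::topological_space \<Rightarrow> 'b::topological_space"
  assumes Z: "Z \<in> sets (restrict_space borel S)" and g: "continuous_on Z g" "continuous_on (S - Z) g"
  shows "g \<in> borel_measurable (restrict_space borel S)"
proof (rule measurableI)
  fix B :: "'b set" assume B: "B \<in> sets borel"
  have SZ: "S - Z \<in> sets (restrict_space borel S)"
    using sets.compl_sets [OF Z] by (simp add: space_restrict_space)
  have part: "g -` B \<inter> A \<in> sets (restrict_space borel S)"
    if A: "A \<in> sets (restrict_space borel S)" and g: "continuous_on A g" for A
  proof -
    have "g -` B \<inter> space (restrict_space borel A) \<in> sets (restrict_space borel A)"
      by (rule measurable_sets [OF borel_measurable_continuous_on_restrict [OF g] B])
    then obtain C where C: "C \<in> sets borel" "g -` B \<inter> A = A \<inter> C"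
      by (auto simp: sets_restrict_space space_restrict_space)
    obtain A' where "A' \<in> sets borel" "A = S \<inter> A'" using A by (auto simp: sets_restrict_space)
    then have "A \<inter> C = S \<inter> (A' \<inter> C)" "A' \<inter> C \<in> sets borel" using C by auto
    then show ?thesis unfolding C(2) sets_restrict_space by blast
  qed
  have "Z \<subseteq> S" using sets.sets_into_space [OF Z] by (simp add: space_restrict_space)
  then have "g -` B \<inter> space (restrict_space borel S) = (g -` B \<inter> Z) \<union> (g -` B \<inter> (S - Z))"
    by (auto simp: space_restrict_space)
  then show "g -` B \<inter> space (restrict_space borel S) \<in> sets (restrict_space borel S)"
    using part [OF Z g(1)] part [OF SZ g(2)] by auto
qed simp

section \<open>Normals and horizontal projections on a hypersurface\<close>

context carnot_group
begin

lemma layer_subspace: "subspace (layer G 1)"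
  using step by (intro subspace_layer) auto

lemma continuous_on_param:
  fixes g :: "'g \<Rightarrow> 'z::topological_space"
  assumes N: "submanifold G 1 m N" and M: "M \<subseteq> N"
    and cont: "\<And>D U f. local_param G 1 N D U f \<Longrightarrow> card D = m \<Longrightarrow> continuous_on (U \<inter> f -` M) (\<lambda>u. g (f u))"
  shows "continuous_on M g"
proof (rule continuous_on_locally)
  fix p assume p: "p \<in> M"
  then obtain D U f where P: "local_param G 1 N D U f" "card D = m" "p \<in> f ` U"
    using N M unfolding submanifold_def by blast
  note param = local_paramD [OF P(1)]
  obtain T where T: "open T" "f ` U = N \<inter> T" using param(5) by (auto simp: openin_open)
  have "openin (top_of_set M) (M \<inter> f ` U)"
    using T M by (auto simp: openin_open)
  moreover have "continuous_on (M \<inter> f ` U) (\<lambda>p. g (f (inv_into U f p)))"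
  proof (rule continuous_on_compose2 [OF cont [OF P(1,2)]])
    show "continuous_on (M \<inter> f ` U) (inv_into U f)"
      using param(7) by (auto simp: homeomorphism_def elim: continuous_on_subset)
    show "inv_into U f ` (M \<inter> f ` U) \<subseteq> U \<inter> f -` M"
      by (auto simp: inv_into_into f_inv_into_f)
  qed
  then have "continuous_on (M \<inter> f ` U) g"
    by (rule continuous_on_eq) (simp add: f_inv_into_f)
  ultimately show "\<exists>W. openin (top_of_set M) W \<and> p \<in> W \<and> continuous_on W g"
    using p P(3) by blast
qed

context
  fixes S D U f
  assumes P: "local_param G 1 S D U f" and codim: "card D = DIM('e) - 1"
begin

lemma unit_normal_hypersurface:
  assumes u: "u \<in> U"
  shows "norm (unit_normal G UNIV S (f u)) = 1"
    and "\<And>v. v \<in> tangent_space G S (f u) \<Longrightarrow> unit_normal G UNIV S (f u) \<bullet> v = 0"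
proof -
  let ?T = "tangent_space G S (f u)"
  have "dim ?T < DIM('e)" using dim_tangent_space [OF P u] codim by simp
  then obtain x where x: "x \<noteq> 0" "\<And>y. y \<in> span ?T \<Longrightarrow> orthogonal x y"
    using orthogonal_to_subspace_exists by blast
  then have "\<exists>\<nu>. \<nu> \<in> UNIV \<and> norm \<nu> = 1 \<and> (\<forall>v\<in>?T. \<nu> \<bullet> v = 0)"
    by (intro exI [of _ "x /\<^sub>R norm x"]) (auto simp: orthogonal_def span_base)
  from someI_ex [OF this] show "norm (unit_normal G UNIV S (f u)) = 1"
    "\<And>v. v \<in> ?T \<Longrightarrow> unit_normal G UNIV S (f u) \<bullet> v = 0"
    by (auto simp: unit_normal_def)
qed

lemma normal_multiple:
  assumes u: "u \<in> U" and n: "\<And>v. v \<in> tangent_space G S (f u) \<Longrightarrow> n \<bullet> v = 0"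
  shows "n = (n \<bullet> unit_normal G UNIV S (f u)) *\<^sub>R unit_normal G UNIV S (f u)"
  using n unit_normal_hypersurface [OF u] dim_tangent_space [OF P u] codim subspace_tangent_space [OF P u]
  by (intro codim1_orthogonal [of UNIV "tangent_space G S (f u)"]) (auto simp: Suc_leI)

text \<open>The component of \<open>e\<close> orthogonal to the tangent space is a multiple of the
  unit normal, and so is \<open>n\<close>. If \<open>n\<close> is orthogonal to \<open>e\<close>, it
  is orthogonal to this component, which must then vanish.\<close>

lemma tangent_space_iff_normal:
  assumes u: "u \<in> U" and n: "n \<noteq> 0" "\<And>v. v \<in> tangent_space G S (f u) \<Longrightarrow> n \<bullet> v = 0"
  shows "e \<in> tangent_space G S (f u) \<longleftrightarrow> n \<bullet> e = 0"
proof
  let ?T = "tangent_space G S (f u)" and ?\<nu> = "unit_normal G UNIV S (f u)"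
  assume 0: "n \<bullet> e = 0"
  let ?r = "e - orth_proj ?T e"
  note T = subspace_tangent_space [OF P u]
  have r: "?r = (?r \<bullet> ?\<nu>) *\<^sub>R ?\<nu>"
    by (rule normal_multiple [OF u]) (simp add: inner_diff_left orth_proj_inner [OF T])
  have "n \<bullet> ?r = 0" using 0 n(2) [OF orth_proj_in [OF T]] by (simp add: inner_diff_right)
  moreover have "n \<bullet> ?\<nu> \<noteq> 0" using normal_multiple [OF u n(2)] n(1) by auto
  ultimately have "?r \<bullet> ?\<nu> = 0" using r by (metis inner_scaleR_right mult_eq_0_iff)
  then have "?r = 0" using r by simp
  then show "e \<in> ?T" using orth_proj_in [OF T, of e] by simp
qed (use n in auto)

text \<open>The quotient is invariant under rescaling of the normal, so the arbitrarily chosen unit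
  normal may be exchanged for any nonzero normal, in particular for a continuous one.\<close>

lemma hor_normal_norm_normal:
  assumes u: "u \<in> U" and n: "n \<noteq> 0" "\<And>v. v \<in> tangent_space G S (f u) \<Longrightarrow> n \<bullet> v = 0"
  shows "hor_normal_norm G S (f u) = norm (orth_proj (layer G 1) n) / norm n"
proof -
  let ?\<nu> = "unit_normal G UNIV S (f u)"
  note eq = normal_multiple [OF u n(2)]
  have "norm n = norm ((n \<bullet> ?\<nu>) *\<^sub>R ?\<nu>)" by (rule arg_cong [OF eq])
  also have "\<dots> = \<bar>n \<bullet> ?\<nu>\<bar>" by (simp add: unit_normal_hypersurface(1) [OF u])
  finally have "norm n = \<bar>n \<bullet> ?\<nu>\<bar>" .
  moreover have "orth_proj (layer G 1) n = orth_proj (layer G 1) ((n \<bullet> ?\<nu>) *\<^sub>R ?\<nu>)"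
    by (rule arg_cong [OF eq])
  ultimately have "norm n = \<bar>n \<bullet> ?\<nu>\<bar>"
    "orth_proj (layer G 1) n = (n \<bullet> ?\<nu>) *\<^sub>R orth_proj (layer G 1) ?\<nu>"
    by (simp_all only: linear_scale [OF linear_orth_proj [OF layer_subspace]])
  moreover from this n(1) have "n \<bullet> ?\<nu> \<noteq> 0" by (metis abs_0 norm_eq_zero)
  ultimately show ?thesis
    by (simp add: hor_normal_norm_def)
qed

text \<open>\<open>unit_normal\<close> is chosen point by point and need not be continuous. Fixing
  the normal at \<open>u0\<close> and removing its tangential part at nearby points gives a
  continuous normal field that stays nonzero near \<open>u0\<close>.\<close>

lemma normal_field:
  assumes u0: "u0 \<in> U"
  obtains W n where "openin (top_of_set U) W" "u0 \<in> W" "continuous_on W n"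
    "\<And>u. u \<in> W \<Longrightarrow> n u \<noteq> 0" "\<And>u v. u \<in> W \<Longrightarrow> v \<in> tangent_space G S (f u) \<Longrightarrow> n u \<bullet> v = 0"
proof -
  let ?\<nu> = "unit_normal G UNIV S (f u0)"
  define n where "n u = ?\<nu> - orth_proj (tangent_space G S (f u)) ?\<nu>" for u
  have cont: "continuous_on U n"
    unfolding n_def [abs_def]
    by (intro continuous_intros continuous_on_orth_proj_tangent [OF P])
  have perp: "n u \<bullet> v = 0" if "u \<in> U" "v \<in> tangent_space G S (f u)" for u v
    using that by (simp add: n_def inner_diff_left orth_proj_inner [OF subspace_tangent_space [OF P]])
  have "orth_proj (tangent_space G S (f u0)) ?\<nu> = 0"
    using unit_normal_hypersurface(2) [OF u0] subspace_tangent_space [OF P u0]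
    by (intro orth_proj_eqI) (auto intro: subspace_0)
  then have "n u0 \<noteq> 0" using unit_normal_hypersurface(1) [OF u0] by (auto simp: n_def)
  let ?W = "U \<inter> n -` (- {0})"
  have "openin (top_of_set U) ?W"
    using cont by (rule continuous_openin_preimage_gen) auto
  moreover have "continuous_on ?W n" using cont by (rule continuous_on_subset) auto
  ultimately show ?thesis
    using that [of ?W n] u0 \<open>n u0 \<noteq> 0\<close> perp by blast
qed

lemma continuous_on_hor_normal_norm_param: "continuous_on U (\<lambda>u. hor_normal_norm G S (f u))"
proof (rule continuous_on_locally)
  fix u0 assume u0: "u0 \<in> U"
  obtain W n where W: "openin (top_of_set U) W" "u0 \<in> W" "continuous_on W n"
    "\<And>u. u \<in> W \<Longrightarrow> n u \<noteq> 0" "\<And>u v. u \<in> W \<Longrightarrow> v \<in> tangent_space G S (f u) \<Longrightarrow> n u \<bullet> v = 0"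
    using normal_field [OF u0] by blast
  have "continuous_on W (\<lambda>u. norm (orth_proj (layer G 1) (n u)) / norm (n u))"
    by (intro continuous_on_divide continuous_on_norm W(3) ballI
        linear_continuous_on_compose [OF W(3) linear_orth_proj [OF layer_subspace]]) (simp add: W(4))
  then have "continuous_on W (\<lambda>u. hor_normal_norm G S (f u))"
  proof (rule continuous_on_eq)
    fix u assume u: "u \<in> W"
    then have "u \<in> U" using W(1) openin_imp_subset by blast
    then show "norm (orth_proj (layer G 1) (n u)) / norm (n u) = hor_normal_norm G S (f u)"
      using W(4,5) u by (intro hor_normal_norm_normal [symmetric]) auto
  qed
  then show "\<exists>W. openin (top_of_set U) W \<and> u0 \<in> W \<and> continuous_on W (\<lambda>u. hor_normal_norm G S (f u))"
    using W(1,2) by blast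
qed

text \<open>At a characteristic point \<open>m = 0\<close>, so the quotient is \<open>0\<close>, and then \<open>HS\<close> is the
  whole horizontal space.\<close>

lemma orth_proj_HS:
  assumes u: "u \<in> U" and n: "n \<noteq> 0" "\<And>v. v \<in> tangent_space G S (f u) \<Longrightarrow> n \<bullet> v = 0"
  defines "m \<equiv> orth_proj (layer G 1) n"
  shows "orth_proj (HS G S (f u)) w =
    orth_proj (layer G 1) w - ((orth_proj (layer G 1) w \<bullet> m) / (m \<bullet> m)) *\<^sub>R m"
proof (rule orth_proj_eqI)
  let ?T = "tangent_space G S (f u)" and ?H = "layer G 1"
  let ?x = "orth_proj ?H w - ((orth_proj ?H w \<bullet> m) / (m \<bullet> m)) *\<^sub>R m"
  note H = layer_subspace
  note T = subspace_tangent_space [OF P u]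
  have m: "m \<in> ?H" "\<And>e. e \<in> ?H \<Longrightarrow> m \<bullet> e = n \<bullet> e"
    unfolding m_def using orth_proj_in [OF H] orth_proj_inner [OF H] by auto
  show "subspace (HS G S (f u))" unfolding HS_def using H T by (rule subspace_inter)
  have xH: "?x \<in> ?H" using m(1) orth_proj_in [OF H] by (intro subspace_diff subspace_scale H)
  \<comment> \<open>On horizontal vectors \<open>m\<close> and \<open>n\<close> have the same inner
    products, so a horizontal vector is tangent exactly when it is orthogonal to
    \<open>m\<close>.\<close>
  have "n \<bullet> ?x = m \<bullet> ?x" using m(2) [OF xH] by simp
  also have "\<dots> = 0" by (simp add: inner_diff_right inner_commute)
  finally have "?x \<in> ?T" using tangent_space_iff_normal [OF u n] by simp
  then show "?x \<in> HS G S (f u)" using xH by (simp add: HS_def)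
  fix e assume "e \<in> HS G S (f u)"
  then have e: "e \<in> ?H" "e \<in> ?T" by (auto simp: HS_def)
  have "m \<bullet> e = 0" using m(2) [OF e(1)] n(2) [OF e(2)] by simp
  then show "(w - ?x) \<bullet> e = 0"
    by (simp add: inner_diff_left orth_proj_inner [OF H e(1)] del: One_nat_def)
qed

text \<open>In the formula of \<open>orth_proj_HS\<close> only the division by
  \<open>m \<bullet> m\<close> can spoil continuity, and \<open>m\<close> vanishes exactly where
  \<open>hor_normal_norm\<close> does. There the formula reduces to the horizontal projection of the
  gradient; elsewhere the quotient is continuous.\<close>

lemma grad_HS_param_continuous:
  assumes \<phi>: "C_on 1 D (\<phi> \<circ> f) U"
  shows "continuous_on (U \<inter> f -` {p. hor_normal_norm G S p = 0}) (\<lambda>u. grad_HS G S \<phi> (f u))"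
    and "continuous_on (U \<inter> f -` {p. hor_normal_norm G S p \<noteq> 0}) (\<lambda>u. grad_HS G S \<phi> (f u))"
proof -
  let ?H = "layer G 1" and ?w = "\<lambda>u. tangential_grad G S \<phi> (f u)"
  have cw: "continuous_on U (\<lambda>u. orth_proj ?H (?w u))"
    by (rule linear_continuous_on_compose [OF continuous_on_tangential_grad_param [OF P \<phi>]
          linear_orth_proj [OF layer_subspace]])
  have loc: "\<exists>W m. openin (top_of_set U) W \<and> u0 \<in> W \<and> continuous_on W m \<and>
      (\<forall>u\<in>W. (m u = 0 \<longleftrightarrow> hor_normal_norm G S (f u) = 0) \<and>
        grad_HS G S \<phi> (f u) = orth_proj ?H (?w u) - ((orth_proj ?H (?w u) \<bullet> m u) / (m u \<bullet> m u)) *\<^sub>R m u)"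
    if u0: "u0 \<in> U" for u0
  proof -
    obtain W n where W: "openin (top_of_set U) W" "u0 \<in> W" "continuous_on W n"
      "\<And>u. u \<in> W \<Longrightarrow> n u \<noteq> 0" "\<And>u v. u \<in> W \<Longrightarrow> v \<in> tangent_space G S (f u) \<Longrightarrow> n u \<bullet> v = 0"
      using normal_field [OF u0] by blast
    have WU: "W \<subseteq> U" using W(1) by (rule openin_imp_subset)
    show ?thesis
    proof (intro exI [of _ W] exI [of _ "\<lambda>u. orth_proj ?H (n u)"] conjI ballI)
      show "continuous_on W (\<lambda>u. orth_proj ?H (n u))"
        by (rule linear_continuous_on_compose [OF W(3) linear_orth_proj [OF layer_subspace]])
      fix u assume u: "u \<in> W"
      then have uU: "u \<in> U" using WU by auto
      show "orth_proj ?H (n u) = 0 \<longleftrightarrow> hor_normal_norm G S (f u) = 0"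
        using hor_normal_norm_normal [OF uU W(4,5) [OF u]] W(4) [OF u] by simp
      show "grad_HS G S \<phi> (f u) = orth_proj ?H (?w u) -
          ((orth_proj ?H (?w u) \<bullet> orth_proj ?H (n u)) / (orth_proj ?H (n u) \<bullet> orth_proj ?H (n u))) *\<^sub>R orth_proj ?H (n u)"
        unfolding grad_HS_def by (rule orth_proj_HS [OF uU W(4,5) [OF u]])
    qed (use W in auto)
  qed
  show "continuous_on (U \<inter> f -` {p. hor_normal_norm G S p = 0}) (\<lambda>u. grad_HS G S \<phi> (f u))"
  proof (rule continuous_on_eq)
    show "continuous_on (U \<inter> f -` {p. hor_normal_norm G S p = 0}) (\<lambda>u. orth_proj ?H (?w u))"
      using cw by (rule continuous_on_subset) auto
    fix u assume u: "u \<in> U \<inter> f -` {p. hor_normal_norm G S p = 0}"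
    then have "u \<in> U" by simp
    from loc [OF this] obtain W m where "openin (top_of_set U) W \<and> u \<in> W \<and> continuous_on W m \<and>
      (\<forall>u\<in>W. (m u = 0 \<longleftrightarrow> hor_normal_norm G S (f u) = 0) \<and>
        grad_HS G S \<phi> (f u) = orth_proj ?H (?w u) - ((orth_proj ?H (?w u) \<bullet> m u) / (m u \<bullet> m u)) *\<^sub>R m u)"
      by (elim exE)
    then have "m u = 0"
      "grad_HS G S \<phi> (f u) = orth_proj ?H (?w u) - ((orth_proj ?H (?w u) \<bullet> m u) / (m u \<bullet> m u)) *\<^sub>R m u"
      using u by simp_all
    then show "orth_proj ?H (?w u) = grad_HS G S \<phi> (f u)" by simp
  qed
  show "continuous_on (U \<inter> f -` {p. hor_normal_norm G S p \<noteq> 0}) (\<lambda>u. grad_HS G S \<phi> (f u))"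
  proof (rule continuous_on_locally)
    let ?A = "U \<inter> f -` {p. hor_normal_norm G S p \<noteq> 0}"
    fix u0 assume u0: "u0 \<in> ?A"
    then have "u0 \<in> U" by simp
    from loc [OF this] obtain W m where *: "openin (top_of_set U) W \<and> u0 \<in> W \<and> continuous_on W m \<and>
      (\<forall>u\<in>W. (m u = 0 \<longleftrightarrow> hor_normal_norm G S (f u) = 0) \<and>
        grad_HS G S \<phi> (f u) = orth_proj ?H (?w u) - ((orth_proj ?H (?w u) \<bullet> m u) / (m u \<bullet> m u)) *\<^sub>R m u)"
      by (elim exE)
    then have W: "openin (top_of_set U) W" "u0 \<in> W" "continuous_on W m"
      "\<And>u. u \<in> W \<Longrightarrow> m u = 0 \<longleftrightarrow> hor_normal_norm G S (f u) = 0"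
      "\<And>u. u \<in> W \<Longrightarrow> grad_HS G S \<phi> (f u) = orth_proj ?H (?w u) - ((orth_proj ?H (?w u) \<bullet> m u) / (m u \<bullet> m u)) *\<^sub>R m u"
      by simp_all
    have WU: "W \<subseteq> U" using W(1) by (rule openin_imp_subset)
    have "openin (top_of_set ?A) (?A \<inter> W)"
      using W(1) by (auto simp: openin_open)
    moreover have "continuous_on (?A \<inter> W) (\<lambda>u. orth_proj ?H (?w u) - ((orth_proj ?H (?w u) \<bullet> m u) / (m u \<bullet> m u)) *\<^sub>R m u)"
      by (intro continuous_on_diff continuous_on_scaleR continuous_on_divide continuous_on_inner
          continuous_on_subset [OF cw] continuous_on_subset [OF W(3)] ballI) (use W(4) WU in auto)
    then have "continuous_on (?A \<inter> W) (\<lambda>u. grad_HS G S \<phi> (f u))"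
      by (rule continuous_on_eq) (simp add: W(5))
    ultimately show "\<exists>W. openin (top_of_set ?A) W \<and> u0 \<in> W \<and> continuous_on W (\<lambda>u. grad_HS G S \<phi> (f u))"
      using u0 W(2) by blast
  qed
qed

end

context
  fixes S \<phi>
  assumes S: "submanifold G 1 (DIM('e) - 1) S" and \<phi>: "C1_fun G S \<phi>"
begin

lemma C_on_param: "local_param G 1 S D U f \<Longrightarrow> C_on 1 D (\<phi> \<circ> f) U"
  using \<phi> by (simp add: C1_fun_def)

lemma continuous_on_hor_normal_norm: "continuous_on S (hor_normal_norm G S)"
  by (rule continuous_on_param [OF S order_refl])
    (rule continuous_on_subset [OF continuous_on_hor_normal_norm_param], auto)

lemma continuous_on_tangential_grad: "continuous_on S (tangential_grad G S \<phi>)"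
  by (rule continuous_on_param [OF S order_refl])
    (rule continuous_on_subset [OF continuous_on_tangential_grad_param [OF _ C_on_param]], auto)

lemma borel_measurable_hor_normal_norm: "hor_normal_norm G S \<in> borel_measurable (restrict_space borel S)"
  by (rule borel_measurable_continuous_on_restrict [OF continuous_on_hor_normal_norm])

lemma borel_measurable_tangential_grad: "tangential_grad G S \<phi> \<in> borel_measurable (restrict_space borel S)"
  by (rule borel_measurable_continuous_on_restrict [OF continuous_on_tangential_grad])

lemma borel_measurable_grad_HS: "grad_HS G S \<phi> \<in> borel_measurable (restrict_space borel S)"
proof (rule borel_measurable_piecewise_continuous)
  let ?Z = "{p\<in>S. hor_normal_norm G S p = 0}"
  have "hor_normal_norm G S -` {0} \<inter> space (restrict_space borel S) \<in> sets (restrict_space borel S)"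
    by (rule measurable_sets [OF borel_measurable_hor_normal_norm]) simp
  moreover have "hor_normal_norm G S -` {0} \<inter> space (restrict_space borel S) = ?Z"
    by (auto simp: space_restrict_space)
  ultimately show "?Z \<in> sets (restrict_space borel S)" by simp
  show "continuous_on ?Z (grad_HS G S \<phi>)"
    by (rule continuous_on_param [OF S])
      (auto intro: continuous_on_subset [OF grad_HS_param_continuous(1) [OF _ _ C_on_param]])
  show "continuous_on (S - ?Z) (grad_HS G S \<phi>)"
    by (rule continuous_on_param [OF S])
      (auto intro: continuous_on_subset [OF grad_HS_param_continuous(2) [OF _ _ C_on_param]])
qed

end

end

section \<open>Level sets\<close>

context carnot_group
begin

definition adapted_param :: "'g set \<Rightarrow> ('g \<Rightarrow> real) \<Rightarrow> 'e set \<Rightarrow> 'e \<Rightarrow> 'e set \<Rightarrow> ('e \<Rightarrow> 'g) \<Rightarrow> bool" where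
  "adapted_param S \<phi> D b W F \<longleftrightarrow> local_param G 1 S D W F \<and> b \<in> D \<and> (\<forall>w\<in>W. \<phi> (F w) = w \<bullet> b)"

text \<open>The coordinate \<open>b\<close> is replaced by \<open>\<phi>\<close>. Injectivity of the new coordinates is Rolle's theorem
  on segments parallel to \<open>b\<close>, and openness is invariance of domain.\<close>

lemma straightening:
  fixes g :: "'e \<Rightarrow> real"
  assumes D: "D \<subseteq> Basis" "b \<in> D" and U: "openin (top_of_set (span D)) U" and u0: "u0 \<in> U"
    and g: "C_on 1 D g U" and nz: "frechet_derivative g (at u0 within U) b \<noteq> 0"
  obtains V \<Phi> \<Psi> \<Psi>' where "openin (top_of_set U) V" "u0 \<in> V" "openin (top_of_set (span D)) (\<Phi> ` V)"
    "homeomorphism V (\<Phi> ` V) \<Phi> \<Psi>" "\<And>u. u \<in> V \<Longrightarrow> \<Phi> u \<bullet> b = g u"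
    "\<And>u. u \<in> V \<Longrightarrow> frechet_derivative g (at u within U) b \<noteq> 0"
    "\<And>w. w \<in> \<Phi> ` V \<Longrightarrow> (\<Psi> has_derivative \<Psi>' w) (at w within \<Phi> ` V)"
    "\<And>w. range (\<Psi>' w) \<subseteq> span D" "\<And>w. w \<in> \<Phi> ` V \<Longrightarrow> inj_on (\<Psi>' w) (span D)"
    "\<And>w h. w \<in> \<Phi> ` V \<Longrightarrow> h \<in> D \<Longrightarrow>
      \<Psi>' w h = h + ((h \<bullet> b - frechet_derivative g (at (\<Psi> w) within U) h) / frechet_derivative g (at (\<Psi> w) within U) b) *\<^sub>R b"
proof -
  define p where "p u = frechet_derivative g (at u within U)" for u
  have der: "(g has_derivative p u) (at u within U)" if "u \<in> U" for u
    using g that unfolding C_on_1_iff differentiable_on_def p_def frechet_derivative_works [symmetric] by blast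
  have cont_g: "continuous_on U g"
    using g unfolding C_on_1_iff by (blast intro: differentiable_imp_continuous_on)
  have "continuous_on U (\<lambda>u. p u b)" using g D(2) unfolding C_on_1_iff p_def by blast
  then have "openin (top_of_set U) (U \<inter> (\<lambda>u. p u b) -` (- {0}))"
    by (rule continuous_openin_preimage_gen) auto
  then have "openin (top_of_set (span D)) (U \<inter> (\<lambda>u. p u b) -` (- {0}))"
    using U by (rule openin_trans)
  moreover have "u0 \<in> U \<inter> (\<lambda>u. p u b) -` (- {0})" using u0 nz by (simp add: p_def)
  \<comment> \<open>The intersection of a ball with \<open>span D\<close> is convex, so the segments
    on which Rolle's theorem is used stay in \<open>V\<close>, where the derivative in direction
    \<open>b\<close> is nonzero.\<close>
  ultimately obtain e where e: "e > 0" "ball u0 e \<inter> span D \<subseteq> U \<inter> (\<lambda>u. p u b) -` (- {0})"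
    unfolding openin_contains_ball by blast
  define V where "V = ball u0 e \<inter> span D"
  have VU: "V \<subseteq> U" and q: "\<And>u. u \<in> V \<Longrightarrow> p u b \<noteq> 0" using e(2) by (auto simp: V_def)
  have u0V: "u0 \<in> V" using u0 e(1) U openin_imp_subset by (auto simp: V_def)
  have V_open: "openin (top_of_set (span D)) V" by (auto simp: V_def openin_open)
  have V_openU: "openin (top_of_set U) V"
    using VU openin_imp_subset [OF U] by (intro openin_subset_trans [OF V_open]) auto
  have convex: "convex V" unfolding V_def by (intro convex_Int) (auto simp: subspace_imp_convex)
  have b_span: "b \<in> span D" using D(2) by (rule span_base)
  have bb: "b \<bullet> b = 1" using D by (auto simp: inner_Basis subset_iff)
  define \<Phi> where "\<Phi> u = u + (g u - u \<bullet> b) *\<^sub>R b" for u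
  define \<Phi>' where "\<Phi>' u h = h + (p u h - h \<bullet> b) *\<^sub>R b" for u h
  \<comment> \<open>\<open>\<Phi>'\<close> leaves all components but the one along \<open>b\<close>
    unchanged and makes that one equal to \<open>p u\<close>. Hence the preimage of \<open>h\<close>
    is \<open>h\<close> plus the multiple of \<open>b\<close> for which \<open>p u\<close> takes the
    value \<open>h \<bullet> b\<close>.\<close>
  define inv' where "inv' u h = h + ((h \<bullet> b - p u h) / p u b) *\<^sub>R b" for u h
  have \<Phi>b: "\<Phi> u \<bullet> b = g u" for u by (simp add: \<Phi>_def inner_add_left bb)
  have der_\<Phi>: "(\<Phi> has_derivative \<Phi>' u) (at u within V)" if "u \<in> V" for u
    unfolding \<Phi>_def [abs_def] \<Phi>'_def [abs_def]
    using has_derivative_subset [OF der VU] that VU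
    by (auto intro!: derivative_eq_intros)
  have lin_p: "linear (p u)" if "u \<in> V" for u using der that VU has_derivative_linear by blast
  have \<Phi>'_inv': "\<Phi>' u (inv' u h) = h" if "u \<in> V" for u h
  proof -
    have "p u (inv' u h) = p u h + ((h \<bullet> b - p u h) / p u b) * p u b"
      unfolding inv'_def by (simp add: linear_add [OF lin_p [OF that]] linear_scale [OF lin_p [OF that]])
    then have "p u (inv' u h) = h \<bullet> b" using q [OF that] by simp
    moreover have "inv' u h \<bullet> b = h \<bullet> b + (h \<bullet> b - p u h) / p u b"
      by (simp add: inv'_def inner_add_left bb)
    ultimately show ?thesis by (simp add: \<Phi>'_def inv'_def [of u h] scaleR_add_left [symmetric])
  qed
  have \<Phi>'_inj: "h = 0" if "u \<in> V" "\<Phi>' u h = 0" for u h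
  proof -
    have "h = - ((p u h - h \<bullet> b) *\<^sub>R b)"
      using that(2) by (simp add: \<Phi>'_def eq_neg_iff_add_eq_0)
    also have "\<dots> = (h \<bullet> b - p u h) *\<^sub>R b" by (simp add: scaleR_left_diff_distrib)
    finally have h: "h = (h \<bullet> b - p u h) *\<^sub>R b" .
    have "p u h = \<Phi>' u h \<bullet> b" by (simp add: \<Phi>'_def inner_add_left bb)
    then have 0: "p u h = 0" using that(2) by simp
    have "p u ((h \<bullet> b - p u h) *\<^sub>R b) = (h \<bullet> b - p u h) * p u b"
      by (simp add: linear_scale [OF lin_p [OF that(1)]])
    then have "(h \<bullet> b - p u h) * p u b = 0" using h 0 by simp
    then show "h = 0" using q [OF that(1)] h by simp
  qed
  have cont_\<Phi>: "continuous_on V \<Phi>"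
    unfolding \<Phi>_def [abs_def] by (intro continuous_intros continuous_on_subset [OF cont_g VU])
  have inj: "inj_on \<Phi> V"
  proof (rule inj_onI)
    fix u u' assume uu': "u \<in> V" "u' \<in> V" "\<Phi> u = \<Phi> u'"
    then have geq: "g u = g u'" using \<Phi>b by metis
    define r where "r = u' \<bullet> b - u \<bullet> b"
    \<comment> \<open>\<Phi> alters the coordinate along \<open>b\<close> only, so points with the
      same image differ by a multiple of \<open>b\<close>. Moreover \<open>g\<close> takes the same
      value at both, which is the hypothesis of Rolle's theorem.\<close>
    have u': "u' = u + r *\<^sub>R b"
      using uu'(3) geq by (simp add: \<Phi>_def r_def algebra_simps)
    define c where "c t = u + t *\<^sub>R (r *\<^sub>R b)" for t :: real
    have cV: "c t \<in> V" if "0 \<le> t" "t \<le> 1" for t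
    proof -
      have "c t = (1 - t) *\<^sub>R u + t *\<^sub>R u'" by (simp add: c_def u' algebra_simps)
      then show ?thesis using convexD_alt [OF convex uu'(1,2) that] by simp
    qed
    have "((\<lambda>t. g (c t)) has_real_derivative r * p (c t) b) (at t)" if t: "0 < t" "t < 1" for t
    proof -
      have "\<forall>\<^sub>F s in nhds t. s \<in> {0<..<1}" using t by (intro eventually_nhds_in_open) auto
      then have "\<forall>\<^sub>F s in nhds t. c s \<in> U"
        by (rule eventually_mono) (use cV VU in auto)
      moreover have "(c has_vector_derivative r *\<^sub>R b) (at t)"
        unfolding c_def [abs_def] by (auto intro!: derivative_eq_intros)
      ultimately have "((\<lambda>t. g (c t)) has_vector_derivative p (c t) (r *\<^sub>R b)) (at t)"
        using cV [of t] t VU by (intro has_vector_derivative_within_curve [OF der]) auto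
      then show ?thesis
        using linear_scale [OF lin_p [OF cV [of t]], of r b] t
        by (simp add: has_real_derivative_iff_has_vector_derivative)
    qed
    note dg = this
    have "continuous_on {0..1} (\<lambda>t. g (c t))"
      by (rule continuous_on_compose2 [OF cont_g]) (use cV VU in \<open>auto simp: c_def [abs_def] intro!: continuous_intros\<close>)
    then obtain z where z: "0 < z" "z < 1" "DERIV (\<lambda>t. g (c t)) z :> 0"
      using Rolle [of 0 1 "\<lambda>t. g (c t)"] dg geq by (auto simp: c_def u' real_differentiable_def)
    then have "r * p (c z) b = 0" using dg [of z] DERIV_unique by blast
    then show "u = u'" using q [OF cV [of z]] z u' by simp
  qed
  have \<Phi>_span: "\<Phi> u \<in> span D" if "u \<in> V" for u
    using that b_span unfolding \<Phi>_def V_def by (auto intro: span_add span_scale)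
  have open_map: "openin (top_of_set (span D)) (\<Phi> ` A)" if "openin (top_of_set V) A" for A
  proof (rule invariance_of_domain_subspaces)
    have AV: "A \<subseteq> V" using that by (rule openin_imp_subset)
    show "openin (top_of_set (span D)) A" using openin_trans [OF that V_open] .
    show "continuous_on A \<Phi>" "inj_on \<Phi> A" "\<Phi> \<in> A \<rightarrow> span D"
      using AV cont_\<Phi> inj \<Phi>_span by (auto intro: continuous_on_subset inj_on_subset)
  qed auto
  have \<Phi>V: "openin (top_of_set (span D)) (\<Phi> ` V)" by (rule open_map) simp
  have open_map': "openin (top_of_set (\<Phi> ` V)) (\<Phi> ` A)" if "openin (top_of_set V) A" for A
    using openin_imp_subset [OF that] openin_imp_subset [OF \<Phi>V]
    by (intro openin_subset_trans [OF open_map [OF that]]) auto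
  obtain \<Psi> where hom: "homeomorphism V (\<Phi> ` V) \<Phi> \<Psi>"
    using homeomorphism_injective_open_map [OF cont_\<Phi> refl inj open_map'] by blast
  have \<Psi>V: "\<Psi> w \<in> V" "\<Phi> (\<Psi> w) = w" if "w \<in> \<Phi> ` V" for w
    using hom that by (auto simp: homeomorphism_def)
  have "\<exists>\<Psi>'. (\<Psi> has_derivative \<Psi>') (at w within \<Phi> ` V) \<and> range \<Psi>' \<subseteq> span D" if w: "w \<in> \<Phi> ` V" for w
  proof -
    have cw: "continuous (at w within \<Phi> ` V) \<Psi>"
      using hom w by (auto simp: homeomorphism_def continuous_on_eq_continuous_within)
    have "((\<lambda>x. \<Phi> (\<Psi> x)) has_derivative (\<lambda>h. h)) (at w within \<Phi> ` V)"
      by (rule has_derivative_transform [OF w _ has_derivative_ident]) (simp add: \<Psi>V)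
    note id = this
    show ?thesis
    proof (rule has_derivative_of_lift [where f = \<Phi> and h = \<Psi> and a = w and A = "\<Phi> ` V" and U = V
          and E = "span D" and f' = "\<Phi>' (\<Psi> w)" and g' = "\<lambda>h. h"])
      show "(\<Phi> has_derivative \<Phi>' (\<Psi> w)) (at (\<Psi> w) within V)" by (rule der_\<Phi> [OF \<Psi>V(1) [OF w]])
      show "\<Psi> ` \<Phi> ` V \<subseteq> V" using \<Psi>V(1) by blast
      show "V \<subseteq> span D" by (simp add: V_def)
    qed (use \<Phi>'_inj [OF \<Psi>V(1) [OF w]] w cw id in blast)+
  qed
  then obtain \<Psi>' where \<Psi>': "\<And>w. w \<in> \<Phi> ` V \<Longrightarrow> (\<Psi> has_derivative \<Psi>' w) (at w within \<Phi> ` V)"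
    "\<And>w. w \<in> \<Phi> ` V \<Longrightarrow> range (\<Psi>' w) \<subseteq> span D" by metis
  have \<Phi>'\<Psi>': "\<Phi>' (\<Psi> w) (\<Psi>' w h) = h" if w: "w \<in> \<Phi> ` V" and h: "h \<in> span D" for w h
  proof -
    have "((\<lambda>x. \<Phi> (\<Psi> x)) has_derivative (\<lambda>h. \<Phi>' (\<Psi> w) (\<Psi>' w h))) (at w within \<Phi> ` V)"
      by (rule has_derivative_in_compose2 [OF der_\<Phi> _ w \<Psi>'(1) [OF w]]) (use \<Psi>V in auto)
    then have "((\<lambda>x. x) has_derivative (\<lambda>h. \<Phi>' (\<Psi> w) (\<Psi>' w h))) (at w within \<Phi> ` V)"
      by (rule has_derivative_transform [OF w, rotated]) (simp add: \<Psi>V)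
    from has_derivative_within_unique_on [OF this has_derivative_ident \<Phi>V w h] show ?thesis .
  qed
  have lin_\<Phi>': "\<Phi>' u (h - h') = \<Phi>' u h - \<Phi>' u h'" if "u \<in> V" for u h h'
    by (simp add: \<Phi>'_def linear_diff [OF lin_p [OF that]] inner_diff_left algebra_simps)
  \<comment> \<open>Off the image of \<open>V\<close> the derivative is set to 0, so that the range
    condition holds for every \<open>w\<close>.\<close>
  define \<Psi>'' where "\<Psi>'' w = (if w \<in> \<Phi> ` V then \<Psi>' w else (\<lambda>_. 0))" for w
  have eq: "\<Psi>'' w = \<Psi>' w" if "w \<in> \<Phi> ` V" for w using that by (simp add: \<Psi>''_def)
  have 1: "(\<Psi> has_derivative \<Psi>'' w) (at w within \<Phi> ` V)" if "w \<in> \<Phi> ` V" for w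
    unfolding eq [OF that] by (rule \<Psi>'(1) [OF that])
  have 2: "range (\<Psi>'' w) \<subseteq> span D" for w
    using \<Psi>'(2) [of w] by (cases "w \<in> \<Phi> ` V") (auto simp: \<Psi>''_def span_0)
  have 3: "inj_on (\<Psi>'' w) (span D)" if w: "w \<in> \<Phi> ` V" for w
    unfolding eq [OF w] using \<Phi>'\<Psi>' [OF w] by (intro inj_on_inverseI [of _ "\<Phi>' (\<Psi> w)"]) auto
  \<comment> \<open>This explicit form will yield continuous partial derivatives of the new
    parametrization.\<close>
  have 4: "\<Psi>'' w h = h + ((h \<bullet> b - p (\<Psi> w) h) / p (\<Psi> w) b) *\<^sub>R b" if w: "w \<in> \<Phi> ` V" and h: "h \<in> D" for w h
  proof -
    have "\<Phi>' (\<Psi> w) (\<Psi>' w h - inv' (\<Psi> w) h) = 0"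
      using \<Phi>'\<Psi>' [OF w span_base [OF h]] \<Phi>'_inv' [OF \<Psi>V(1) [OF w]] by (simp add: lin_\<Phi>' \<Psi>V(1) [OF w])
    then have "\<Psi>' w h - inv' (\<Psi> w) h = 0" by (rule \<Phi>'_inj [OF \<Psi>V(1) [OF w]])
    then show ?thesis by (simp add: inv'_def eq [OF w])
  qed
  show ?thesis
    by (rule that [OF V_openU u0V \<Phi>V hom \<Phi>b q [unfolded p_def] 1 2 3 4 [unfolded p_def]])
qed

text \<open>The new parametrization is \<open>f \<circ> \<Psi>\<close> with \<Psi> from
  \<open>straightening\<close>. The formula for \<open>\<Psi>'\<close> expresses its partial
  derivatives in charts by those of \<open>f\<close> and of \<open>\<phi> \<circ> f\<close>, so they
  are continuous; injectivity of \<open>\<Psi>'\<close> keeps the partial velocities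
  independent.\<close>

lemma ex_adapted_param:
  assumes P: "local_param G 1 S D U f" and \<phi>: "C_on 1 D (\<phi> \<circ> f) U" and u0: "u0 \<in> U" and b: "b \<in> D"
    and nz: "frechet_derivative (\<phi> \<circ> f) (at u0 within U) b \<noteq> 0"
  shows "\<exists>W F. adapted_param S \<phi> D b W F \<and> f u0 \<in> F ` W"
proof -
  note param = local_paramD [OF P]
  let ?p = "\<lambda>u. frechet_derivative (\<phi> \<circ> f) (at u within U)"
  obtain V \<Phi> \<Psi> \<Psi>' where V: "openin (top_of_set U) V" "u0 \<in> V" "openin (top_of_set (span D)) (\<Phi> ` V)"
    and hom: "homeomorphism V (\<Phi> ` V) \<Phi> \<Psi>" and \<Phi>b: "\<And>u. u \<in> V \<Longrightarrow> \<Phi> u \<bullet> b = (\<phi> \<circ> f) u"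
    and pV: "\<And>u. u \<in> V \<Longrightarrow> ?p u b \<noteq> 0"
    and \<Psi>': "\<And>w. w \<in> \<Phi> ` V \<Longrightarrow> (\<Psi> has_derivative \<Psi>' w) (at w within \<Phi> ` V)" "\<And>w. range (\<Psi>' w) \<subseteq> span D"
      "\<And>w. w \<in> \<Phi> ` V \<Longrightarrow> inj_on (\<Psi>' w) (span D)"
      "\<And>w h. w \<in> \<Phi> ` V \<Longrightarrow> h \<in> D \<Longrightarrow> \<Psi>' w h = h + ((h \<bullet> b - ?p (\<Psi> w) h) / ?p (\<Psi> w) b) *\<^sub>R b"
    by (rule straightening [OF param(1) b param(3) u0 \<phi> nz]) blast
  define W where "W = \<Phi> ` V"
  define F where "F w = f (\<Psi> w)" for w
  have VU: "V \<subseteq> U" using V(1) by (rule openin_imp_subset)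
  have \<Psi>V: "\<Psi> w \<in> V" "\<Phi> (\<Psi> w) = w" if "w \<in> W" for w
    using hom that by (auto simp: homeomorphism_def W_def)
  have \<Psi>W: "\<Psi> ` W = V" and \<Psi>\<Phi>: "\<And>u. u \<in> V \<Longrightarrow> \<Psi> (\<Phi> u) = u" and cont_\<Psi>: "continuous_on W \<Psi>"
    using hom by (auto simp: homeomorphism_def W_def)
  have FW: "F ` W = f ` V" unfolding F_def [abs_def] image_image [symmetric] \<Psi>W ..
  have W_open: "openin (top_of_set (span D)) W" using V(3) by (simp add: W_def)
  have der: "(\<Psi> has_derivative \<Psi>' w) (at w within W)" if "w \<in> W" for w
    using \<Psi>'(1) that by (simp add: W_def)
  have linear_\<Psi>': "linear (\<Psi>' w)" if "w \<in> W" for w using der [OF that] by (rule has_derivative_linear)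
  have velocity: "partial_velocity G F w h = velocity_map D f (\<Psi> w) (\<Psi>' w h)" if w: "w \<in> W" and h: "h \<in> D" for w h
  proof -
    have h': "h \<in> span D" using h by (rule span_base)
    have "((\<lambda>t. \<Psi> (w + t *\<^sub>R h)) has_vector_derivative \<Psi>' w h) (at 0)"
      by (rule has_vector_derivative_line [OF der [OF w] W_open w h'])
    moreover have "\<forall>\<^sub>F t in nhds 0. \<Psi> (w + t *\<^sub>R h) \<in> U"
      using eventually_line_in [OF W_open w h'] by (rule eventually_mono) (use \<Psi>V VU in auto)
    ultimately have "has_velocity G (\<lambda>t. F (w + t *\<^sub>R h)) (velocity_map D f (\<Psi> w) (\<Psi>' w h)) 0"
      using param_curve_velocity [OF P, of "\<lambda>t. \<Psi> (w + t *\<^sub>R h)" "\<Psi>' w h" 0] \<Psi>'(2)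
      by (auto simp: F_def velocity_map_def [OF P])
    then show ?thesis
      unfolding partial_velocity_def by (intro the_equality) (auto intro: has_velocity_unique)
  qed
  have "local_param G 1 S D W F"
    unfolding local_param_def
  proof (intro conjI ballI impI allI)
    show "D \<subseteq> Basis" "openin (top_of_set (span D)) W" using param(1) W_open by auto
    have fV: "openin (top_of_set (f ` U)) (f ` V)"
      by (rule homeomorphism_imp_open_map [OF param(7) V(1)])
    then show "openin (top_of_set S) (F ` W)" unfolding FW using param(5) by (rule openin_trans)
    have "homeomorphism W V \<Psi> \<Phi>" using homeomorphism_symD [OF hom] by (simp add: W_def)
    moreover have "homeomorphism V (f ` V) f (inv_into U f)"
      by (rule homeomorphism_of_subsets [OF param(7) VU]) (use VU param(8) in \<open>auto simp: inv_into_f_f\<close>)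
    ultimately have "homeomorphism W (f ` V) (f \<circ> \<Psi>) (\<Phi> \<circ> inv_into U f)"
      by (rule homeomorphism_compose)
    moreover have "f \<circ> \<Psi> = F" by (simp add: F_def fun_eq_iff)
    ultimately show "\<exists>h. homeomorphism W (F ` W) F h" unfolding FW by auto
  next
    fix c assume "c \<in> atlas G"
    obtain C y where c: "c = (C, y)" by (cases c)
    then have C: "(C, y) \<in> atlas G" using \<open>c \<in> atlas G\<close> by simp
    let ?A = "U \<inter> f -` C" and ?B = "W \<inter> F -` C"
    let ?d = "\<lambda>u. frechet_derivative (y \<circ> f) (at u within ?A)"
    have cont_F: "continuous_on W F"
      unfolding F_def using cont_\<Psi> \<Psi>V VU
      by (intro continuous_on_compose2 [OF param(9)]) auto
    have B: "openin (top_of_set (span D)) ?B"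
      using openin_trans [OF continuous_openin_preimage_gen [OF cont_F open_chart [OF C]] W_open] .
    have \<Psi>B: "\<Psi> ` ?B \<subseteq> ?A" using \<Psi>V VU by (auto simp: F_def)
    have cd: "continuous_on ?A (\<lambda>u. ?d u h)" if "h \<in> D" for h
      using param(10) [OF C] that unfolding C_on_1_iff by blast
    have cp: "continuous_on U (\<lambda>u. ?p u h)" if "h \<in> D" for h
      using \<phi> that unfolding C_on_1_iff by blast
    have cB: "continuous_on ?B (\<lambda>w. ?d (\<Psi> w) h)" "continuous_on ?B (\<lambda>w. ?p (\<Psi> w) h)" if "h \<in> D" for h
      using \<Psi>B by (auto intro!: continuous_on_compose2 [OF cd [OF that]] continuous_on_compose2 [OF cp [OF that]]
          continuous_on_subset [OF cont_\<Psi>])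
    have pnz: "?p (\<Psi> w) b \<noteq> 0" if "w \<in> W" for w using pV \<Psi>V(1) [OF that] .
    show "case c of (V, y) \<Rightarrow> C_on 1 D (y \<circ> F) (W \<inter> F -` V)"
      unfolding c prod.case
    proof (rule C_on_1I [OF B])
      fix w assume w: "w \<in> ?B"
      have dyf: "((\<lambda>u. y (f u)) has_derivative ?d u) (at u within ?A)" if "u \<in> ?A" for u
        using that by (intro param_derivative [OF P C]) auto
      have d\<Psi>: "(\<Psi> has_derivative \<Psi>' w) (at w within ?B)"
        using w by (intro has_derivative_subset [OF der]) auto
      have "y \<circ> F = (\<lambda>x. y (f (\<Psi> x)))" by (simp add: F_def fun_eq_iff)
      then show "(y \<circ> F has_derivative (\<lambda>h. ?d (\<Psi> w) (\<Psi>' w h))) (at w within ?B)"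
        using has_derivative_in_compose2 [OF dyf \<Psi>B w d\<Psi>] by simp
    next
      fix h assume h: "h \<in> D"
      have "continuous_on ?B (\<lambda>w. ?d (\<Psi> w) h + ((h \<bullet> b - ?p (\<Psi> w) h) / ?p (\<Psi> w) b) *\<^sub>R ?d (\<Psi> w) b)"
        by (intro continuous_on_add continuous_on_scaleR continuous_on_divide continuous_on_diff continuous_on_const
            cB h b ballI) (use pnz in auto)
      then show "continuous_on ?B (\<lambda>w. ?d (\<Psi> w) (\<Psi>' w h))"
      proof (rule continuous_on_eq)
        fix w assume w: "w \<in> ?B"
        then have lin: "linear (?d (\<Psi> w))"
          using \<Psi>B by (intro has_derivative_linear [OF param_derivative [OF P C]]) auto
        show "?d (\<Psi> w) h + ((h \<bullet> b - ?p (\<Psi> w) h) / ?p (\<Psi> w) b) *\<^sub>R ?d (\<Psi> w) b = ?d (\<Psi> w) (\<Psi>' w h)"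
          using w h \<Psi>'(4) by (simp add: W_def linear_add [OF lin] linear_scale [OF lin])
      qed
    qed
  next
    fix w c h
    assume w: "w \<in> W" and 0: "(\<Sum>b\<in>D. c b *\<^sub>R partial_velocity G F w b) = 0" and h: "h \<in> D"
    note linV = linear_velocity_map [OF P, of "\<Psi> w"]
    have "velocity_map D f (\<Psi> w) (\<Psi>' w (\<Sum>b\<in>D. c b *\<^sub>R b)) = (\<Sum>b\<in>D. c b *\<^sub>R partial_velocity G F w b)"
      by (simp add: velocity [OF w] linear_sum [OF linV] linear_scale [OF linV]
          linear_sum [OF linear_\<Psi>' [OF w]] linear_scale [OF linear_\<Psi>' [OF w]])
    also have "\<dots> = velocity_map D f (\<Psi> w) 0" using 0 linear_0 [OF linV] by simp
    finally have "\<Psi>' w (\<Sum>b\<in>D. c b *\<^sub>R b) = 0"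
      using inj_onD [OF inj_on_velocity_map [OF P, of "\<Psi> w"]] \<Psi>V(1) [OF w] VU \<Psi>'(2) span_0 by blast
    also have "0 = \<Psi>' w 0" using linear_0 [OF linear_\<Psi>' [OF w]] by simp
    finally have eq: "\<Psi>' w (\<Sum>b\<in>D. c b *\<^sub>R b) = \<Psi>' w 0" .
    have "(\<Sum>b\<in>D. c b *\<^sub>R b) \<in> span D" by (intro span_sum span_scale span_base)
    then have "(\<Sum>b\<in>D. c b *\<^sub>R b) = 0"
      using inj_onD [OF \<Psi>'(3) eq _ span_0] w by (simp add: W_def)
    then show "c h = 0" using inner_sum_coords [OF param(1) h, of c] by simp
  qed
  moreover have "\<phi> (F w) = w \<bullet> b" if "w \<in> W" for w
    using \<Phi>b [OF \<Psi>V(1) [OF that]] \<Psi>V(2) [OF that] by (simp add: F_def)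
  moreover have "f u0 \<in> F ` W" unfolding FW using V(2) by blast
  ultimately show ?thesis using b unfolding adapted_param_def by blast
qed

end

section \<open>Slices of an adapted parametrization\<close>

context carnot_group
begin

context
  fixes S \<phi> D b W F
  assumes A: "adapted_param S \<phi> D b W F"
begin

lemma adapted: "local_param G 1 S D W F" "b \<in> D" "\<And>w. w \<in> W \<Longrightarrow> \<phi> (F w) = w \<bullet> b"
  using A by (auto simp: adapted_param_def)

text \<open>In these coordinates \<phi> is the linear function \<open>w \<bullet> b\<close>, so its
  gradient is the tangent vector dual to the partial velocity along \<open>b\<close>.\<close>

lemma adapted_tangential_grad:
  assumes w: "w \<in> W"
  shows "tangential_grad G S \<phi> (F w) \<in> tangent_space G S (F w)"
    and "\<And>a. a \<in> D \<Longrightarrow> tangential_grad G S \<phi> (F w) \<bullet> partial_velocity G F w a = (if a = b then 1 else 0)"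
    and "tangential_grad G S \<phi> (F w) \<noteq> 0"
proof -
  have "((\<lambda>w. w \<bullet> b) has_derivative (\<lambda>h. h \<bullet> b)) (at w within W)"
    by (auto intro!: derivative_eq_intros)
  then have der: "((\<phi> \<circ> F) has_derivative (\<lambda>h. h \<bullet> b)) (at w within W)"
    by (rule has_derivative_transform [OF w, rotated]) (simp add: adapted(3))
  obtain v where v: "v \<in> tangent_space G S (F w)" "\<And>a. a \<in> D \<Longrightarrow> v \<bullet> partial_velocity G F w a = a \<bullet> b"
    using ex_dual_vector [OF adapted(1) w, of "\<lambda>a. a \<bullet> b"] by blast
  have eq: "tangential_grad G S \<phi> (F w) = v"
    by (rule tangential_grad_eqI [OF adapted(1) w der v])
  then show "tangential_grad G S \<phi> (F w) \<in> tangent_space G S (F w)" using v by simp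
  show *: "tangential_grad G S \<phi> (F w) \<bullet> partial_velocity G F w a = (if a = b then 1 else 0)" if "a \<in> D" for a
    using v(2) [OF that] that adapted(2) local_paramD(1) [OF adapted(1)] by (auto simp: eq inner_Basis subset_iff)
  show "tangential_grad G S \<phi> (F w) \<noteq> 0" using * [OF adapted(2)] by auto
qed

text \<open>By Cramer's rule \<open>|\<nabla>\<phi>|\<^sup>2\<close> is a diagonal entry of the inverse Gram matrix.\<close>

lemma coarea_factor:
  assumes w: "w \<in> W"
  shows "norm (tangential_grad G S \<phi> (F w)) * sqrt (gram_det G D F w) = sqrt (gram_det G (D - {b}) F w)"
proof -
  let ?g = "tangential_grad G S \<phi> (F w)"
  obtain c where c: "?g = (\<Sum>a\<in>D. c a *\<^sub>R partial_velocity G F w a)"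
    using adapted_tangential_grad(1) [OF w] unfolding tangent_space_param [OF adapted(1) w] by auto
  \<comment> \<open>The gradient pairs to 1 with the velocity along \<open>b\<close> and to 0 with
    the others, so its coefficients \<open>c\<close> form row \<open>b\<close> of the inverse Gram
    matrix. Pairing the gradient with itself shows that \<open>c b\<close> is its squared
    norm.\<close>
  have "c b * gram_det G D F w = gram_det G (D - {b}) F w"
    unfolding gram_det_def
  proof (rule det_on_cofactor [OF local_paramD(1) [OF adapted(1)] adapted(2)])
    fix j assume j: "j \<in> D"
    have "(\<Sum>i\<in>D. c i * (partial_velocity G F w i \<bullet> partial_velocity G F w j)) = ?g \<bullet> partial_velocity G F w j"
      by (simp add: c inner_sum_left)
    then show "(\<Sum>i\<in>D. c i * (partial_velocity G F w i \<bullet> partial_velocity G F w j)) = (if j = b then 1 else 0)"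
      using adapted_tangential_grad(2) [OF w j] by simp
  qed
  moreover have "(norm ?g)\<^sup>2 = c b"
  proof -
    have "(norm ?g)\<^sup>2 = ?g \<bullet> (\<Sum>a\<in>D. c a *\<^sub>R partial_velocity G F w a)"
      by (simp only: power2_norm_eq_inner c [symmetric])
    also have "\<dots> = (\<Sum>a\<in>D. c a * (if a = b then 1 else 0))"
      by (simp add: inner_sum_right adapted_tangential_grad(2) [OF w] cong: sum.cong)
    also have "\<dots> = c b" using local_paramD(2) [OF adapted(1)] adapted(2) by (simp add: if_distrib cong: if_cong)
    finally show ?thesis .
  qed
  ultimately have "sqrt ((norm ?g)\<^sup>2 * gram_det G D F w) = sqrt (gram_det G (D - {b}) F w)" by simp
  then show ?thesis by (simp add: real_sqrt_mult)
qed

definition slice_domain :: "real \<Rightarrow> 'e set" where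
  "slice_domain s = {t \<in> span (D - {b}). t + s *\<^sub>R b \<in> W}"

definition slice :: "real \<Rightarrow> 'e \<Rightarrow> 'g" where
  "slice s t = F (t + s *\<^sub>R b)"

lemma slice_inner:
  assumes "t \<in> span (D - {b})"
  shows "(t + s *\<^sub>R b) \<bullet> b = s"
proof -
  have "t \<bullet> b = 0"
    using assms adapted(2) local_paramD(1) [OF adapted(1)] unfolding span_substd_basis [OF subset_trans [OF Diff_subset local_paramD(1) [OF adapted(1)]]] by auto
  moreover have "b \<bullet> b = 1" using adapted(2) local_paramD(1) [OF adapted(1)] by (auto simp: inner_Basis subset_iff)
  ultimately show ?thesis by (simp add: inner_add_left)
qed

text \<open>A point of level \<open>s\<close> in the image of \<open>W\<close> automatically lies in
  the regular level set, because the gradient is nonzero throughout an adapted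
  parametrization.\<close>

lemma slice_image: "slice s ` slice_domain s = F ` W \<inter> regular_level G S \<phi> s"
proof (intro subset_antisym subsetI)
  fix p assume "p \<in> slice s ` slice_domain s"
  then obtain t where t: "t \<in> span (D - {b})" "t + s *\<^sub>R b \<in> W" "p = F (t + s *\<^sub>R b)"
    by (auto simp: slice_domain_def slice_def)
  then show "p \<in> F ` W \<inter> regular_level G S \<phi> s"
    using adapted(3) adapted_tangential_grad(3) local_paramD(6) [OF adapted(1)] slice_inner by (auto simp: regular_level_def)
next
  fix p assume "p \<in> F ` W \<inter> regular_level G S \<phi> s"
  then obtain w where w: "w \<in> W" "p = F w" "w \<bullet> b = s"
    using adapted(3) by (auto simp: regular_level_def)
  have "w - (w \<bullet> b) *\<^sub>R b = (\<Sum>a\<in>D - {b}. (w \<bullet> a) *\<^sub>R a)"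
    using span_coords_expansion [OF local_paramD(1) [OF adapted(1)], of w] local_paramD(2,4) [OF adapted(1)] w(1) adapted(2)
      sum.remove [of D b "\<lambda>a. (w \<bullet> a) *\<^sub>R a"] by (auto simp: algebra_simps)
  then have "w - s *\<^sub>R b \<in> span (D - {b})"
    using w(3) by (metis (no_types, lifting) span_base span_scale span_sum)
  then show "p \<in> slice s ` slice_domain s"
    using w by (intro image_eqI [of _ _ "w - s *\<^sub>R b"]) (auto simp: slice_def slice_domain_def)
qed

lemma partial_velocity_slice: "partial_velocity G (slice s) t a = partial_velocity G F (t + s *\<^sub>R b) a"
  unfolding partial_velocity_def slice_def by (simp add: add.assoc add.left_commute add.commute)

lemma gram_det_slice: "gram_det G D' (slice s) t = gram_det G D' F (t + s *\<^sub>R b)"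
  by (simp add: gram_det_def partial_velocity_slice)

text \<open>Everything is inherited from \<open>F\<close> through the translation by
  \<open>s *\<^sub>R b\<close>. A vanishing combination of the velocities of the slice is one of the
  velocities of \<open>F\<close> with coefficient 0 at \<open>b\<close>.\<close>

lemma local_param_slice: "local_param G 1 (regular_level G S \<phi> s) (D - {b}) (slice_domain s) (slice s)"
  unfolding local_param_def
proof (intro conjI ballI impI allI)
  let ?D' = "D - {b}" and ?W = "slice_domain s" and ?N = "regular_level G S \<phi> s"
  let ?i = "\<lambda>t. t + s *\<^sub>R b"
  have b_span: "b \<in> span D" using adapted(2) by (rule span_base)
  have iW: "?i ` ?W \<subseteq> W" by (auto simp: slice_domain_def)
  show "?D' \<subseteq> Basis" using local_paramD(1) [OF adapted(1)] by auto
  obtain T where T: "open T" "W = span D \<inter> T" using local_paramD(3) [OF adapted(1)] by (auto simp: openin_open)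
  have i_span: "?i t \<in> span D" if "t \<in> span ?D'" for t
    using that b_span span_mono [of ?D' D] by (auto intro: span_add span_scale)
  have "?W = span ?D' \<inter> ?i -` T"
    unfolding slice_domain_def using T(2) i_span by blast
  moreover have "open (?i -` T)" by (intro open_vimage T continuous_intros)
  ultimately show W_open: "openin (top_of_set (span ?D')) ?W" by (auto simp: openin_open)
  obtain T' where T': "open T'" "F ` W = S \<inter> T'" using local_paramD(5) [OF adapted(1)] by (auto simp: openin_open)
  have "slice s ` ?W = ?N \<inter> T'"
    unfolding slice_image T'(2) by (auto simp: regular_level_def)
  then show "openin (top_of_set ?N) (slice s ` ?W)" using T'(1) by (auto simp: openin_open)
  have cont: "continuous_on ?W (slice s)"
    unfolding slice_def [abs_def] using iW by (intro continuous_on_compose2 [OF local_paramD(9) [OF adapted(1)]] continuous_intros)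
  show "\<exists>h. homeomorphism ?W (slice s ` ?W) (slice s) h"
  proof (intro exI homeomorphismI)
    let ?h = "\<lambda>p. inv_into W F p - s *\<^sub>R b"
    have sub: "slice s ` ?W \<subseteq> F ` W" unfolding slice_image by blast
    have "continuous_on (F ` W) (inv_into W F)" using local_paramD(7) [OF adapted(1)] by (simp add: homeomorphism_def)
    then show "continuous_on (slice s ` ?W) ?h"
      by (intro continuous_intros continuous_on_subset [OF _ sub])
    show 1: "?h (slice s t) = t" if "t \<in> ?W" for t
      using that iW local_paramD(8) [OF adapted(1)] by (auto simp: slice_def slice_domain_def inv_into_f_f)
    then show "?h ` slice s ` ?W \<subseteq> ?W" by auto
    show "slice s (?h p) = p" if "p \<in> slice s ` ?W" for p
      using that sub by (auto simp: slice_def f_inv_into_f)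
  qed (use cont in auto)
next
  let ?D' = "D - {b}" and ?W = "slice_domain s"
  let ?i = "\<lambda>t. t + s *\<^sub>R b"
  fix c assume "c \<in> atlas G"
  obtain C y where c: "c = (C, y)" by (cases c)
  then have C: "(C, y) \<in> atlas G" using \<open>c \<in> atlas G\<close> by simp
  let ?A = "W \<inter> F -` C" and ?B = "?W \<inter> slice s -` C"
  let ?d = "\<lambda>w. frechet_derivative (y \<circ> F) (at w within ?A)"
  have iB: "?i ` ?B \<subseteq> ?A" by (auto simp: slice_domain_def slice_def)
  have b_span: "b \<in> span D" using adapted(2) by (rule span_base)
  obtain T where T: "open T" "?A = span D \<inter> T"
    using param_chart_domain(2) [OF adapted(1) C] by (auto simp: openin_open)
  have i_span: "?i t \<in> span D" if "t \<in> span ?D'" for t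
    using that b_span span_mono [of ?D' D] by (auto intro: span_add span_scale)
  have "?B = span ?D' \<inter> ?i -` ?A" by (auto simp: slice_domain_def slice_def)
  also have "\<dots> = span ?D' \<inter> ?i -` T" unfolding T(2) using i_span by auto
  finally have "?B = span ?D' \<inter> ?i -` T" .
  moreover have "open (?i -` T)" by (intro open_vimage T continuous_intros)
  ultimately have B: "openin (top_of_set (span ?D')) ?B" by (auto simp: openin_open)
  show "case c of (V, y) \<Rightarrow> C_on 1 ?D' (y \<circ> slice s) (?W \<inter> slice s -` V)"
    unfolding c prod.case
  proof (rule C_on_1I [OF B])
    fix t assume t: "t \<in> ?B"
    have dyF: "((\<lambda>w. y (F w)) has_derivative ?d w) (at w within ?A)" if "w \<in> ?A" for w
      using that by (intro param_derivative [OF adapted(1) C]) auto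
    have di: "(?i has_derivative (\<lambda>h. h)) (at t within ?B)" by (auto intro!: derivative_eq_intros)
    have "y \<circ> slice s = (\<lambda>t. y (F (?i t)))" by (simp add: slice_def fun_eq_iff)
    then show "(y \<circ> slice s has_derivative ?d (?i t)) (at t within ?B)"
      using has_derivative_in_compose2 [OF dyF iB t di] by simp
  next
    fix a assume "a \<in> ?D'"
    then have "continuous_on ?A (\<lambda>w. ?d w a)"
      using local_paramD(10) [OF adapted(1) C] unfolding C_on_1_iff by blast
    then show "continuous_on ?B (\<lambda>t. ?d (?i t) a)"
      using iB by (intro continuous_on_compose2 [of ?A "\<lambda>w. ?d w a" ?B ?i] continuous_intros) auto
  qed
next
  fix t c a
  assume t: "t \<in> slice_domain s" and a: "a \<in> D - {b}"
    and 0: "(\<Sum>a\<in>D - {b}. c a *\<^sub>R partial_velocity G (slice s) t a) = 0"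
  have "(\<Sum>a\<in>D. (if a = b then 0 else c a) *\<^sub>R partial_velocity G F (t + s *\<^sub>R b) a) =
      (\<Sum>a\<in>D - {b}. c a *\<^sub>R partial_velocity G (slice s) t a)"
    using local_paramD(2) [OF adapted(1)] by (intro sum.mono_neutral_cong_right) (auto simp: partial_velocity_slice)
  then have "(if a = b then 0 else c a) = 0"
    using t a 0 by (intro local_paramD(11) [OF adapted(1), of "t + s *\<^sub>R b"]) (auto simp: slice_domain_def)
  then show "c a = 0" using a by simp
qed

lemma HS_unit_normal_level:
  assumes w: "w \<in> W" "F w \<in> regular_level G S \<phi> s"
  shows "norm (grad_HS G S \<phi> (F w)) = norm (tangential_grad G S \<phi> (F w)) *
    norm (orth_proj (HS G S (F w)) (unit_normal G (tangent_space G S (F w)) (regular_level G S \<phi> s) (F w)))"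
proof -
  let ?T = "tangent_space G S (F w)" and ?N = "regular_level G S \<phi> s" and ?g = "tangential_grad G S \<phi> (F w)"
  let ?TN = "tangent_space G ?N (F w)" and ?\<eta> = "unit_normal G (tangent_space G S (F w)) (regular_level G S \<phi> s) (F w)"
  obtain t where t: "t \<in> slice_domain s" "F w = slice s t"
    using w slice_image [of s] by blast
  then have u: "t + s *\<^sub>R b \<in> W" "F w = F (t + s *\<^sub>R b)" by (auto simp: slice_domain_def slice_def)
  then have w_eq: "w = t + s *\<^sub>R b" using local_paramD(8) [OF adapted(1)] w(1) by (auto dest: inj_onD)
  note T = subspace_tangent_space [OF adapted(1) w(1)]
  note g = adapted_tangential_grad [OF w(1)]
  have TN: "subspace ?TN" unfolding t(2) by (rule subspace_tangent_space [OF local_param_slice t(1)])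
  have vel: "partial_velocity G F w a \<in> ?T" if "a \<in> D" for a
    by (rule partial_velocity_in_tangent_space [OF adapted(1) w(1) that])
  have TN_eq: "?TN = range (\<lambda>c. \<Sum>a\<in>D - {b}. c a *\<^sub>R partial_velocity G F w a)"
    using tangent_space_param [OF local_param_slice t(1)] unfolding t(2) [symmetric] partial_velocity_slice w_eq [symmetric] .
  have TN_T: "?TN \<subseteq> ?T"
    unfolding TN_eq using vel T by (auto intro!: subspace_sum subspace_scale)
  have g_TN: "?g \<bullet> v = 0" if "v \<in> ?TN" for v
    using that unfolding TN_eq by (auto simp: inner_sum_right g(2))
  \<comment> \<open>The normalized gradient is a witness for the choice in
    \<open>unit_normal\<close>, whose defining properties are therefore available.\<close>
  have "\<exists>\<nu>. \<nu> \<in> ?T \<and> norm \<nu> = 1 \<and> (\<forall>v\<in>?TN. \<nu> \<bullet> v = 0)"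
    using g(1,3) g_TN by (intro exI [of _ "?g /\<^sub>R norm ?g"]) (auto intro: subspace_scale [OF T])
  from someI_ex [OF this] have \<eta>: "?\<eta> \<in> ?T" "norm ?\<eta> = 1" "\<And>v. v \<in> ?TN \<Longrightarrow> ?\<eta> \<bullet> v = 0"
    by (auto simp: unit_normal_def)
  \<comment> \<open>The level set loses exactly the direction \<open>b\<close>, so its normals
    within the tangent space of \<open>S\<close> form a line. The gradient is thus a multiple of the
    chosen unit normal.\<close>
  have dim: "dim ?T = dim ?TN + 1"
    using dim_tangent_space [OF adapted(1) w(1)] dim_tangent_space [OF local_param_slice t(1)] t(2)
      local_paramD(2) [OF adapted(1)] adapted(2) card_Suc_Diff1 [of D b] by simp
  have eq: "?g = (?g \<bullet> ?\<eta>) *\<^sub>R ?\<eta>"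
    by (rule codim1_orthogonal [OF T TN TN_T dim \<eta> g(1) g_TN])
  have HS: "subspace (HS G S (F w))"
    unfolding HS_def by (rule subspace_inter [OF layer_subspace T])
  have "norm ?g = norm ((?g \<bullet> ?\<eta>) *\<^sub>R ?\<eta>)" by (rule arg_cong [OF eq])
  also have "\<dots> = \<bar>?g \<bullet> ?\<eta>\<bar>" by (simp add: \<eta>(2))
  finally have 1: "norm ?g = \<bar>?g \<bullet> ?\<eta>\<bar>" .
  have "grad_HS G S \<phi> (F w) = orth_proj (HS G S (F w)) ((?g \<bullet> ?\<eta>) *\<^sub>R ?\<eta>)"
    unfolding grad_HS_def by (rule arg_cong [OF eq])
  also have "\<dots> = (?g \<bullet> ?\<eta>) *\<^sub>R orth_proj (HS G S (F w)) ?\<eta>"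
    by (rule linear_scale [OF linear_orth_proj [OF HS]])
  finally show ?thesis by (simp add: 1)
qed

end

section \<open>Regular level sets as submanifolds\<close>

context
  fixes S \<phi>
  assumes S: "submanifold G 1 (DIM('e) - 1) S" and \<phi>: "C1_fun G S \<phi>"
begin

text \<open>If all partial derivatives of \<open>\<phi> \<circ> f\<close> vanished, the gradient
  would be a tangent vector orthogonal to every partial velocity, hence 0. So some coordinate
  direction is available for \<open>straightening\<close>.\<close>

lemma adapted_param_around:
  assumes p: "p \<in> S" "tangential_grad G S \<phi> p \<noteq> 0"
  shows "\<exists>D b W F. adapted_param S \<phi> D b W F \<and> card D = DIM('e) - 1 \<and> p \<in> F ` W"
proof -
  obtain D U f where P: "local_param G 1 S D U f" "card D = DIM('e) - 1" "p \<in> f ` U"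
    using S p(1) unfolding submanifold_def by blast
  then obtain u where u: "u \<in> U" "p = f u" by blast
  have C: "C_on 1 D (\<phi> \<circ> f) U" using \<phi> P(1) by (simp add: C1_fun_def)
  note T = subspace_tangent_space [OF P(1) u(1)]
  have "\<exists>b\<in>D. frechet_derivative (\<phi> \<circ> f) (at u within U) b \<noteq> 0"
  proof (rule ccontr)
    assume "\<not> (\<exists>b\<in>D. frechet_derivative (\<phi> \<circ> f) (at u within U) b \<noteq> 0)"
    then have "tangential_grad G S \<phi> (f u) \<bullet> v = 0 \<bullet> v" if "v \<in> tangent_space G S (f u)" for v
      using tangential_grad_param(2) [OF P(1) C u(1)] by (intro tangent_space_inner_eqI [OF P(1) u(1) that]) auto
    then have "tangential_grad G S \<phi> (f u) = 0"
      by (rule subspace_orthogonal_unique [OF T tangential_grad_param(1) [OF P(1) C u(1)] subspace_0 [OF T]])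
    then show False using p u by simp
  qed
  then show ?thesis using ex_adapted_param [OF P(1) C u(1)] P(2) u(2) by blast
qed

lemma submanifold_regular_level: "submanifold G 1 (DIM('e) - 2) (regular_level G S \<phi> s)"
  unfolding submanifold_def
proof
  fix p assume p: "p \<in> regular_level G S \<phi> s"
  then obtain D b W F where A: "adapted_param S \<phi> D b W F" "card D = DIM('e) - 1" "p \<in> F ` W"
    using adapted_param_around [of p] by (auto simp: regular_level_def)
  \<comment> \<open>The truncated difference is correct: for \<open>DIM('e) = 1\<close> the set
    \<open>D\<close> would be empty, so there is no \<open>b\<close> and no regular point.\<close>
  have "card (D - {b}) = DIM('e) - 2"
    using A(2) adapted(2) [OF A(1)] by (simp add: card_Diff_singleton)
  moreover have "p \<in> slice b F s ` slice_domain D b W s" using slice_image [OF A(1)] A(3) p by auto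
  ultimately show "\<exists>D U f. local_param G 1 (regular_level G S \<phi> s) D U f \<and> card D = DIM('e) - 2 \<and> p \<in> f ` U"
    using local_param_slice [OF A(1)] by blast
qed

end

end

section \<open>The Riemannian coarea formula\<close>

text \<open>\<open>lborel_on D\<close> is an image of a product measure under sums with terms in
  \<open>span D\<close>, so the integrands are compared there only. This matters for slices, whose
  domain is cut down to a span.\<close>

lemma nn_integral_lborel_on_cong:
  fixes D :: "'e::euclidean_space set"
  assumes D: "finite D" and g: "g \<in> borel_measurable borel" "g' \<in> borel_measurable borel"
    and eq: "\<And>u. u \<in> span D \<Longrightarrow> g u = g' u"
  shows "(\<integral>\<^sup>+u. g u \<partial>lborel_on D) = (\<integral>\<^sup>+u. g' u \<partial>lborel_on D)"
  unfolding nn_integral_lborel_on [OF D g(1)] nn_integral_lborel_on [OF D g(2)]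
  by (intro nn_integral_cong eq span_sum span_scale span_base)

lemma nn_integral_disjointed:
  assumes d: "\<And>n. d n \<in> sets M" "disjoint_family d" and h: "h \<in> borel_measurable M"
    and supp: "\<And>x. x \<in> space M \<Longrightarrow> h x \<noteq> 0 \<Longrightarrow> x \<in> (\<Union>n. d n)"
  shows "(\<integral>\<^sup>+x. h x \<partial>M) = (\<Sum>n. \<integral>\<^sup>+x. h x * indicator (d n) x \<partial>M)"
proof -
  have "(\<integral>\<^sup>+x. h x \<partial>M) = (\<integral>\<^sup>+x. (\<Sum>n. h x * indicator (d n) x) \<partial>M)"
  proof (intro nn_integral_cong)
    fix x assume x: "x \<in> space M"
    have "(\<Sum>n. h x * indicator (d n) x) = h x * indicator (\<Union>n. d n) x"
      using suminf_indicator [OF d(2), of x] by (simp add: ennreal_suminf_cmult)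
    then show "h x = (\<Sum>n. h x * indicator (d n) x)"
      using supp [OF x] by (auto simp: indicator_def)
  qed
  also have "\<dots> = (\<Sum>n. \<integral>\<^sup>+x. h x * indicator (d n) x \<partial>M)"
    using d(1) h by (intro nn_integral_suminf) auto
  finally show ?thesis .
qed

context carnot_group
begin

lemma borel_measurable_param_compose:
  assumes U: "U \<in> sets borel" and f: "continuous_on U f" "f ` U \<subseteq> N"
    and h: "(h :: 'g \<Rightarrow> ennreal) \<in> borel_measurable (restrict_space borel N)"
    and r: "continuous_on U (r :: 'e \<Rightarrow> real)"
  shows "(\<lambda>u. h (f u) * (ennreal (r u) * indicator U u)) \<in> borel_measurable borel"
proof -
  have "f \<in> restrict_space borel U \<rightarrow>\<^sub>M restrict_space borel N"
    using f(2) by (intro measurable_restrict_space2 borel_measurable_continuous_on_restrict [OF f(1)])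
      (auto simp: space_restrict_space)
  from measurable_compose [OF this h] have "(\<lambda>u. h (f u)) \<in> borel_measurable (restrict_space borel U)" .
  moreover have "(\<lambda>u. ennreal (r u)) \<in> borel_measurable (restrict_space borel U)"
    using borel_measurable_continuous_on_restrict [OF r] by measurable
  ultimately have "(\<lambda>u. h (f u) * ennreal (r u)) \<in> borel_measurable (restrict_space borel U)"
    by measurable
  then show ?thesis
    using U by (simp add: borel_measurable_restrict_space_iff_ennreal mult.assoc)
qed

context
  fixes S \<phi>
  assumes S: "submanifold G 1 (DIM('e) - 1) S" and \<phi>: "C1_fun G S \<phi>"
begin

lemma borel_measurable_level:
  assumes "h \<in> borel_measurable (restrict_space borel S)"
  shows "h \<in> borel_measurable (restrict_space borel (regular_level G S \<phi> s))"
  using measurable_restrict_mono [OF assms] by (auto simp: regular_level_def)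

lemma coarea_local:
  assumes A: "adapted_param S \<phi> D b W F" and card: "card D = DIM('e) - 1"
    and h: "(h :: 'g \<Rightarrow> ennreal) \<in> borel_measurable (restrict_space borel S)"
    and supp: "\<And>p. h p \<noteq> 0 \<Longrightarrow> p \<in> F ` W"
  shows "(\<lambda>s. \<integral>\<^sup>+p. h p \<partial>riem_measure G (DIM('e) - 2) (regular_level G S \<phi> s)) \<in> borel_measurable borel"
    and "(\<integral>\<^sup>+p. h p * ennreal (norm (tangential_grad G S \<phi> p)) \<partial>riem_measure G (DIM('e) - 1) S) =
      (\<integral>\<^sup>+s. (\<integral>\<^sup>+p. h p \<partial>riem_measure G (DIM('e) - 2) (regular_level G S \<phi> s)) \<partial>lborel)"
proof -
  note ad = adapted [OF A] and param = local_paramD [OF adapted(1) [OF A]]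
  let ?D' = "D - {b}" and ?N = "regular_level G S \<phi>" and ?w = "\<lambda>p. norm (tangential_grad G S \<phi> p)"
  have D: "D = insert b ?D'" using ad(2) by auto
  have fin: "finite ?D'" "b \<notin> ?D'" using param(2) by auto
  have W: "W \<in> sets borel" by (rule borel_param_domain [OF param(3)])
  have card': "card ?D' = DIM('e) - 2" using card ad(2) by (simp add: card_Diff_singleton)
  \<comment> \<open>\<open>g\<close> represents both sides: along each slice it is \<open>h\<close>
    times the volume density of the slice, and by \<open>coarea_factor\<close> it is
    \<open>h\<close> times the norm of the gradient times the volume density of
    \<open>S\<close>.\<close>
  define g where "g u = h (F u) * (ennreal (sqrt (gram_det G ?D' F u)) * indicator W u)" for u
  have cont: "continuous_on W (gram_det G ?D' F)"
    unfolding gram_det_def [abs_def]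
    by (intro continuous_on_det_on continuous_on_inner continuous_on_partial_velocity [OF ad(1)]) auto
  have g: "g \<in> borel_measurable borel"
    unfolding g_def [abs_def]
    by (rule borel_measurable_param_compose [OF W param(9,6) h continuous_on_real_sqrt [OF cont]])
  have level: "(\<integral>\<^sup>+p. h p \<partial>riem_measure G (DIM('e) - 2) (?N s)) = (\<integral>\<^sup>+t. g (t + s *\<^sub>R b) \<partial>lborel_on ?D')" for s
  proof -
    let ?\<mu> = "riem_measure G (DIM('e) - 2) (?N s)" and ?W = "slice_domain D b W s" and ?F = "slice b F s"
    note N = submanifold_regular_level [OF S \<phi>, of s]
    note P = local_param_slice [OF A, of s]
    note paramN = local_paramD [OF P]
    have hN: "h \<in> borel_measurable (restrict_space borel (?N s))" by (rule borel_measurable_level [OF h])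
    have "(\<integral>\<^sup>+p. h p \<partial>?\<mu>) = (\<integral>\<^sup>+p. h p * indicator (?F ` ?W) p \<partial>?\<mu>)"
    proof (intro nn_integral_cong)
      fix p assume "p \<in> space ?\<mu>"
      then have "p \<in> ?N s" by (simp only: space_riem_measure [OF N])
      then show "h p = h p * indicator (?F ` ?W) p"
        using supp [of p] slice_image [OF A, of s] by (auto simp: indicator_def)
    qed
    also have "\<dots> = (\<integral>\<^sup>+t. h (?F t) * param_density ?D' ?W ?F t \<partial>lborel_on ?D')"
      by (rule nn_integral_riem_measure [OF N P card' hN])
    also have "\<dots> = (\<integral>\<^sup>+t. g (t + s *\<^sub>R b) \<partial>lborel_on ?D')"
    proof (rule nn_integral_lborel_on_cong [OF fin(1)])
      show "(\<lambda>t. g (t + s *\<^sub>R b)) \<in> borel_measurable borel" using g by measurable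
      show "(\<lambda>t. h (?F t) * param_density ?D' ?W ?F t) \<in> borel_measurable borel"
        unfolding param_density_def
        by (rule borel_measurable_param_compose [OF borel_param_domain [OF paramN(3)] paramN(9,6) hN
              continuous_on_real_sqrt [OF continuous_on_gram_det [OF P]]])
      fix t assume "t \<in> span ?D'"
      then show "h (?F t) * param_density ?D' ?W ?F t = g (t + s *\<^sub>R b)"
        by (simp add: g_def param_density_def gram_det_slice [OF A] slice_def [OF A] slice_domain_def [OF A] indicator_def)
    qed
    finally show ?thesis .
  qed
  show "(\<lambda>s. \<integral>\<^sup>+p. h p \<partial>riem_measure G (DIM('e) - 2) (?N s)) \<in> borel_measurable borel"
    unfolding level by (rule lborel_on_insert(1) [OF fin g])
  have hw: "(\<lambda>p. h p * ennreal (?w p)) \<in> borel_measurable (restrict_space borel S)"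
    using h borel_measurable_tangential_grad [OF S \<phi>] by measurable
  have "(\<integral>\<^sup>+p. h p * ennreal (?w p) \<partial>riem_measure G (DIM('e) - 1) S) =
      (\<integral>\<^sup>+p. (h p * ennreal (?w p)) * indicator (F ` W) p \<partial>riem_measure G (DIM('e) - 1) S)"
    using supp by (intro nn_integral_cong) (auto simp: indicator_def)
  also have "\<dots> = (\<integral>\<^sup>+u. (h (F u) * ennreal (?w (F u))) * param_density D W F u \<partial>lborel_on D)"
    by (rule nn_integral_riem_measure [OF S ad(1) card hw])
  also have "\<dots> = (\<integral>\<^sup>+u. g u \<partial>lborel_on D)"
  proof (intro nn_integral_cong)
    fix u
    show "(h (F u) * ennreal (?w (F u))) * param_density D W F u = g u"
      using coarea_factor [OF A, of u]
      by (simp add: g_def param_density_def indicator_def mult.assoc ennreal_mult' [symmetric])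
  qed
  also have "\<dots> = (\<integral>\<^sup>+s. (\<integral>\<^sup>+t. g (t + s *\<^sub>R b) \<partial>lborel_on ?D') \<partial>lborel)"
    by (subst D) (rule lborel_on_insert(2) [OF fin g])
  finally show "(\<integral>\<^sup>+p. h p * ennreal (?w p) \<partial>riem_measure G (DIM('e) - 1) S) =
      (\<integral>\<^sup>+s. (\<integral>\<^sup>+p. h p \<partial>riem_measure G (DIM('e) - 2) (?N s)) \<partial>lborel)"
    by (simp only: level)
qed

text \<open>Only points with nonzero gradient matter: elsewhere the integrand on \<open>S\<close>
  vanishes, and the level measures live on regular points. Countably many adapted parametrizations
  cover these points, and \<open>h\<close> is split along disjoint pieces.\<close>

lemma coarea_riemannian:
  assumes h: "(h :: 'g \<Rightarrow> ennreal) \<in> borel_measurable (restrict_space borel S)"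
  shows "(\<lambda>s. \<integral>\<^sup>+p. h p \<partial>riem_measure G (DIM('e) - 2) (regular_level G S \<phi> s)) \<in> borel_measurable borel"
    and "(\<integral>\<^sup>+p. h p * ennreal (norm (tangential_grad G S \<phi> p)) \<partial>riem_measure G (DIM('e) - 1) S) =
      (\<integral>\<^sup>+s. (\<integral>\<^sup>+p. h p \<partial>riem_measure G (DIM('e) - 2) (regular_level G S \<phi> s)) \<partial>lborel)"
proof -
  let ?w = "\<lambda>p. norm (tangential_grad G S \<phi> p)"
  let ?\<sigma> = "\<lambda>s. riem_measure G (DIM('e) - 2) (regular_level G S \<phi> s)" and ?\<mu> = "riem_measure G (DIM('e) - 1) S"
  define R where "R = {p \<in> S. tangential_grad G S \<phi> p \<noteq> 0}"
  have "(\<lambda>s. \<integral>\<^sup>+p. h p \<partial>?\<sigma> s) \<in> borel_measurable borel \<and>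
      (\<integral>\<^sup>+p. h p * ennreal (?w p) \<partial>?\<mu>) = (\<integral>\<^sup>+s. (\<integral>\<^sup>+p. h p \<partial>?\<sigma> s) \<partial>lborel)"
  proof (cases "R = {}")
    case True
    then have "regular_level G S \<phi> s = {}" for s by (auto simp: R_def regular_level_def)
    then have "space (?\<sigma> s) = {}" for s
      using space_riem_measure [OF submanifold_regular_level [OF S \<phi>, of s]] by simp
    then have 0: "(\<integral>\<^sup>+p. h p \<partial>?\<sigma> s) = 0" for s by (rule nn_integral_empty)
    have "(\<integral>\<^sup>+p. h p * ennreal (?w p) \<partial>?\<mu>) = (\<integral>\<^sup>+p. 0 \<partial>?\<mu>)"
    proof (intro nn_integral_cong)
      fix p assume "p \<in> space ?\<mu>"
      then have "p \<in> S" by (simp only: space_riem_measure [OF S])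
      then show "h p * ennreal (?w p) = 0" using True by (auto simp: R_def)
    qed
    then show ?thesis by (simp add: 0)
  next
    case False
    let ?Q = "\<lambda>(D, b, W, F). adapted_param S \<phi> D b W F \<and> card D = DIM('e) - 1"
    let ?I = "\<lambda>(D, b, W, F). F ` W"
    obtain x where x: "\<And>n::nat. ?Q (x n)" "R \<subseteq> (\<Union>n. ?I (x n))"
    proof (rule countable_indexed_cover [of ?Q S ?I R])
      show "openin (top_of_set S) (?I x)" if "?Q x" for x
        using that local_paramD(5) [OF adapted(1)] by (auto split: prod.splits)
      show "\<exists>x. ?Q x \<and> p \<in> ?I x" if "p \<in> R" for p
        using adapted_param_around [OF S \<phi>, of p] that unfolding R_def by fast
    qed (use False in auto)
    define D where "D n = fst (x n)" for n
    define b where "b n = fst (snd (x n))" for n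
    define W where "W n = fst (snd (snd (x n)))" for n
    define F where "F n = snd (snd (snd (x n)))" for n
    have A: "adapted_param S \<phi> (D n) (b n) (W n) (F n)" "card (D n) = DIM('e) - 1" for n
      using x(1) [of n] by (auto simp: D_def b_def W_def F_def split: prod.splits)
    have R: "R \<subseteq> (\<Union>n. F n ` W n)" using x(2) by (simp add: W_def F_def case_prod_unfold)
    define d where "d = disjointed (\<lambda>n. F n ` W n)"
    have d_sub: "d n \<subseteq> F n ` W n" for n unfolding d_def by (rule disjointed_subset)
    have d_R: "R \<subseteq> (\<Union>n. d n)" using R unfolding d_def UN_disjointed_eq .
    have d_disj: "disjoint_family d" unfolding d_def by (rule disjoint_family_disjointed)
    have d: "d n \<in> sets (restrict_space borel S)" for n
      unfolding d_def using borel_openin [OF local_paramD(5) [OF adapted(1) [OF A(1)]]]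
      by (intro sets.range_disjointed_sets [THEN range_subsetD]) auto
    have hn: "(\<lambda>p. h p * indicator (d n) p) \<in> borel_measurable (restrict_space borel S)" for n
      using h d by measurable
    have supp: "p \<in> F n ` W n" if "h p * indicator (d n) p \<noteq> 0" for n p
      using that d_sub [of n] by (auto simp: indicator_def split: if_splits)
    have loc1: "(\<lambda>s. \<integral>\<^sup>+p. h p * indicator (d n) p \<partial>?\<sigma> s) \<in> borel_measurable borel" for n
      by (rule coarea_local(1) [OF A hn supp])
    have loc2: "(\<integral>\<^sup>+p. h p * indicator (d n) p * ennreal (?w p) \<partial>?\<mu>) =
        (\<integral>\<^sup>+s. (\<integral>\<^sup>+p. h p * indicator (d n) p \<partial>?\<sigma> s) \<partial>lborel)" for n
      by (rule coarea_local(2) [OF A hn supp])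
    have level: "(\<integral>\<^sup>+p. h p \<partial>?\<sigma> s) = (\<Sum>n. \<integral>\<^sup>+p. h p * indicator (d n) p \<partial>?\<sigma> s)" for s
    proof -
      note N = submanifold_regular_level [OF S \<phi>, of s]
      let ?d = "\<lambda>n. d n \<inter> regular_level G S \<phi> s"
      have "(\<integral>\<^sup>+p. h p \<partial>?\<sigma> s) = (\<Sum>n. \<integral>\<^sup>+p. h p * indicator (?d n) p \<partial>?\<sigma> s)"
      proof (rule nn_integral_disjointed)
        show "?d n \<in> sets (?\<sigma> s)" for n
        proof -
          obtain B where "B \<in> sets borel" "d n = S \<inter> B" using d [of n] by (auto simp: sets_restrict_space)
          then have "?d n = regular_level G S \<phi> s \<inter> B" "B \<in> sets borel" by (auto simp: regular_level_def)
          then show ?thesis by (simp add: sets_riem_measure [OF N] sets_restrict_space)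
        qed
        show "disjoint_family ?d" using d_disj by (auto simp: disjoint_family_on_def)
        show "h \<in> borel_measurable (?\<sigma> s)"
          using borel_measurable_level [OF h, of s] measurable_cong_sets [OF sets_riem_measure [OF N] refl] by blast
        show "p \<in> (\<Union>n. ?d n)" if "p \<in> space (?\<sigma> s)" for p
        proof -
          have p: "p \<in> regular_level G S \<phi> s" using that by (simp only: space_riem_measure [OF N])
          then have "p \<in> R" by (simp add: R_def regular_level_def)
          then obtain n where "p \<in> d n" using d_R by blast
          with p show ?thesis by blast
        qed
      qed
      also have "\<dots> = (\<Sum>n. \<integral>\<^sup>+p. h p * indicator (d n) p \<partial>?\<sigma> s)"
        by (intro suminf_cong nn_integral_cong) (auto simp: space_riem_measure [OF N] indicator_def simp del: One_nat_def)
      finally show ?thesis .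
    qed
    have "(\<integral>\<^sup>+p. h p * ennreal (?w p) \<partial>?\<mu>) = (\<Sum>n. \<integral>\<^sup>+p. h p * ennreal (?w p) * indicator (d n) p \<partial>?\<mu>)"
    proof (rule nn_integral_disjointed [OF _ d_disj])
      show "d n \<in> sets ?\<mu>" for n using d by (simp only: sets_riem_measure [OF S])
      have "(\<lambda>p. h p * ennreal (?w p)) \<in> borel_measurable (restrict_space borel S)"
        using h borel_measurable_tangential_grad [OF S \<phi>] by measurable
      then show "(\<lambda>p. h p * ennreal (?w p)) \<in> borel_measurable ?\<mu>"
        using measurable_cong_sets [OF sets_riem_measure [OF S] refl] by blast
      show "p \<in> (\<Union>n. d n)" if "p \<in> space ?\<mu>" "h p * ennreal (?w p) \<noteq> 0" for p
      proof -
        have "p \<in> S" using that(1) by (simp only: space_riem_measure [OF S])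
        then have "p \<in> R" using that(2) by (auto simp: R_def)
        then show ?thesis using d_R by blast
      qed
    qed
    also have "\<dots> = (\<Sum>n. \<integral>\<^sup>+p. (h p * indicator (d n) p) * ennreal (?w p) \<partial>?\<mu>)"
      by (simp add: mult_ac)
    also have "\<dots> = (\<Sum>n. \<integral>\<^sup>+s. (\<integral>\<^sup>+p. h p * indicator (d n) p \<partial>?\<sigma> s) \<partial>lborel)"
      by (simp only: loc2)
    also have "\<dots> = (\<integral>\<^sup>+s. (\<Sum>n. \<integral>\<^sup>+p. h p * indicator (d n) p \<partial>?\<sigma> s) \<partial>lborel)"
      using loc1 by (intro nn_integral_suminf [symmetric]) simp
    also have "\<dots> = (\<integral>\<^sup>+s. (\<integral>\<^sup>+p. h p \<partial>?\<sigma> s) \<partial>lborel)" by (simp only: level)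
    finally have 2: "(\<integral>\<^sup>+p. h p * ennreal (?w p) \<partial>?\<mu>) = (\<integral>\<^sup>+s. (\<integral>\<^sup>+p. h p \<partial>?\<sigma> s) \<partial>lborel)" .
    have "(\<lambda>s. \<integral>\<^sup>+p. h p \<partial>?\<sigma> s) \<in> borel_measurable borel"
      unfolding level using loc1 by measurable
    with 2 show ?thesis by blast
  qed
  then show "(\<lambda>s. \<integral>\<^sup>+p. h p \<partial>?\<sigma> s) \<in> borel_measurable borel"
    "(\<integral>\<^sup>+p. h p * ennreal (?w p) \<partial>?\<mu>) = (\<integral>\<^sup>+s. (\<integral>\<^sup>+p. h p \<partial>?\<sigma> s) \<partial>lborel)" by auto
qed

end

end

section \<open>Passage to the completed measures\<close>

text \<open>A preimage under \<open>f\<close> differs from the one under \<open>f'\<close> by a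
  subset of a null set. This serves for functions on the level sets and for inner integrals as
  functions of \<open>s\<close>.\<close>

lemma borel_measurable_completion_AE:
  fixes f f' :: "'a \<Rightarrow> 'b::topological_space"
  assumes f': "f' \<in> borel_measurable M" and eq: "AE x in M. f x = f' x"
  shows "f \<in> borel_measurable (completion M)"
proof (rule measurableI)
  fix B :: "'b set" assume B: "B \<in> sets borel"
  have A: "f' -` B \<inter> space M \<in> sets (completion M)"
    using measurable_sets [OF f' B] by (rule sets_completionI_sets)
  have ae: "AE x in completion M. x \<in> f' -` B \<inter> space M \<longleftrightarrow> x \<in> f -` B \<inter> space M"
    using AE_completion [OF eq] by (rule eventually_mono) auto
  have "f -` B \<inter> space M \<in> sets (completion M)"
    by (rule completion.in_sets_AE [OF ae A]) auto
  then show "f -` B \<inter> space (completion M) \<in> sets (completion M)" by simp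
qed simp

text \<open>A function with finite integral is finite almost everywhere, so \<open>enn2real\<close>
  loses nothing.\<close>

lemma integrable_enn2real:
  assumes g: "g \<in> borel_measurable N" and fin: "(\<integral>\<^sup>+x. g x \<partial>N) < \<infinity>"
  shows "integrable N (\<lambda>x. enn2real (g x))" "(\<integral>x. enn2real (g x) \<partial>N) = enn2real (\<integral>\<^sup>+x. g x \<partial>N)"
proof -
  have "AE x in N. g x \<noteq> \<infinity>" using nn_integral_PInf_AE [OF g] fin by auto
  then have eq: "(\<integral>\<^sup>+x. ennreal (enn2real (g x)) \<partial>N) = (\<integral>\<^sup>+x. g x \<partial>N)"
    by (intro nn_integral_cong_AE) (auto elim!: eventually_mono simp: ennreal_enn2real_if)
  show "integrable N (\<lambda>x. enn2real (g x))"
    using g fin by (intro integrableI_bounded) (auto simp: eq)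
  show "(\<integral>x. enn2real (g x) \<partial>N) = enn2real (\<integral>\<^sup>+x. g x \<partial>N)"
    using g by (subst integral_eq_nn_integral) (auto simp: eq)
qed

text \<open>A set that is null for the total measure is null for almost every \<open>K s\<close>; hence functions that
  are measurable only for the completion may be replaced by Borel ones.\<close>

locale disintegration =
  fixes M :: "'a measure" and K :: "real \<Rightarrow> 'a measure" and w :: "'a \<Rightarrow> real"
  assumes KM: "\<And>s. (\<lambda>x. x) \<in> K s \<rightarrow>\<^sub>M M"
    and w: "w \<in> borel_measurable M" "\<And>x. 0 \<le> w x"
    and meas: "\<And>h :: 'a \<Rightarrow> ennreal. h \<in> borel_measurable M \<Longrightarrow> (\<lambda>s. \<integral>\<^sup>+x. h x \<partial>K s) \<in> borel_measurable borel"
    and int: "\<And>h :: 'a \<Rightarrow> ennreal. h \<in> borel_measurable M \<Longrightarrow>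
      (\<integral>\<^sup>+x. h x * ennreal (w x) \<partial>M) = (\<integral>\<^sup>+s. (\<integral>\<^sup>+x. h x \<partial>K s) \<partial>lborel)"
begin

lemma AE_level:
  assumes "AE x in M. P x"
  shows "AE s in lborel. AE x in K s. P x"
proof -
  obtain N where N: "N \<in> sets M" "emeasure M N = 0" "\<And>x. x \<in> space M \<Longrightarrow> \<not> P x \<Longrightarrow> x \<in> N"
    using assms by (elim AE_E) blast
  have ind: "(indicator N :: 'a \<Rightarrow> ennreal) \<in> borel_measurable M" using N(1) by simp
  have "AE x in M. x \<notin> N" using N(1,2) by (intro AE_not_in) auto
  \<comment> \<open>Formula \<open>int\<close> is applied to the indicator of the null set
    \<open>N\<close>: the weighted integral is 0, so the masses of \<open>N\<close> under
    \<open>K s\<close> have integral 0 and vanish for almost every \<open>s\<close>.\<close>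
  then have "(\<integral>\<^sup>+x. indicator N x * ennreal (w x) \<partial>M) = (\<integral>\<^sup>+x. 0 \<partial>M)"
    by (intro nn_integral_cong_AE) (auto elim!: eventually_mono)
  then have "(\<integral>\<^sup>+s. (\<integral>\<^sup>+x. indicator N x \<partial>K s) \<partial>lborel) = 0" by (simp add: int [OF ind])
  then have "AE s in lborel. (\<integral>\<^sup>+x. indicator N x \<partial>K s) = 0"
    using meas [OF ind] by (subst (asm) nn_integral_0_iff_AE) auto
  then show ?thesis
  proof (rule eventually_mono)
    fix s assume 0: "(\<integral>\<^sup>+x. indicator N x \<partial>K s) = 0"
    have "(indicator N :: 'a \<Rightarrow> ennreal) \<in> borel_measurable (K s)"
      using measurable_compose [OF KM ind] .
    then have "AE x in K s. (indicator N x :: ennreal) = 0"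
      using 0 by (subst (asm) nn_integral_0_iff_AE) auto
    moreover have "AE x in K s. x \<in> space M"
      using measurable_space [OF KM] by (intro AE_I2) auto
    ultimately show "AE x in K s. P x"
      by eventually_elim (use N(3) in \<open>auto simp: indicator_def split: if_splits\<close>)
  qed
qed

lemma ex_borel:
  fixes f :: "'a \<Rightarrow> real"
  assumes f: "f \<in> borel_measurable (completion M)"
  obtains f' where "f' \<in> borel_measurable M" "AE x in M. f x = f' x"
    "AE s in lborel. AE x in K s. f x = f' x"
  using completion_ex_borel_measurable_real [OF f] AE_level by blast

lemma borel_measurable_level_completion:
  fixes f :: "'a \<Rightarrow> real"
  assumes f: "f \<in> borel_measurable (completion M)"
  shows "AE s in lborel. f \<in> borel_measurable (completion (K s))"
proof -
  obtain f' where f': "f' \<in> borel_measurable M" "AE s in lborel. AE x in K s. f x = f' x"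
    using ex_borel [OF f] by blast
  from f'(2) show ?thesis
    by (rule eventually_mono) (rule borel_measurable_completion_AE [OF measurable_compose [OF KM f'(1)]])
qed

text \<open>The inner integral agrees with a Borel function of \<open>s\<close> almost everywhere,
  whence Lebesgue measurability. \<open>f\<close> may change sign: \<open>ennreal\<close> truncates
  it to its positive part, and this commutes with multiplication by the nonnegative
  \<open>w\<close>.\<close>

lemma nn_integral_completion_level:
  fixes f :: "'a \<Rightarrow> real"
  assumes f: "f \<in> borel_measurable (completion M)"
  shows "(\<lambda>s. \<integral>\<^sup>+x. ennreal (f x) \<partial>completion (K s)) \<in> borel_measurable lebesgue"
    and "(\<integral>\<^sup>+x. ennreal (f x * w x) \<partial>completion M) =
      (\<integral>\<^sup>+s. (\<integral>\<^sup>+x. ennreal (f x) \<partial>completion (K s)) \<partial>lebesgue)"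
proof -
  obtain f' where f': "f' \<in> borel_measurable M" "AE x in M. f x = f' x" "AE s in lborel. AE x in K s. f x = f' x"
    using ex_borel [OF f] by blast
  have f'': "(\<lambda>x. ennreal (f' x)) \<in> borel_measurable M" using f'(1) by simp
  have eq: "AE s in lborel. (\<integral>\<^sup>+x. ennreal (f x) \<partial>completion (K s)) = (\<integral>\<^sup>+x. ennreal (f' x) \<partial>K s)"
    using f'(3)
  proof (rule eventually_mono)
    fix s assume "AE x in K s. f x = f' x"
    then show "(\<integral>\<^sup>+x. ennreal (f x) \<partial>completion (K s)) = (\<integral>\<^sup>+x. ennreal (f' x) \<partial>K s)"
      unfolding nn_integral_completion by (intro nn_integral_cong_AE) (auto elim!: eventually_mono)
  qed
  show "(\<lambda>s. \<integral>\<^sup>+x. ennreal (f x) \<partial>completion (K s)) \<in> borel_measurable lebesgue"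
    by (rule borel_measurable_completion_AE [OF _ eq]) (use meas [OF f''] in simp)
  have "(\<integral>\<^sup>+x. ennreal (f x * w x) \<partial>completion M) = (\<integral>\<^sup>+x. ennreal (f' x) * ennreal (w x) \<partial>M)"
    unfolding nn_integral_completion using f'(2) w(2)
    by (intro nn_integral_cong_AE) (auto elim!: eventually_mono simp: ennreal_mult'')
  also have "\<dots> = (\<integral>\<^sup>+s. (\<integral>\<^sup>+x. ennreal (f' x) \<partial>K s) \<partial>lborel)" by (rule int [OF f''])
  also have "\<dots> = (\<integral>\<^sup>+s. (\<integral>\<^sup>+x. ennreal (f x) \<partial>completion (K s)) \<partial>lebesgue)"
    unfolding nn_integral_completion [of lborel] using eq by (intro nn_integral_cong_AE) (auto elim!: eventually_mono)
  finally show "(\<integral>\<^sup>+x. ennreal (f x * w x) \<partial>completion M) =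
      (\<integral>\<^sup>+s. (\<integral>\<^sup>+x. ennreal (f x) \<partial>completion (K s)) \<partial>lebesgue)" .
qed

text \<open>\<open>nn_integral_completion_level\<close> is applied to \<open>f\<close> and to its
  negative. Integrability of the product with \<open>w\<close> makes both total integrals finite, so
  both inner integrals are finite for almost every \<open>s\<close> and may be subtracted.\<close>

lemma integral_completion_level:
  fixes f :: "'a \<Rightarrow> real"
  assumes f: "f \<in> borel_measurable (completion M)" and fw: "integrable (completion M) (\<lambda>x. f x * w x)"
  shows "AE s in lebesgue. integrable (completion (K s)) f"
    and "integrable lebesgue (\<lambda>s. \<integral>x. f x \<partial>completion (K s))"
    and "(\<integral>x. f x * w x \<partial>completion M) = (\<integral>s. (\<integral>x. f x \<partial>completion (K s)) \<partial>lebesgue)"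
proof -
  define P where "P s = (\<integral>\<^sup>+x. ennreal (f x) \<partial>completion (K s))" for s
  define Q where "Q s = (\<integral>\<^sup>+x. ennreal (- f x) \<partial>completion (K s))" for s
  have f_neg: "(\<lambda>x. - f x) \<in> borel_measurable (completion M)" using f by simp
  have P: "P \<in> borel_measurable lebesgue"
    "(\<integral>\<^sup>+s. P s \<partial>lebesgue) = (\<integral>\<^sup>+x. ennreal (f x * w x) \<partial>completion M)"
    unfolding P_def [abs_def] using nn_integral_completion_level [OF f] by simp_all
  have Q: "Q \<in> borel_measurable lebesgue"
    "(\<integral>\<^sup>+s. Q s \<partial>lebesgue) = (\<integral>\<^sup>+x. ennreal (- (f x * w x)) \<partial>completion M)"
    unfolding Q_def [abs_def] using nn_integral_completion_level [OF f_neg] by simp_all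
  have fin: "(\<integral>\<^sup>+s. P s \<partial>lebesgue) < \<infinity>" "(\<integral>\<^sup>+s. Q s \<partial>lebesgue) < \<infinity>"
    unfolding P(2) Q(2) using fw by (auto simp: real_integrable_def less_top)
  have "AE s in lebesgue. P s \<noteq> \<infinity>" "AE s in lebesgue. Q s \<noteq> \<infinity>"
    using nn_integral_PInf_AE [OF P(1)] nn_integral_PInf_AE [OF Q(1)] fin by auto
  moreover have "AE s in lebesgue. f \<in> borel_measurable (completion (K s))"
    by (rule AE_completion [OF borel_measurable_level_completion [OF f]])
  ultimately show int_f: "AE s in lebesgue. integrable (completion (K s)) f"
    by eventually_elim (simp add: P_def Q_def real_integrable_def)
  have eq: "AE s in lebesgue. enn2real (P s) - enn2real (Q s) = (\<integral>x. f x \<partial>completion (K s))"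
    using int_f by (rule eventually_mono) (simp add: real_lebesgue_integral_def P_def Q_def)
  note IP = integrable_enn2real [OF P(1) fin(1)] and IQ = integrable_enn2real [OF Q(1) fin(2)]
  have PQ: "integrable lebesgue (\<lambda>s. enn2real (P s) - enn2real (Q s))"
    using IP(1) IQ(1) by (rule Bochner_Integration.integrable_diff)
  \<comment> \<open>For exceptional \<open>s\<close> the inner integral need not be the difference
    of the two parts. Measurability comes from almost everywhere agreement with that
    difference.\<close>
  have meas: "(\<lambda>s. \<integral>x. f x \<partial>completion (K s)) \<in> borel_measurable lebesgue"
  proof -
    obtain g where g: "g \<in> borel_measurable lborel" "AE s in lborel. enn2real (P s) - enn2real (Q s) = g s"
      using completion_ex_borel_measurable_real [OF borel_measurable_integrable [OF PQ]] by blast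
    have "AE s in lborel. (\<integral>x. f x \<partial>completion (K s)) = g s"
      using g(2) eq [unfolded AE_completion_iff] by eventually_elim simp
    then show ?thesis by (rule borel_measurable_completion_AE [OF g(1)])
  qed
  show "integrable lebesgue (\<lambda>s. \<integral>x. f x \<partial>completion (K s))"
    using PQ meas eq by (rule integrable_cong_AE_imp)
  have "(\<integral>x. f x * w x \<partial>completion M) = enn2real (\<integral>\<^sup>+s. P s \<partial>lebesgue) - enn2real (\<integral>\<^sup>+s. Q s \<partial>lebesgue)"
    unfolding P(2) Q(2) by (rule real_lebesgue_integral_def [OF fw])
  also have "\<dots> = (\<integral>s. enn2real (P s) - enn2real (Q s) \<partial>lebesgue)"
    using IP IQ by (simp add: Bochner_Integration.integral_diff)
  also have "\<dots> = (\<integral>s. (\<integral>x. f x \<partial>completion (K s)) \<partial>lebesgue)"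
    using eq meas borel_measurable_integrable [OF PQ] by (intro integral_cong_AE) auto
  finally show "(\<integral>x. f x * w x \<partial>completion M) = (\<integral>s. (\<integral>x. f x \<partial>completion (K s)) \<partial>lebesgue)" .
qed

end

section \<open>Disintegration of the horizontal measure\<close>

context carnot_group
begin

lemma disintegration_horizontal:
  assumes S: "submanifold G 1 (DIM('e) - 1) S" and \<phi>: "C1_fun G S \<phi>"
  defines "M \<equiv> density (riem_measure G (DIM('e) - 1) S) (\<lambda>p. ennreal (hor_normal_norm G S p))"
    and "K \<equiv> \<lambda>s. density (riem_measure G (DIM('e) - 2) (regular_level G S \<phi> s))
      (\<lambda>p. ennreal (hor_normal_norm G S p *
        norm (orth_proj (HS G S p) (unit_normal G (tangent_space G S p) (regular_level G S \<phi> s) p))))"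
  shows "disintegration M K (\<lambda>p. norm (grad_HS G S \<phi> p))"
proof -
  let ?\<mu> = "riem_measure G (DIM('e) - 1) S" and ?\<sigma> = "\<lambda>s. riem_measure G (DIM('e) - 2) (regular_level G S \<phi> s)"
  let ?h = "hor_normal_norm G S" and ?g = "\<lambda>p. norm (tangential_grad G S \<phi> p)" and ?w = "\<lambda>p. norm (grad_HS G S \<phi> p)"
  let ?R = "restrict_space borel S"
  note N = submanifold_regular_level [OF S \<phi>]
  note [measurable] = borel_measurable_hor_normal_norm [OF S \<phi>] borel_measurable_tangential_grad [OF S \<phi>]
    borel_measurable_grad_HS [OF S \<phi>]
  have M_iff: "f \<in> borel_measurable M \<longleftrightarrow> f \<in> borel_measurable ?R" for f :: "'g \<Rightarrow> 'z::topological_space"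
    unfolding M_def using measurable_cong_sets [OF sets_riem_measure [OF S] refl] by auto
  \<comment> \<open>\<open>k\<close> is the density of the level measures written without the level
    and without a choice of normal, hence a single Borel function on \<open>S\<close>. The density
    that involves \<open>unit_normal\<close> is measurable because it agrees with \<open>k\<close>
    on the level set.\<close>
  define k where "k p = ennreal (?h p * (?w p / ?g p))" for p
  have k: "k \<in> borel_measurable ?R" unfolding k_def [abs_def] by measurable
  have \<sigma>_level: "f \<in> borel_measurable (?\<sigma> s)" if "f \<in> borel_measurable ?R" for f :: "'g \<Rightarrow> ennreal" and s
    using borel_measurable_level [OF S \<phi> that] measurable_cong_sets [OF sets_riem_measure [OF N] refl] by blast
  have hor: "0 \<le> ?h p" for p by (simp add: hor_normal_norm_def)
  have K: "K s = density (?\<sigma> s) k" for s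
  proof -
    let ?k' = "\<lambda>p. ennreal (?h p * norm (orth_proj (HS G S p) (unit_normal G (tangent_space G S p) (regular_level G S \<phi> s) p)))"
    have eq: "?k' p = k p" if "p \<in> space (?\<sigma> s)" for p
    proof -
      have p: "p \<in> regular_level G S \<phi> s" using that by (simp only: space_riem_measure [OF N])
      then obtain D b W F where A: "adapted_param S \<phi> D b W F" "p \<in> F ` W"
        using adapted_param_around [OF S \<phi>, of p] by (auto simp: regular_level_def)
      then obtain u where u: "u \<in> W" "p = F u" by blast
      have "?w p = ?g p * norm (orth_proj (HS G S p) (unit_normal G (tangent_space G S p) (regular_level G S \<phi> s) p))"
        unfolding u(2) using p u by (intro HS_unit_normal_level [OF A(1)]) auto
      moreover have "?g p \<noteq> 0" using p by (simp add: regular_level_def)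
      ultimately show ?thesis by (simp add: k_def)
    qed
    have k': "?k' \<in> borel_measurable (?\<sigma> s)"
      using \<sigma>_level [OF k] by (subst measurable_cong [OF eq])
    show ?thesis
      unfolding K_def using k' \<sigma>_level [OF k] eq by (intro density_cong AE_I2) auto
  qed
  have main: "(\<integral>\<^sup>+p. f p \<partial>K s) = (\<integral>\<^sup>+p. k p * f p \<partial>?\<sigma> s)" if "f \<in> borel_measurable ?R" for f s
    unfolding K by (rule nn_integral_density [OF \<sigma>_level [OF k] \<sigma>_level [OF that]])
  show ?thesis
  proof
    show "(\<lambda>x. x) \<in> K s \<rightarrow>\<^sub>M M" for s
    proof (rule measurableI)
      show "x \<in> space M" if "x \<in> space (K s)" for x
        using that by (simp add: K M_def space_riem_measure [OF N] space_riem_measure [OF S] del: One_nat_def)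
          (simp add: regular_level_def)
      fix A assume "A \<in> sets M"
      then obtain B where B: "B \<in> sets borel" "A = S \<inter> B"
        by (auto simp: M_def sets_riem_measure [OF S] sets_restrict_space simp del: One_nat_def)
      have "(\<lambda>x. x) -` A \<inter> space (K s) = regular_level G S \<phi> s \<inter> B"
        using B(2) by (simp add: K space_riem_measure [OF N]) (auto simp: regular_level_def)
      then show "(\<lambda>x. x) -` A \<inter> space (K s) \<in> sets (K s)"
        using B(1) by (simp add: K sets_riem_measure [OF N] sets_restrict_space)
    qed
    show "?w \<in> borel_measurable M" unfolding M_iff by measurable
    show "0 \<le> ?w x" for x by simp
    fix f :: "'g \<Rightarrow> ennreal" assume "f \<in> borel_measurable M"
    then have f: "f \<in> borel_measurable ?R" by (simp only: M_iff)
    have kf: "(\<lambda>p. k p * f p) \<in> borel_measurable ?R" using k f by measurable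
    show "(\<lambda>s. \<integral>\<^sup>+p. f p \<partial>K s) \<in> borel_measurable borel"
      unfolding main [OF f] by (rule coarea_riemannian(1) [OF S \<phi> kf])
    have f\<mu>: "f \<in> borel_measurable ?\<mu>" "(\<lambda>p. ennreal (?h p)) \<in> borel_measurable ?\<mu>" "(\<lambda>p. ennreal (?w p)) \<in> borel_measurable ?\<mu>"
      using f by (simp_all add: measurable_cong_sets [OF sets_riem_measure [OF S] refl] del: One_nat_def)
    have "(\<integral>\<^sup>+p. f p * ennreal (?w p) \<partial>M) = (\<integral>\<^sup>+p. ennreal (?h p) * (f p * ennreal (?w p)) \<partial>?\<mu>)"
      unfolding M_def using f\<mu> by (intro nn_integral_density) auto
    also have "\<dots> = (\<integral>\<^sup>+p. k p * f p * ennreal (?g p) \<partial>?\<mu>)"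
    proof (intro nn_integral_cong)
      fix p assume "p \<in> space ?\<mu>"
      then have p: "p \<in> S" by (simp only: space_riem_measure [OF S])
      \<comment> \<open>Where the gradient vanishes, so does its projection, while the quotient in
        \<open>k\<close> is 0 by the convention for division. So multiplying the quotient by the
        norm of the gradient gives back \<open>?w p\<close> at every point.\<close>
      have "?w p = 0" if "?g p = 0"
      proof -
        obtain D U f u where P: "local_param G 1 S D U f" "u \<in> U" "p = f u"
          using S p unfolding submanifold_def by blast
        have "subspace (HS G S p)"
          unfolding HS_def P(3) by (rule subspace_inter [OF layer_subspace subspace_tangent_space [OF P(1,2)]])
        then show ?thesis using that by (simp add: grad_HS_def linear_0 [OF linear_orth_proj])
      qed
      then have eq: "?h p * (?w p / ?g p) * ?g p = ?h p * ?w p" by simp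
      have "k p * ennreal (?g p) = ennreal (?h p) * ennreal (?w p)"
        by (simp only: k_def ennreal_mult'' [OF norm_ge_zero, symmetric] eq)
      then show "ennreal (?h p) * (f p * ennreal (?w p)) = k p * f p * ennreal (?g p)"
        by (metis mult.assoc mult.commute)
    qed
    also have "\<dots> = (\<integral>\<^sup>+s. (\<integral>\<^sup>+p. k p * f p \<partial>?\<sigma> s) \<partial>lborel)"
      by (rule coarea_riemannian(2) [OF S \<phi> kf])
    also have "\<dots> = (\<integral>\<^sup>+s. (\<integral>\<^sup>+p. f p \<partial>K s) \<partial>lborel)" by (simp only: main [OF f])
    finally show "(\<integral>\<^sup>+p. f p * ennreal (?w p) \<partial>M) = (\<integral>\<^sup>+s. (\<integral>\<^sup>+p. f p \<partial>K s) \<partial>lborel)" .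
  qed
qed

end

theorem theorem4p2:
  fixes G :: "('g::{t2_space, second_countable_topology}, 'e::euclidean_space) carnot"
    and S :: "'g set" and \<phi> :: "'g \<Rightarrow> real"
  assumes "carnot_group G"
    and "submanifold G 2 (DIM('e) - 1) S"
    and "C1_fun G S \<phi>"
  shows
    "(\<lambda>s. emeasure (sigma_H_level G S \<phi> s) (regular_level G S \<phi> s)) \<in> borel_measurable lebesgue \<and>
     (\<integral>\<^sup>+p. ennreal (norm (grad_HS G S \<phi> p)) \<partial>sigma_H_hypersurface G S) =
       (\<integral>\<^sup>+s. emeasure (sigma_H_level G S \<phi> s) (regular_level G S \<phi> s) \<partial>lebesgue) \<and>
     (\<forall>\<psi> :: 'g \<Rightarrow> real. integrable (sigma_H_hypersurface G S) \<psi> \<longrightarrow>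
        (\<lambda>s. \<integral>\<^sup>+p. ennreal (\<psi> p) \<partial>sigma_H_level G S \<phi> s) \<in> borel_measurable lebesgue \<and>
        (\<integral>\<^sup>+p. ennreal (\<psi> p * norm (grad_HS G S \<phi> p)) \<partial>sigma_H_hypersurface G S) =
          (\<integral>\<^sup>+s. (\<integral>\<^sup>+p. ennreal (\<psi> p) \<partial>sigma_H_level G S \<phi> s) \<partial>lebesgue) \<and>
        (integrable (sigma_H_hypersurface G S) (\<lambda>p. \<psi> p * norm (grad_HS G S \<phi> p)) \<longrightarrow>
          (AE s in lebesgue. integrable (sigma_H_level G S \<phi> s) \<psi>) \<and>
          integrable lebesgue (\<lambda>s. \<integral>p. \<psi> p \<partial>sigma_H_level G S \<phi> s) \<and>
          (\<integral>p. \<psi> p * norm (grad_HS G S \<phi> p) \<partial>sigma_H_hypersurface G S) =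
            (\<integral>s. (\<integral>p. \<psi> p \<partial>sigma_H_level G S \<phi> s) \<partial>lebesgue)))"
proof -
  interpret carnot_group G by fact
  have S: "submanifold G 1 (DIM('e) - 1) S" using assms(2) by (rule submanifold_2_imp_1)
  interpret disintegration
    "density (riem_measure G (DIM('e) - 1) S) (\<lambda>p. ennreal (hor_normal_norm G S p))"
    "\<lambda>s. density (riem_measure G (DIM('e) - 2) (regular_level G S \<phi> s))
      (\<lambda>p. ennreal (hor_normal_norm G S p *
        norm (orth_proj (HS G S p) (unit_normal G (tangent_space G S p) (regular_level G S \<phi> s) p))))"
    "\<lambda>p. norm (grad_HS G S \<phi> p)"
    by (rule disintegration_horizontal [OF S assms(3)])
  note folds = sigma_H_hypersurface_def [of G S, symmetric] sigma_H_codim2_def [of G S, symmetric]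
  note nn = nn_integral_completion_level [unfolded folds]
    and int = integral_completion_level [unfolded folds]
  have space: "space (sigma_H_level G S \<phi> s) = regular_level G S \<phi> s" for s
    by (simp add: sigma_H_codim2_def space_riem_measure [OF submanifold_regular_level [OF S assms(3)]])
  \<comment> \<open>The first formula is the weighted one for the constant 1. It uses the version
    for nonnegative integrals, which asks for measurability only, as 1 need not be integrable on
    \<open>S\<close>.\<close>
  have one: "emeasure (sigma_H_level G S \<phi> s) (regular_level G S \<phi> s) =
      (\<integral>\<^sup>+p. ennreal 1 \<partial>sigma_H_level G S \<phi> s)" for s
    by (simp add: space)
  have const: "(\<lambda>_. 1 :: real) \<in> borel_measurable (sigma_H_hypersurface G S)" by simp
  show ?thesis
  proof (intro conjI allI impI)
    show "(\<lambda>s. emeasure (sigma_H_level G S \<phi> s) (regular_level G S \<phi> s)) \<in> borel_measurable lebesgue"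
      unfolding one by (rule nn(1) [OF const])
    show "(\<integral>\<^sup>+p. ennreal (norm (grad_HS G S \<phi> p)) \<partial>sigma_H_hypersurface G S) =
        (\<integral>\<^sup>+s. emeasure (sigma_H_level G S \<phi> s) (regular_level G S \<phi> s) \<partial>lebesgue)"
      unfolding one using nn(2) [OF const] by simp
    fix \<psi> :: "'g \<Rightarrow> real"
    assume "integrable (sigma_H_hypersurface G S) \<psi>"
    then have \<psi>: "\<psi> \<in> borel_measurable (sigma_H_hypersurface G S)" by (rule borel_measurable_integrable)
    show "(\<lambda>s. \<integral>\<^sup>+p. ennreal (\<psi> p) \<partial>sigma_H_level G S \<phi> s) \<in> borel_measurable lebesgue"
      by (rule nn(1) [OF \<psi>])
    show "(\<integral>\<^sup>+p. ennreal (\<psi> p * norm (grad_HS G S \<phi> p)) \<partial>sigma_H_hypersurface G S) =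
        (\<integral>\<^sup>+s. (\<integral>\<^sup>+p. ennreal (\<psi> p) \<partial>sigma_H_level G S \<phi> s) \<partial>lebesgue)"
      by (rule nn(2) [OF \<psi>])
    \<comment> \<open>Integrability of \<psi> does not bound its product with the norm of
      \<open>grad_HS\<close>, which may be unbounded. Bochner integrals are therefore compared under
      this assumption, whereas the nonnegative version holds for every \<psi> considered.\<close>
    assume fw: "integrable (sigma_H_hypersurface G S) (\<lambda>p. \<psi> p * norm (grad_HS G S \<phi> p))"
    show "AE s in lebesgue. integrable (sigma_H_level G S \<phi> s) \<psi>"
      by (rule int(1) [OF \<psi> fw])
    show "integrable lebesgue (\<lambda>s. \<integral>p. \<psi> p \<partial>sigma_H_level G S \<phi> s)"
      by (rule int(2) [OF \<psi> fw])
    show "(\<integral>p. \<psi> p * norm (grad_HS G S \<phi> p) \<partial>sigma_H_hypersurface G S) =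
        (\<integral>s. (\<integral>p. \<psi> p \<partial>sigma_H_level G S \<phi> s) \<partial>lebesgue)"
      by (rule int(3) [OF \<psi> fw])
  qed
qed

end
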